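(* Let $k$ be an infinite field, $R=k[x_1,\ldots,x_m]$, $I\subset R$ a homogeneous ideal, $A=R/I$ and $d=\dim A$. Let $v=\{v_{ij}\mid i=m-d+1,\ldots,m,\ j=1,\ldots,m-d\}$ be a set of new indeterminates and $R'=k(v)[x_1,\ldots,x_{m-d}]$. Let $I'\subset R'$ be the ideal generated by the elements obtained from the elements of $I$ by the substitution $$x_i=v_{i1}x_1+\cdots+v_{i\,m-d}\,x_{m-d},\qquad i=m-d+1,\ldots,m.$$ Then $r(A)$ is the largest integer $n$ such that $(R'/I')_n\neq0$.
   Context: $A=R/I$ is a standard graded $k$-algebra (so $I$ is proper). A reduction of $A$ is an ideal $Q$ generated by linear forms (elements of $A_1$) such that $Q_n=A_n$ for all large $n$. The reduction number $r_Q(A)$ of $A$ with respect to $Q$ is the least $n\ge0$ with $Q_{n+1}=A_{n+1}$. A reduction is minimal if it contains no other reduction (equivalently, it is a reduction generated by $d=\dim A$ linear forms). The reduction number is $r(A)=\min\{r_Q(A)\mid Q\text{ a minimal reduction of }A\}$. The ring $R'$ is graded by $\deg x_i=1$. *)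

theory Defs
  imports
    "HOL-Algebra.QuotRing"
    "HOL-Computational_Algebra.Fraction_Field"
    "HOL-Library.Poly_Mapping"
    "HOL-Library.Product_Lexorder"
    "HOL-Library.Extended_Nat"
begin

text \<open>
  Polynomials are finitely supported maps from monomials (finitely supported exponent
  vectors) to coefficients. The type provides all indeterminates of index type \<open>'v\<close> at
  once; the set of indeterminates actually in use is cut out by the carrier below.
  (The lexicographic order on pairs is imported only because the integral domain instance
  for polynomials needs a linear order on the indices of the indeterminates.)
\<close>

type_synonym ('v, 'a) mpoly = "('v \<Rightarrow>\<^sub>0 nat) \<Rightarrow>\<^sub>0 'a"

definition indet :: "'v \<Rightarrow> ('v, 'a::zero_neq_one) mpoly" where
  "indet i = Poly_Mapping.single (Poly_Mapping.single i 1) 1"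

definition const :: "'a::zero \<Rightarrow> ('v, 'a) mpoly" where
  "const a = Poly_Mapping.single 0 a"

definition mon_degree :: "('v \<Rightarrow>\<^sub>0 nat) \<Rightarrow> nat" where
  "mon_degree t = (\<Sum>i\<in>Poly_Mapping.keys t. Poly_Mapping.lookup t i)"

text \<open>The ring \<open>K[V]\<close>, for \<open>K\<close> (the carrier of) a subring of the coefficient type.\<close>

definition mpoly_ring :: "'a::comm_ring_1 set \<Rightarrow> 'v set \<Rightarrow> ('v, 'a) mpoly ring" where
  "mpoly_ring K V =
    \<lparr>carrier = {p. range (Poly_Mapping.lookup p) \<subseteq> K \<and>
                   (\<forall>t\<in>Poly_Mapping.keys p. Poly_Mapping.keys t \<subseteq> V)},
     monoid.mult = (*), one = 1, zero = 0, add = (+)\<rparr>"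

text \<open>The value of a polynomial at \<open>x\<close>, with coefficients mapped along \<open>c\<close>.\<close>

definition eval_mpoly :: "('a::zero \<Rightarrow> 'b::comm_semiring_1) \<Rightarrow> ('v \<Rightarrow> 'b) \<Rightarrow> ('v, 'a) mpoly \<Rightarrow> 'b"
  where "eval_mpoly c x p =
    (\<Sum>t\<in>Poly_Mapping.keys p. c (Poly_Mapping.lookup p t) *
       (\<Prod>i\<in>Poly_Mapping.keys t. x i ^ Poly_Mapping.lookup t i))"

text \<open>The \<open>n\<close>-th graded piece of \<open>K[V]\<close> (zero included).\<close>

definition forms :: "'a::comm_ring_1 set \<Rightarrow> 'v set \<Rightarrow> nat \<Rightarrow> ('v, 'a) mpoly set" where
  "forms K V n = {p \<in> carrier (mpoly_ring K V). \<forall>t\<in>Poly_Mapping.keys p. mon_degree t = n}"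

definition homogeneous_ideal :: "'a::comm_ring_1 set \<Rightarrow> 'v set \<Rightarrow> ('v, 'a) mpoly set \<Rightarrow> bool" where
  "homogeneous_ideal K V I \<longleftrightarrow>
    (\<exists>S. S \<subseteq> (\<Union>n. forms K V n) \<and> I = Idl\<^bsub>mpoly_ring K V\<^esub> S)"

text \<open>The \<open>n\<close>-th graded piece of \<open>K[V]/I\<close>: the classes of the forms of degree \<open>n\<close>.\<close>

definition quot_piece ::
    "'a::comm_ring_1 set \<Rightarrow> 'v set \<Rightarrow> ('v, 'a) mpoly set \<Rightarrow> nat \<Rightarrow> ('v, 'a) mpoly set set" where
  "quot_piece K V I n = (\<lambda>f. I +>\<^bsub>mpoly_ring K V\<^esub> f) ` forms K V n"

definition krull_dim :: "('c, 'e) ring_scheme \<Rightarrow> enat" where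
  "krull_dim A = Sup {enat n | n. \<exists>P :: nat \<Rightarrow> 'c set.
     (\<forall>i\<le>n. primeideal (P i) A) \<and> (\<forall>i<n. P i \<subset> P (Suc i))}"

text \<open>
  In the following, \<open>G n\<close> is the \<open>n\<close>-th graded piece of the graded ring \<open>A\<close>. The ideals
  considered are generated by elements of \<open>G 1\<close>, hence homogeneous, so their
  piece of degree \<open>n\<close> is the intersection with \<open>G n\<close>.
\<close>

definition is_reduction :: "('c, 'e) ring_scheme \<Rightarrow> (nat \<Rightarrow> 'c set) \<Rightarrow> 'c set \<Rightarrow> bool" where
  "is_reduction A G Q \<longleftrightarrow>
    (\<exists>L. L \<subseteq> G 1 \<and> Q = Idl\<^bsub>A\<^esub> L) \<and> (\<exists>N. \<forall>n\<ge>N. Q \<inter> G n = G n)"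

definition is_minimal_reduction :: "('c, 'e) ring_scheme \<Rightarrow> (nat \<Rightarrow> 'c set) \<Rightarrow> 'c set \<Rightarrow> bool" where
  "is_minimal_reduction A G Q \<longleftrightarrow>
    is_reduction A G Q \<and> (\<forall>Q'. is_reduction A G Q' \<and> Q' \<subseteq> Q \<longrightarrow> Q' = Q)"

definition reduction_number_wrt :: "(nat \<Rightarrow> 'c set) \<Rightarrow> 'c set \<Rightarrow> nat" where
  "reduction_number_wrt G Q = (LEAST n. Q \<inter> G (n + 1) = G (n + 1))"

definition reduction_number :: "('c, 'e) ring_scheme \<Rightarrow> (nat \<Rightarrow> 'c set) \<Rightarrow> nat" where
  "reduction_number A G = (LEAST r. \<exists>Q. is_minimal_reduction A G Q \<and> r = reduction_number_wrt G Q)"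

text \<open>The field of rational functions over \<open>'a\<close> in the indeterminates from \<open>W\<close>.\<close>

definition ratfuns :: "'w::linorder set \<Rightarrow> ('w, 'a::field) mpoly fract set" where
  "ratfuns W = {Fraction_Field.Fract p q | p q.
     p \<in> carrier (mpoly_ring UNIV W) \<and> q \<in> carrier (mpoly_ring UNIV W) \<and> q \<noteq> 0}"

definition gen_indices :: "nat \<Rightarrow> nat \<Rightarrow> (nat \<times> nat) set" where
  "gen_indices m d = {m - d + 1..m} \<times> {1..m - d}"

text \<open>
  The substitution \<open>x\<^sub>i = (\<Sum>j = 1..m - d. v\<^sub>i\<^sub>j x\<^sub>j)\<close> for \<open>i > m - d\<close>;
  the indeterminate \<open>v\<^sub>i\<^sub>j\<close> is \<open>indet (i, j)\<close>, viewed in the fraction field.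
\<close>

definition gen_subst ::
    "nat \<Rightarrow> nat \<Rightarrow> (nat, 'a::field) mpoly \<Rightarrow> (nat, (nat \<times> nat, 'a) mpoly fract) mpoly" where
  "gen_subst m d =
    eval_mpoly (\<lambda>a. const (Fraction_Field.Fract (const a) 1))
      (\<lambda>i. if i \<le> m - d then indet i
           else (\<Sum>j = 1..m - d. const (Fraction_Field.Fract (indet (i, j)) 1) * indet j))"

end

theory Submission
  imports Defs "HOL-Computational_Algebra.Polynomial"
begin

text \<open>
  Write \<open>n\<close>-reducing for a \<open>d\<close>-tuple of linear forms which together with \<open>I\<close> generates all forms of
  degree \<open>n\<close>. Being \<open>n\<close>-reducing is an open condition on the tuple: the matrix expressing it is
  the identity at one point of the parameter space, so by Nakayama's lemma it is invertible after
  multiplying with a polynomial in the parameters that does not vanish there. Over an infinite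
  field one may therefore move an \<open>n\<close>-reducing tuple into the shape
  \<open>x\<^sub>i - (\<Sum>j. a\<^sub>i\<^sub>j x\<^sub>j)\<close>, and such a tuple exists for some \<open>a\<close> iff the generic one,
  with \<open>a\<^sub>i\<^sub>j = v\<^sub>i\<^sub>j\<close>, is \<open>n\<close>-reducing, i.e. iff \<open>(R'/I')\<^sub>n = 0\<close>.

  It remains to see that the minimal reductions are exactly the reductions generated by \<open>d\<close>
  linear forms. If \<open>e\<close> forms suffice, then \<open>R/I\<close> has at most \<open>O(n\<^sup>e)\<close> dimensions up to degree \<open>n\<close>,
  whereas elements \<open>f\<^sub>i \<in> P\<^sub>i\<^sub>+\<^sub>1 - P\<^sub>i\<close> picked along a chain of primes are algebraically
  independent; hence \<open>d \<le> e\<close>. Conversely, if no \<open>e\<close> forms from a given reduction suffice, a homogeneous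
  ideal maximal with this property is prime, and iterating this modulo a further linear form
  of the reduction yields a chain of primes of length \<open>e + 1\<close>; hence every reduction contains one
  generated by \<open>d\<close> forms.
\<close>

text \<open>Openness is handled without determinants or a topology on the tuples. It enters through
  \<open>nakayama\<close>, applied with a ring \<open>S\<close> of parameters, the ideal
  \<open>M\<close> of parameters vanishing at the known good point, and a module \<open>W\<close> in
  which the monomials are to be placed; the resulting \<open>D\<close> has value 1 at that point,
  hence is nonzero. Between two tuples a pencil with one parameter is enough, since two nonzero
  polynomials over an infinite field have a common non-root. From a special point to the generic
  one, \<open>S\<close> is k[v]. The way back is by clearing denominators and choosing a point where
  none of them vanishes. To solve for the last variables, a tuple must also generate all linear
  forms modulo x_1, ..., x_(m-d). This is again a reducing condition, for the ideal (x_1, ...,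
  x_(m-d)) in degree 1, which is one reason why \<open>common_reduction\<close> treats two ideals;
  the other is the primality proof, with the ideals P + (f) and P + (g). The perturbation stays
  inside a linear space \<open>L\<close> of forms. With \<open>L\<close> the linear forms lying in a
  given reduction, smaller reductions can be found inside it.\<close>

section \<open>Linear algebra\<close>

text \<open>The determinant trick, eliminating one generator at a time. Modulo \<open>W\<close> the
  relation for \<open>z\<close> expresses (1 - c z) e z by the remaining generators; multiplying the
  other relations by 1 - c z removes \<open>z\<close> from them, at the price of that factor in
  \<open>D\<close>. Nothing is inverted, so all that is known of \<open>D\<close> is that it is 1
  modulo \<open>M\<close>.\<close>

lemma nakayama:
  fixes e :: "'i \<Rightarrow> 'b::comm_ring_1"
  assumes "finite T"
    and S: "1 \<in> S" "\<And>x y. x \<in> S \<Longrightarrow> y \<in> S \<Longrightarrow> x - y \<in> S" "\<And>x y. x \<in> S \<Longrightarrow> y \<in> S \<Longrightarrow> x * y \<in> S"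
    and M: "M \<subseteq> S" "0 \<in> M" "\<And>x y. x \<in> M \<Longrightarrow> y \<in> M \<Longrightarrow> x + y \<in> M" "\<And>s x. s \<in> S \<Longrightarrow> x \<in> M \<Longrightarrow> s * x \<in> M"
    and W: "0 \<in> W" "\<And>x y. x \<in> W \<Longrightarrow> y \<in> W \<Longrightarrow> x + y \<in> W" "\<And>s x. s \<in> S \<Longrightarrow> x \<in> W \<Longrightarrow> s * x \<in> W"
    and "\<And>t. t \<in> T \<Longrightarrow> \<exists>c. (\<forall>u\<in>T. c u \<in> M) \<and> e t - (\<Sum>u\<in>T. c u * e u) \<in> W"
  shows "\<exists>D\<in>S. 1 - D \<in> M \<and> (\<forall>t\<in>T. D * e t \<in> W)"
  using assms(1,12)
proof (induction T rule: finite_induct)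
  case empty
  show ?case by (rule bexI[of _ 1]) (use M S in auto)
next
  case (insert z T)
  obtain c where c: "\<And>u. u \<in> insert z T \<Longrightarrow> c u \<in> M"
    and "e z - (\<Sum>u\<in>insert z T. c u * e u) \<in> W"
    using insert.prems[of z] by auto
  define a where "a = 1 - c z"
  have "a * e z - (\<Sum>u\<in>T. c u * e u) = e z - (\<Sum>u\<in>insert z T. c u * e u)"
    using insert.hyps by (simp add: a_def algebra_simps)
  then have cW: "a * e z - (\<Sum>u\<in>T. c u * e u) \<in> W"
    using \<open>e z - _ \<in> W\<close> by simp
  have aS: "a \<in> S" using c M(1) S by (auto simp: a_def)
  have "\<exists>c'. (\<forall>u\<in>T. c' u \<in> M) \<and> e t - (\<Sum>u\<in>T. c' u * e u) \<in> W" if t: "t \<in> T" for t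
  proof -
    obtain b where b: "\<And>u. u \<in> insert z T \<Longrightarrow> b u \<in> M"
      and "e t - (\<Sum>u\<in>insert z T. b u * e u) \<in> W"
      using insert.prems[of t] t by auto
    then have bW: "e t - b z * e z - (\<Sum>u\<in>T. b u * e u) \<in> W"
      using insert.hyps by (simp add: diff_diff_eq)
    \<comment> \<open>Multiplying the relation for \<open>t\<close> by \<open>a\<close> leaves a * e
      t on the left; moving its part - c z * e t to the right gives the last summand.\<close>
    define c' where "c' u = a * b u + b z * c u + (if u = t then c z else 0)" for u
    have "c' u \<in> M" if "u \<in> T" for u
      unfolding c'_def using that b c aS M by (intro M(3) M(4)) auto
    moreover have "a * (e t - b z * e z - (\<Sum>u\<in>T. b u * e u)) + b z * (a * e z - (\<Sum>u\<in>T. c u * e u)) \<in> W"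
      using b M(1) by (intro W(2,3) bW cW aS) auto
    moreover have "(\<Sum>u\<in>T. c' u * e u) = a * (\<Sum>u\<in>T. b u * e u) + b z * (\<Sum>u\<in>T. c u * e u) + c z * e t"
    proof -
      have "(\<Sum>u\<in>T. c' u * e u) = (\<Sum>u\<in>T. a * (b u * e u) + b z * (c u * e u) + (if u = t then c z * e t else 0))"
        by (rule sum.cong) (auto simp: c'_def algebra_simps)
      then show ?thesis using t insert.hyps by (simp add: sum.distrib sum_distrib_left)
    qed
    then have "a * (e t - b z * e z - (\<Sum>u\<in>T. b u * e u)) + b z * (a * e z - (\<Sum>u\<in>T. c u * e u)) =
      e t - (\<Sum>u\<in>T. c' u * e u)"
      by (simp add: a_def algebra_simps)
    ultimately show ?thesis by metis
  qed
  then obtain D where D: "D \<in> S" "1 - D \<in> M" "\<And>t. t \<in> T \<Longrightarrow> D * e t \<in> W"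
    using insert.IH by metis
  have sum_W: "sum f A \<in> W" if "\<And>u. u \<in> A \<Longrightarrow> f u \<in> W" for f and A :: "'i set"
    using that by (induction A rule: infinite_finite_induct) (auto intro: W)
  have sumW: "(\<Sum>u\<in>T. c u * (D * e u)) \<in> W"
    by (rule sum_W, rule W(3)[OF _ D(3)]) (use c M(1) in auto)
  have "D * (a * e z - (\<Sum>u\<in>T. c u * e u)) + (\<Sum>u\<in>T. c u * (D * e u)) \<in> W"
    by (intro W sumW D cW)
  then have "(D * a) * e z \<in> W"
    by (simp add: algebra_simps sum_distrib_left)
  moreover have "(D * a) * e t \<in> W" if "t \<in> T" for t
    using W(3)[OF aS D(3)[OF that]] by (simp add: ac_simps)
  moreover have "1 - D * a = (1 - D) + D * c z" by (simp add: a_def algebra_simps)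
  then have "1 - D * a \<in> M" using M(3)[OF D(2) M(4)[OF D(1) c[of z]]] by (simp only: insertI1)
  ultimately show ?case using S(3)[OF D(1) aS] by blast
qed

text \<open>Gaussian elimination: an equation with a nonzero entry at \<open>p\<close> is solved for
  the unknown \<open>l p\<close> and substituted into the others, which leaves one equation and one
  unknown fewer.\<close>

lemma underdetermined_system:
  fixes a :: "'b \<Rightarrow> 'g \<Rightarrow> 'k::field"
  assumes "finite G" "finite B" "card G < card B"
  shows "\<exists>l. (\<exists>b\<in>B. l b \<noteq> 0) \<and> (\<forall>g\<in>G. (\<Sum>b\<in>B. l b * a b g) = 0)"
  using assms
proof (induction G arbitrary: a B rule: finite_induct)
  case empty
  then have "B \<noteq> {}" by auto
  then show ?case by (intro exI[of _ "\<lambda>_. 1"]) auto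
next
  case (insert z G)
  show ?case
  proof (cases "\<forall>b\<in>B. a b z = 0")
    case True
    then show ?thesis using insert.IH[of B a] insert.prems insert.hyps by auto
  next
    case False
    then obtain p where p: "p \<in> B" "a p z \<noteq> 0" by auto
    define a' where "a' b g = a b g - a b z / a p z * a p g" for b g
    have "card G < card (B - {p})" using insert p by simp
    then obtain l where l: "\<exists>b\<in>B - {p}. l b \<noteq> 0"
      "\<And>g. g \<in> G \<Longrightarrow> (\<Sum>b\<in>B - {p}. l b * a' b g) = 0"
      using insert.IH[of "B - {p}" a'] insert.prems by auto
    define l' where "l' b = (if b = p then - (\<Sum>b\<in>B - {p}. l b * a b z / a p z) else l b)" for b
    have eq: "(\<Sum>b\<in>B. l' b * a b g) = (\<Sum>b\<in>B - {p}. l b * a' b g)" for g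
    proof -
      have "(\<Sum>b\<in>B. l' b * a b g) = l' p * a p g + (\<Sum>b\<in>B - {p}. l' b * a b g)"
        using insert.prems p by (simp add: sum.remove)
      also have "(\<Sum>b\<in>B - {p}. l' b * a b g) = (\<Sum>b\<in>B - {p}. l b * a b g)"
        by (rule sum.cong) (auto simp: l'_def)
      also have "l' p * a p g = (\<Sum>b\<in>B - {p}. - (l b * a b z / a p z * a p g))"
        by (simp add: l'_def sum_distrib_right sum_negf)
      finally show ?thesis
        by (simp add: a'_def sum.distrib[symmetric] algebra_simps)
    qed
    have "(\<Sum>b\<in>B - {p}. l b * a' b z) = 0"
      using p by (simp add: a'_def)
    with l eq have "\<forall>g\<in>insert z G. (\<Sum>b\<in>B. l' b * a b g) = 0" by auto
    moreover have "\<exists>b\<in>B. l' b \<noteq> 0" using l(1) by (auto simp: l'_def)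
    ultimately show ?thesis by blast
  qed
qed

text \<open>Fixing all variables but \<open>w\<close> gives a univariate polynomial with infinitely
  many roots, so its coefficients vanish and the induction continues with them. The exponents are
  functions on an abstract index set \<open>T\<close> because, after grouping by the exponent of
  \<open>w\<close>, the remaining variables alone have to separate the indices.\<close>

lemma vanishing_sum_of_monomials:
  fixes c :: "'t \<Rightarrow> 'a::field" and f :: "'t \<Rightarrow> 'w \<Rightarrow> nat"
  assumes "infinite (UNIV :: 'a set)" "finite W" "finite T"
    and "\<And>s t. s \<in> T \<Longrightarrow> t \<in> T \<Longrightarrow> (\<And>w. w \<in> W \<Longrightarrow> f s w = f t w) \<Longrightarrow> s = t"
    and "\<And>a. (\<Sum>t\<in>T. c t * (\<Prod>w\<in>W. a w ^ f t w)) = 0"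
  shows "\<forall>t\<in>T. c t = 0"
  using assms(2-)
proof (induction W arbitrary: T rule: finite_induct)
  case empty
  show ?case
  proof
    fix t assume t: "t \<in> T"
    then have "T = {t}" using empty by auto
    then show "c t = 0" using empty.prems(3) by simp
  qed
next
  case (insert w W)
  define Tk where "Tk k = {t \<in> T. f t w = k}" for k
  have "(\<Sum>t\<in>Tk k. c t * (\<Prod>v\<in>W. a v ^ f t v)) = 0" for k a
  proof -
    define p where "p = (\<Sum>t\<in>T. monom (c t * (\<Prod>v\<in>W. a v ^ f t v)) (f t w))"
    have "poly p s = 0" for s
    proof -
      have "(\<Prod>v\<in>W. (a(w := s)) v ^ f t v) = (\<Prod>v\<in>W. a v ^ f t v)" for t
        using insert.hyps by (intro prod.cong) auto
      then have "poly p s = (\<Sum>t\<in>T. c t * (\<Prod>v\<in>insert w W. (a(w := s)) v ^ f t v))"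
        using insert.hyps by (simp add: p_def poly_sum poly_monom algebra_simps)
      then show ?thesis using insert.prems(3) by simp
    qed
    then have "p = 0" using assms(1) poly_roots_finite[of p] by auto
    then have "coeff p k = 0" by simp
    moreover have "coeff p k = (\<Sum>t\<in>Tk k. c t * (\<Prod>v\<in>W. a v ^ f t v))"
      unfolding p_def coeff_sum Tk_def using insert.prems(1)
      by (simp add: sum.inter_filter)
    ultimately show ?thesis by simp
  qed
  moreover have "s = t" if "s \<in> Tk k" "t \<in> Tk k" "\<And>v. v \<in> W \<Longrightarrow> f s v = f t v" for s t k
    by (rule insert.prems(2)) (use that in \<open>auto simp: Tk_def\<close>)
  moreover have "finite (Tk k)" for k using insert.prems(1) by (simp add: Tk_def)
  ultimately have "\<forall>t\<in>Tk k. c t = 0" for k using insert.IH[of "Tk k"] by blast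
  then show ?case by (auto simp: Tk_def)
qed

section \<open>Polynomial rings, forms and evaluation\<close>

abbreviation polys :: "'v set \<Rightarrow> ('v, 'a::comm_ring_1) mpoly set" where
  "polys V \<equiv> carrier (mpoly_ring UNIV V)"

abbreviation lookup where "lookup \<equiv> Poly_Mapping.lookup"
abbreviation keys where "keys \<equiv> Poly_Mapping.keys"
abbreviation xmon :: "('v \<Rightarrow>\<^sub>0 nat) \<Rightarrow> ('v, 'a::comm_ring_1) mpoly" where
  "xmon t \<equiv> Poly_Mapping.single t 1"

lemma polys_iff: "p \<in> polys V \<longleftrightarrow> (\<forall>t\<in>keys p. keys t \<subseteq> V)"
  by (simp add: mpoly_ring_def)

lemma mpoly_ring_simps [simp]:
  "monoid.mult (mpoly_ring K V) = (*)" "monoid.one (mpoly_ring K V) = 1"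
  "ring.zero (mpoly_ring K V) = 0" "ring.add (mpoly_ring K V) = (+)"
  by (auto simp: mpoly_ring_def)

lemma mpoly_sum_xmons: "p = (\<Sum>t\<in>keys p. Poly_Mapping.single t (lookup p t))"
  by (rule poly_mapping_eqI)
    (simp add: lookup_sum lookup_single when_def in_keys_iff)

lemma const_simps [simp]:
  "const 0 = 0" "const 1 = (1 :: ('v, 'a::comm_ring_1) mpoly)"
  "const (a + b) = const a + const b" "const (a * b) = (const a * const b :: ('v, 'a) mpoly)"
  "const (- a) = (- const a :: ('v, 'a) mpoly)" "const (a - b) = (const a - const b :: ('v, 'a) mpoly)"
  by (simp_all add: const_def single_add mult_single single_uminus single_diff)

lemma const_times_single: "const a * Poly_Mapping.single t b = Poly_Mapping.single t (a * b)"
  by (simp add: const_def mult_single)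

lemma lookup_const_mult [simp]: "lookup (const a * p) t = a * lookup p t"
proof -
  have "const a * p = (\<Sum>s\<in>keys p. Poly_Mapping.single s (a * lookup p s))"
    by (subst mpoly_sum_xmons[of p]) (simp add: sum_distrib_left const_times_single)
  then show ?thesis
    by (simp add: lookup_sum lookup_single when_def in_keys_iff)
qed

lemma const_eq_iff [simp]: "const a = const b \<longleftrightarrow> a = b"
  unfolding const_def by (metis lookup_single_eq)

lemma const_sum: "const (sum f A) = (\<Sum>x\<in>A. const (f x :: 'a::comm_ring_1))"
  by (induction A rule: infinite_finite_induct) auto

lemma keys_const_mult: "keys (const a * p) \<subseteq> keys p"
  by (auto simp: in_keys_iff)

lemma polys_closed [intro, simp]:
  "0 \<in> polys V" "1 \<in> polys V"
  "p \<in> polys V \<Longrightarrow> q \<in> polys V \<Longrightarrow> p + q \<in> polys V"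
  "p \<in> polys V \<Longrightarrow> - p \<in> polys V"
  "p \<in> polys V \<Longrightarrow> q \<in> polys V \<Longrightarrow> p - q \<in> polys V"
  "const a \<in> polys V"
proof -
  show "0 \<in> polys V" "1 \<in> polys V" by (auto simp: polys_iff)
  show "p \<in> polys V \<Longrightarrow> q \<in> polys V \<Longrightarrow> p + q \<in> polys V" 
    using Poly_Mapping.keys_add[of p q] by (fastforce simp: polys_iff)
  show "p \<in> polys V \<Longrightarrow> - p \<in> polys V"
    by (auto simp: polys_iff in_keys_iff)
  show "p \<in> polys V \<Longrightarrow> q \<in> polys V \<Longrightarrow> p - q \<in> polys V"
    using keys_diff[of p q] unfolding polys_iff by blast
  show "const a \<in> polys V" by (auto simp: polys_iff const_def)
qed

lemma keys_plus_nat: "keys (s + t) = keys s \<union> keys (t :: 'v \<Rightarrow>\<^sub>0 nat)"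
  by (auto simp: in_keys_iff lookup_add)

lemma polys_mult [intro, simp]:
  assumes "p \<in> polys V" "q \<in> polys V"
  shows "p * q \<in> polys V"
  unfolding polys_iff
proof
  fix t assume "t \<in> keys (p * q)"
  then obtain a b where "t = a + b" "a \<in> keys p" "b \<in> keys q"
    using keys_mult[of p q] by blast
  then show "keys t \<subseteq> V"
    using assms by (auto simp: polys_iff keys_plus_nat)
qed

lemma polys_power [intro, simp]: "p \<in> polys V \<Longrightarrow> p ^ n \<in> polys V"
  by (induction n) auto

lemma polys_sum [intro]: "(\<And>x. x \<in> A \<Longrightarrow> f x \<in> polys V) \<Longrightarrow> sum f A \<in> polys V"
  by (induction A rule: infinite_finite_induct) auto

lemma polys_prod [intro]: "(\<And>x. x \<in> A \<Longrightarrow> f x \<in> polys V) \<Longrightarrow> prod f A \<in> polys V"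
  by (induction A rule: infinite_finite_induct) auto

lemma single_polys [simp]: "keys t \<subseteq> V \<Longrightarrow> Poly_Mapping.single t a \<in> polys V"
  by (simp add: polys_iff)

lemma indet_polys [simp]: "i \<in> V \<Longrightarrow> indet i \<in> polys V"
  by (simp add: indet_def)

lemma mon_degree_superset:
  "finite A \<Longrightarrow> keys t \<subseteq> A \<Longrightarrow> mon_degree t = (\<Sum>i\<in>A. lookup t i)"
  unfolding mon_degree_def by (rule sum.mono_neutral_left) (auto simp: in_keys_iff)

lemma mon_degree_plus [simp]: "mon_degree (s + t) = mon_degree s + mon_degree t"
proof -
  let ?A = "keys s \<union> keys t"
  have "mon_degree (s + t) = (\<Sum>i\<in>?A. lookup (s + t) i)" "mon_degree s = (\<Sum>i\<in>?A. lookup s i)"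
    "mon_degree t = (\<Sum>i\<in>?A. lookup t i)"
    by (rule mon_degree_superset; simp add: keys_plus_nat)+
  then show ?thesis by (simp add: lookup_add sum.distrib)
qed

lemma mon_degree_simps [simp]: "mon_degree 0 = 0" "mon_degree (Poly_Mapping.single i n) = n"
  by (simp_all add: mon_degree_def)

lemma mon_degree_0_iff [simp]: "mon_degree t = 0 \<longleftrightarrow> t = 0"
  unfolding mon_degree_def by (auto simp: in_keys_iff intro: poly_mapping_eqI)

lemma mon_degree_SucE:
  assumes "mon_degree t = Suc n"
  obtains i u where "t = Poly_Mapping.single i 1 + u" "mon_degree u = n"
proof -
  have "t \<noteq> 0" using assms by auto
  then obtain i where i: "i \<in> keys t" by fastforce
  define u where "u = t - Poly_Mapping.single i 1"
  have "t = Poly_Mapping.single i 1 + u"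
    by (rule poly_mapping_eqI) (use i in \<open>auto simp: u_def lookup_add lookup_minus lookup_single when_def in_keys_iff\<close>)
  with assms show thesis by (intro that) auto
qed

lemma mon_degree_split:
  assumes "mon_degree t = a + b"
  obtains u v where "t = u + v" "mon_degree u = a" "mon_degree v = b"
  using assms
proof (induction a arbitrary: t thesis)
  case 0
  then show ?case by (metis add_0 mon_degree_simps(1))
next
  case (Suc a)
  then obtain i t' where t': "t = Poly_Mapping.single i 1 + t'" "mon_degree t' = a + b"
    by (auto elim: mon_degree_SucE)
  obtain u v where "t' = u + v" "mon_degree u = a" "mon_degree v = b" using Suc.IH t' by metis
  then show ?case using Suc.prems(1)[of "Poly_Mapping.single i 1 + u" v] t' by (simp add: add.assoc)
qed

definition xmons :: "'v set \<Rightarrow> nat \<Rightarrow> ('v \<Rightarrow>\<^sub>0 nat) set" where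
  "xmons V n = {t. keys t \<subseteq> V \<and> mon_degree t = n}"

lemma finite_xmons: "finite V \<Longrightarrow> finite (xmons V n)"
proof (induction n)
  case 0
  have "xmons V 0 \<subseteq> {0}" by (auto simp: xmons_def)
  then show ?case using finite_subset by blast
next
  case (Suc n)
  have "xmons V (Suc n) \<subseteq> (\<lambda>(i, u). Poly_Mapping.single i 1 + u) ` (V \<times> xmons V n)"
  proof
    fix t assume t: "t \<in> xmons V (Suc n)"
    then obtain i u where "t = Poly_Mapping.single i 1 + u" "mon_degree u = n"
      by (auto simp: xmons_def elim: mon_degree_SucE)
    with t show "t \<in> (\<lambda>(i, u). Poly_Mapping.single i 1 + u) ` (V \<times> xmons V n)"
      by (auto simp: xmons_def keys_plus_nat)
  qed
  with Suc show ?case by (meson finite_SigmaI finite_imageI finite_subset)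
qed

abbreviation F :: "'v set \<Rightarrow> nat \<Rightarrow> ('v, 'a::comm_ring_1) mpoly set" where
  "F V n \<equiv> forms UNIV V n"

lemma F_iff: "p \<in> F V n \<longleftrightarrow> keys p \<subseteq> xmons V n"
  by (auto simp: forms_def xmons_def polys_iff)

lemma F_polys: "p \<in> F V n \<Longrightarrow> p \<in> polys V"
  by (auto simp: forms_def)

lemma F_closed [intro, simp]:
  "0 \<in> F V n"
  "p \<in> F V n \<Longrightarrow> q \<in> F V n \<Longrightarrow> p + q \<in> F V n"
  "p \<in> F V n \<Longrightarrow> - p \<in> F V n"
  "p \<in> F V n \<Longrightarrow> q \<in> F V n \<Longrightarrow> p - q \<in> F V n"
  "p \<in> F V n \<Longrightarrow> const a * p \<in> F V n"
  "const a \<in> F V 0" "1 \<in> F V 0"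
proof -
  show "p \<in> F V n \<Longrightarrow> q \<in> F V n \<Longrightarrow> p + q \<in> F V n" 
    using Poly_Mapping.keys_add[of p q] by (fastforce simp: F_iff)
  show "p \<in> F V n \<Longrightarrow> - p \<in> F V n"
    by (simp add: F_iff)
  show "p \<in> F V n \<Longrightarrow> q \<in> F V n \<Longrightarrow> p - q \<in> F V n"
    using keys_diff[of p q] unfolding F_iff by blast
  show "p \<in> F V n \<Longrightarrow> const a * p \<in> F V n" using keys_const_mult[of a p] by (auto simp: F_iff)
  show *: "const a \<in> F V 0" for a
    by (cases "a = 0") (simp_all add: F_iff const_def xmons_def)
  show "1 \<in> F V 0" using *[of 1] by simp
qed (simp add: F_iff)

lemma F_mult [intro]:
  assumes "p \<in> F V a" "q \<in> F V b"
  shows "p * q \<in> F V (a + b)"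
  unfolding F_iff
proof
  fix t assume "t \<in> keys (p * q)"
  then obtain u v where "t = u + v" "u \<in> keys p" "v \<in> keys q"
    using keys_mult[of p q] by blast
  then show "t \<in> xmons V (a + b)"
    using assms by (auto simp: F_iff xmons_def keys_plus_nat)
qed

lemma F_sum [intro]: "(\<And>x. x \<in> A \<Longrightarrow> f x \<in> F V n) \<Longrightarrow> sum f A \<in> F V n"
  by (induction A rule: infinite_finite_induct) auto

lemma xmon_F: "t \<in> xmons V n \<Longrightarrow> xmon t \<in> F V n"
  by (simp add: F_iff)

lemma F_expand:
  assumes "p \<in> F V n" "finite V"
  shows "p = (\<Sum>t\<in>xmons V n. const (lookup p t) * xmon t)"
proof (rule poly_mapping_eqI)
  fix s
  show "lookup p s = lookup (\<Sum>t\<in>xmons V n. const (lookup p t) * xmon t) s"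
    using assms finite_xmons[OF assms(2), of n]
    by (auto simp: lookup_sum lookup_single when_def F_iff in_keys_iff if_distrib[of "(*) _"] cong: if_cong)
qed

lemma F0_const:
  assumes "p \<in> F V 0" shows "p = const (lookup p 0)"
  by (rule poly_mapping_eqI)
    (use assms in \<open>auto simp: F_iff xmons_def const_def lookup_single when_def in_keys_iff\<close>)

lemma indet_F: "i \<in> V \<Longrightarrow> indet i \<in> F V 1"
  by (simp add: indet_def F_iff xmons_def)

definition hom_part :: "nat \<Rightarrow> ('v, 'a::comm_ring_1) mpoly \<Rightarrow> ('v, 'a) mpoly" where
  "hom_part n p = (\<Sum>t\<in>{t \<in> keys p. mon_degree t = n}. Poly_Mapping.single t (lookup p t))"

lemma lookup_hom_part: "lookup (hom_part n p) t = (if mon_degree t = n then lookup p t else 0)"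
  by (auto simp: hom_part_def lookup_sum lookup_single when_def in_keys_iff)

lemma hom_part_F [intro, simp]: "p \<in> polys V \<Longrightarrow> hom_part n p \<in> F V n"
  by (fastforce simp: F_iff polys_iff xmons_def in_keys_iff lookup_hom_part split: if_splits)

lemma hom_part_simps [simp]:
  "hom_part n 0 = 0" "hom_part n (p + q) = hom_part n p + hom_part n q" "hom_part n (p - q) = hom_part n p - hom_part n q"
  by (rule poly_mapping_eqI; simp add: lookup_hom_part lookup_add lookup_minus)+

lemma hom_part_sum: "hom_part n (sum f A) = (\<Sum>x\<in>A. hom_part n (f x))"
  by (induction A rule: infinite_finite_induct) auto

lemma hom_part_of_F: "p \<in> F V m \<Longrightarrow> hom_part n p = (if m = n then p else 0)"
  by (rule poly_mapping_eqI) (auto simp: lookup_hom_part F_iff xmons_def in_keys_iff)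

definition deg_le :: "nat \<Rightarrow> ('v, 'a::comm_ring_1) mpoly \<Rightarrow> bool" where
  "deg_le n p \<longleftrightarrow> (\<forall>t\<in>keys p. mon_degree t \<le> n)"

lemma deg_le_exists: "\<exists>n. deg_le n p"
proof (intro exI)
  show "deg_le (\<Sum>t\<in>keys p. mon_degree t) p"
    unfolding deg_le_def using member_le_sum[of _ "keys p" mon_degree] by auto
qed

lemma deg_le_mono: "deg_le n p \<Longrightarrow> n \<le> m \<Longrightarrow> deg_le m p"
  by (auto simp: deg_le_def)

lemma deg_le_one [simp]: "deg_le n 1"
  by (simp add: deg_le_def)

lemma deg_le_mult:
  assumes "deg_le a p" "deg_le b q" shows "deg_le (a + b) (p * q)"
  unfolding deg_le_def
proof
  fix t assume "t \<in> keys (p * q)"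
  then obtain u v where "t = u + v" "u \<in> keys p" "v \<in> keys q"
    using keys_mult[of p q] by blast
  then show "mon_degree t \<le> a + b"
    using assms by (force simp: deg_le_def)
qed

lemma deg_le_power: "deg_le a p \<Longrightarrow> deg_le (n * a) (p ^ n)"
  by (induction n) (auto intro: deg_le_mult)

lemma sum_hom_part:
  assumes "deg_le n p" shows "(\<Sum>i\<le>n. hom_part i p) = p"
  by (rule poly_mapping_eqI)
    (use assms in \<open>auto simp: deg_le_def lookup_sum lookup_hom_part in_keys_iff\<close>)

lemma hom_part_F_mult:
  assumes "f \<in> F V a" "q \<in> polys V"
  shows "hom_part n (f * q) = (if a \<le> n then f * hom_part (n - a) q else 0)"
proof -
  obtain N where "deg_le N q" using deg_le_exists by blast
  then have N: "deg_le (N + n) q" by (rule deg_le_mono) simp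
  have "hom_part n (f * q) = (\<Sum>i\<le>N+n. hom_part n (f * hom_part i q))"
    by (subst sum_hom_part[OF N, symmetric]) (simp add: sum_distrib_left hom_part_sum)
  also have "\<dots> = (\<Sum>i\<le>N+n. if i = n - a \<and> a \<le> n then f * hom_part (n - a) q else 0)"
    by (rule sum.cong) (use assms in \<open>auto simp: hom_part_of_F[OF F_mult[OF assms(1) hom_part_F[OF assms(2)]]]\<close>)
  also have "\<dots> = (if a \<le> n then f * hom_part (n - a) q else 0)"
    by (auto simp: sum.delta)
  finally show ?thesis .
qed

lemma hom_part_mult:
  assumes "p \<in> polys V" "q \<in> polys V"
  shows "hom_part n (p * q) = (\<Sum>i\<le>n. hom_part i p * hom_part (n - i) q)"
proof -
  obtain N where "deg_le N p" using deg_le_exists by blast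
  then have N: "deg_le (N + n) p" by (rule deg_le_mono) simp
  have "hom_part n (p * q) = (\<Sum>i\<le>N+n. hom_part n (hom_part i p * q))"
    by (subst sum_hom_part[OF N, symmetric]) (simp add: sum_distrib_right hom_part_sum)
  also have "\<dots> = (\<Sum>i\<le>N+n. if i \<le> n then hom_part i p * hom_part (n - i) q else 0)"
    by (rule sum.cong) (use assms in \<open>auto simp: hom_part_F_mult[OF hom_part_F[OF assms(1)] assms(2)]\<close>)
  also have "\<dots> = (\<Sum>i\<le>n. hom_part i p * hom_part (n - i) q)"
    by (rule sum.mono_neutral_cong_right) auto
  finally show ?thesis .
qed


text \<open>Unital ring homomorphisms between whole types. Evaluation, change of coefficients and
  the embedding of constants are all instances, so that composites of substitutions are covered by
  \<open>eval_comp\<close>.\<close>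

locale coeff_hom =
  fixes c :: "'a::comm_ring_1 \<Rightarrow> 'b::comm_ring_1"
  assumes add [simp]: "c (a + b) = c a + c b"
    and mult [simp]: "c (a * b) = c a * c b"
    and one [simp]: "c 1 = 1"
begin

lemma zero [simp]: "c 0 = 0"
  using add[of 0 0] by simp

lemma minus [simp]: "c (- a) = - c a"
  using add[of a "- a"] by (simp add: eq_neg_iff_add_eq_0 add.commute)

lemma diff [simp]: "c (a - b) = c a - c b"
  using add[of a "- b"] by simp

lemma sum: "c (sum f A) = (\<Sum>x\<in>A. c (f x))"
  by (induction A rule: infinite_finite_induct) auto

end

definition mon_val :: "('v \<Rightarrow> 'b::comm_ring_1) \<Rightarrow> ('v \<Rightarrow>\<^sub>0 nat) \<Rightarrow> 'b" where
  "mon_val x t = (\<Prod>i\<in>keys t. x i ^ lookup t i)"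

lemma mon_val_superset:
  "finite A \<Longrightarrow> keys t \<subseteq> A \<Longrightarrow> mon_val x t = (\<Prod>i\<in>A. x i ^ lookup t i)"
  unfolding mon_val_def by (rule prod.mono_neutral_left) (auto simp: in_keys_iff)

lemma mon_val_0 [simp]: "mon_val x 0 = 1"
  by (simp add: mon_val_def)

lemma mon_val_single [simp]: "mon_val x (Poly_Mapping.single i n) = x i ^ n"
  by (simp add: mon_val_def)

lemma mon_val_plus: "mon_val x (s + t) = mon_val x s * mon_val x t"
proof -
  let ?A = "keys s \<union> keys t"
  have "mon_val x (s + t) = (\<Prod>i\<in>?A. x i ^ lookup (s + t) i)"
    "mon_val x s = (\<Prod>i\<in>?A. x i ^ lookup s i)" "mon_val x t = (\<Prod>i\<in>?A. x i ^ lookup t i)"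
    by (rule mon_val_superset; simp add: keys_plus_nat)+
  then show ?thesis by (simp add: lookup_add power_add prod.distrib)
qed

context coeff_hom
begin

lemma eval_superset:
  "finite A \<Longrightarrow> keys p \<subseteq> A \<Longrightarrow> eval_mpoly c x p = (\<Sum>t\<in>A. c (lookup p t) * mon_val x t)"
  unfolding eval_mpoly_def mon_val_def by (rule sum.mono_neutral_left) (auto simp: in_keys_iff)

lemma eval_single: "eval_mpoly c x (Poly_Mapping.single t a) = c a * mon_val x t"
  by (subst eval_superset[of "{t}"]) auto

lemma eval_add: "eval_mpoly c x (p + q) = eval_mpoly c x p + eval_mpoly c x q"
proof -
  let ?A = "keys p \<union> keys q"
  have "eval_mpoly c x (p + q) = (\<Sum>t\<in>?A. c (lookup (p + q) t) * mon_val x t)"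
    "eval_mpoly c x p = (\<Sum>t\<in>?A. c (lookup p t) * mon_val x t)"
    "eval_mpoly c x q = (\<Sum>t\<in>?A. c (lookup q t) * mon_val x t)"
    using Poly_Mapping.keys_add[of p q] by (auto intro!: eval_superset)
  then show ?thesis by (simp add: lookup_add sum.distrib distrib_right)
qed

lemma eval_zero [simp]: "eval_mpoly c x 0 = 0"
  by (simp add: eval_mpoly_def)

lemma eval_sum: "eval_mpoly c x (sum f A) = (\<Sum>a\<in>A. eval_mpoly c x (f a))"
  by (induction A rule: infinite_finite_induct) (auto simp: eval_add)

lemma eval_mult: "eval_mpoly c x (p * q) = eval_mpoly c x p * eval_mpoly c x q"
proof -
  have "eval_mpoly c x (p * q) = eval_mpoly c x ((\<Sum>s\<in>keys p. Poly_Mapping.single s (lookup p s)) *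
      (\<Sum>t\<in>keys q. Poly_Mapping.single t (lookup q t)))"
    by (simp flip: mpoly_sum_xmons)
  also have "\<dots> = (\<Sum>s\<in>keys p. \<Sum>t\<in>keys q.
      (c (lookup p s) * mon_val x s) * (c (lookup q t) * mon_val x t))"
    by (simp add: sum_product eval_sum mult_single eval_single mon_val_plus algebra_simps)
  also have "\<dots> = eval_mpoly c x p * eval_mpoly c x q"
    by (simp add: eval_mpoly_def mon_val_def sum_product)
  finally show ?thesis .
qed

lemma eval_coeff_hom: "coeff_hom (eval_mpoly c x)"
proof
  have "eval_mpoly c x (Poly_Mapping.single 0 1) = 1" unfolding eval_single by simp
  then show "eval_mpoly c x 1 = 1" by simp
qed (simp_all add: eval_add eval_mult)

lemma eval_const: "eval_mpoly c x (const a) = c a"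
  by (simp add: const_def eval_single)

lemma eval_indet: "eval_mpoly c x (indet i) = x i"
  by (simp add: indet_def eval_single)

lemma eval_comp:
  assumes "coeff_hom h" shows "h (eval_mpoly c x p) = eval_mpoly (h \<circ> c) (h \<circ> x) p"
proof -
  interpret h: coeff_hom h by fact
  have pow: "h (a ^ n) = h a ^ n" for a n by (induction n) auto
  have prod: "h (prod f A) = (\<Prod>x\<in>A. h (f x))" for f and A :: "'d set"
    by (induction A rule: infinite_finite_induct) auto
  show ?thesis by (simp add: eval_mpoly_def h.sum prod pow)
qed

lemma eval_cong:
  "(\<And>i. i \<in> V \<Longrightarrow> x i = y i) \<Longrightarrow> p \<in> polys V \<Longrightarrow> eval_mpoly c x p = eval_mpoly c y p"
  unfolding eval_mpoly_def polys_iff by (intro sum.cong arg_cong2[where f = "(*)"] prod.cong refl)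
    (metis subsetD)

lemma eval_polys:
  assumes "\<And>a. c a \<in> S" "\<And>i. i \<in> V \<Longrightarrow> x i \<in> S" "p \<in> polys V"
    and S: "0 \<in> S" "1 \<in> S" "\<And>a b. a \<in> S \<Longrightarrow> b \<in> S \<Longrightarrow> a + b \<in> S" "\<And>a b. a \<in> S \<Longrightarrow> b \<in> S \<Longrightarrow> a * b \<in> S"
  shows "eval_mpoly c x p \<in> S"
proof -
  have pow: "a ^ n \<in> S" if "a \<in> S" for a n using that by (induction n) (auto intro: S)
  have prod: "prod f A \<in> S" if "\<And>x. x \<in> A \<Longrightarrow> f x \<in> S" for f and A :: "'d set"
    using that by (induction A rule: infinite_finite_induct) (auto intro: S)
  have sum: "sum f A \<in> S" if "\<And>x. x \<in> A \<Longrightarrow> f x \<in> S" for f and A :: "('d \<Rightarrow>\<^sub>0 nat) set"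
    using that by (induction A rule: infinite_finite_induct) (auto intro: S)
  show ?thesis unfolding eval_mpoly_def
    using assms(1-3) by (intro sum S(4) prod pow) (auto simp: polys_iff)
qed

end

lemma const_coeff_hom: "coeff_hom (const :: 'a::comm_ring_1 \<Rightarrow> ('v, 'a) mpoly)"
  by unfold_locales auto

lemma id_coeff_hom: "coeff_hom (\<lambda>a. a)"
  by unfold_locales auto

lemma mon_val_indet: "mon_val indet t = (xmon t :: ('v, 'a::comm_ring_1) mpoly)"
proof -
  have pow: "indet i ^ n = (xmon (Poly_Mapping.single i n) :: ('v, 'a) mpoly)" for i n
    by (induction n) (simp_all add: indet_def mult_single flip: single_add)
  have prod: "(\<Prod>i\<in>A. xmon (g i)) = (xmon (\<Sum>i\<in>A. g i) :: ('v, 'a) mpoly)"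
    for A and g :: "'v \<Rightarrow> 'v \<Rightarrow>\<^sub>0 nat"
    by (induction A rule: infinite_finite_induct) (auto simp: mult_single)
  have "(\<Sum>i\<in>keys t. Poly_Mapping.single i (lookup t i)) = t"
    by (rule poly_mapping_eqI) (simp add: lookup_sum lookup_single when_def in_keys_iff)
  then show ?thesis by (simp add: mon_val_def pow prod)
qed

text \<open>Written as an evaluation at the indeterminates, so that multiplicativity is inherited
  from \<open>eval_coeff_hom\<close>; \<open>lookup_map_coeff\<close> recovers the coefficientwise
  description.\<close>

definition map_coeff :: "('a::comm_ring_1 \<Rightarrow> 'b::comm_ring_1) \<Rightarrow> ('v, 'a) mpoly \<Rightarrow> ('v, 'b) mpoly" where
  "map_coeff c = eval_mpoly (\<lambda>a. const (c a)) indet"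

context coeff_hom
begin

lemma const_comp: "coeff_hom (\<lambda>a. const (c a))"
  by unfold_locales auto

lemma map_coeff_hom: "coeff_hom (map_coeff c)"
  unfolding map_coeff_def by (rule coeff_hom.eval_coeff_hom[OF const_comp])

lemma lookup_map_coeff: "lookup (map_coeff c p) t = c (lookup p t)"
proof -
  have "map_coeff c p = (\<Sum>t\<in>keys p. const (c (lookup p t)) * xmon t)"
    unfolding map_coeff_def using coeff_hom.eval_superset[OF const_comp, of "keys p" p indet]
    by (simp add: mon_val_indet)
  then show ?thesis by (auto simp: lookup_sum lookup_single when_def in_keys_iff if_distrib[of "(*) _"] cong: if_cong)
qed

lemma map_coeff_single: "map_coeff c (Poly_Mapping.single t a) = Poly_Mapping.single t (c a)"
  by (rule poly_mapping_eqI) (auto simp: lookup_map_coeff lookup_single when_def)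

lemma map_coeff_const: "map_coeff c (const a) = const (c a)"
  by (simp add: const_def map_coeff_single)

lemma map_coeff_indet: "map_coeff c (indet i) = indet i"
  by (simp add: indet_def map_coeff_single)

end

section \<open>Ideals and generic tuples of linear forms\<close>

text \<open>Ideals as plain sets of polynomials, without the ring record;
  \<open>ideal_iff_pideal\<close> and \<open>primeideal_iff_pprime\<close> give the translation
  later.\<close>

definition pideal :: "'v set \<Rightarrow> ('v, 'a::comm_ring_1) mpoly set \<Rightarrow> bool" where
  "pideal V J \<longleftrightarrow> J \<subseteq> polys V \<and> 0 \<in> J \<and> (\<forall>x\<in>J. \<forall>y\<in>J. x + y \<in> J) \<and> (\<forall>r\<in>polys V. \<forall>x\<in>J. r * x \<in> J)"

definition hideal :: "'v set \<Rightarrow> ('v, 'a::comm_ring_1) mpoly set \<Rightarrow> bool" where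
  "hideal V J \<longleftrightarrow> pideal V J \<and> (\<forall>p\<in>J. \<forall>n. hom_part n p \<in> J)"

definition pprime :: "'v set \<Rightarrow> ('v, 'a::comm_ring_1) mpoly set \<Rightarrow> bool" where
  "pprime V P \<longleftrightarrow> pideal V P \<and> 1 \<notin> P \<and> (\<forall>a\<in>polys V. \<forall>b\<in>polys V. a * b \<in> P \<longrightarrow> a \<in> P \<or> b \<in> P)"

text \<open>This is J + (l 0, ..., l (e - 1)), kept as explicit combinations so that homogeneous
  components of the coefficients can be taken.\<close>

definition idl :: "'v set \<Rightarrow> ('v, 'a::comm_ring_1) mpoly set \<Rightarrow> nat \<Rightarrow> (nat \<Rightarrow> ('v, 'a) mpoly) \<Rightarrow> ('v, 'a) mpoly set" where
  "idl V J e l = {f + (\<Sum>j<e. r j * l j) | f r. f \<in> J \<and> (\<forall>j. r j \<in> polys V)}"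

lemma pidealD:
  assumes "pideal V J"
  shows "J \<subseteq> polys V" "0 \<in> J" "x \<in> J \<Longrightarrow> y \<in> J \<Longrightarrow> x + y \<in> J"
    "r \<in> polys V \<Longrightarrow> x \<in> J \<Longrightarrow> r * x \<in> J" "r \<in> polys V \<Longrightarrow> x \<in> J \<Longrightarrow> x * r \<in> J"
    "x \<in> J \<Longrightarrow> - x \<in> J" "x \<in> J \<Longrightarrow> y \<in> J \<Longrightarrow> x - y \<in> J" "x \<in> J \<Longrightarrow> const a * x \<in> J"
proof -
  show *: "J \<subseteq> polys V" "0 \<in> J" and plus: "x \<in> J \<Longrightarrow> y \<in> J \<Longrightarrow> x + y \<in> J" for x y
    using assms by (auto simp: pideal_def)
  show mult: "r \<in> polys V \<Longrightarrow> x \<in> J \<Longrightarrow> r * x \<in> J" for r x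
    using assms by (auto simp: pideal_def)
  then show "r \<in> polys V \<Longrightarrow> x \<in> J \<Longrightarrow> x * r \<in> J" by (metis mult.commute)
  show neg: "x \<in> J \<Longrightarrow> - x \<in> J" for x
    using mult[of "- 1" x] by auto
  show "x \<in> J \<Longrightarrow> y \<in> J \<Longrightarrow> x - y \<in> J"
    using plus[of x "- y"] neg[of y] by simp
  show "x \<in> J \<Longrightarrow> const a * x \<in> J"
    by (rule mult) auto
qed

lemma pideal_sum: "pideal V J \<Longrightarrow> (\<And>x. x \<in> A \<Longrightarrow> f x \<in> J) \<Longrightarrow> sum f A \<in> J"
  by (induction A rule: infinite_finite_induct) (auto intro: pidealD)

lemma idlI: "f \<in> J \<Longrightarrow> (\<And>j. r j \<in> polys V) \<Longrightarrow> f + (\<Sum>j<e. r j * l j) \<in> idl V J e l"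
  by (auto simp: idl_def)

lemma idl_incl: "f \<in> J \<Longrightarrow> f \<in> idl V J e l"
  using idlI[of f J "\<lambda>_. 0" V l e] by simp

lemma idl_gen:
  assumes "pideal V J" "j < e" shows "l j \<in> idl V J e l"
proof -
  have "(\<Sum>i<e. (if i = j then 1 else 0) * l i) = l j"
    using assms(2) by (simp add: if_distrib[of "\<lambda>x. x * _"] cong: if_cong)
  then show ?thesis
    using idlI[of 0 J "\<lambda>i. if i = j then 1 else 0" V l e] pidealD(2)[OF assms(1)] by auto
qed

lemma idl_least: "pideal V K \<Longrightarrow> J \<subseteq> K \<Longrightarrow> (\<And>j. j < e \<Longrightarrow> l j \<in> K) \<Longrightarrow> idl V J e l \<subseteq> K"
  unfolding idl_def by (auto intro!: pidealD(3) pideal_sum pidealD(4))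

lemma idl_pideal:
  assumes "pideal V J" "\<And>j. j < e \<Longrightarrow> l j \<in> polys V"
  shows "pideal V (idl V J e l)"
  unfolding pideal_def
proof (intro conjI ballI)
  show "0 \<in> idl V J e l" using assms by (auto intro: idl_incl pidealD)
  show "idl V J e l \<subseteq> polys V"
    using assms pidealD(1)[OF assms(1)] by (auto simp: idl_def intro!: polys_closed polys_sum polys_mult)
next
  fix x y assume "x \<in> idl V J e l" "y \<in> idl V J e l"
  then obtain f r g s where x: "x = f + (\<Sum>j<e. r j * l j)" "f \<in> J" "\<And>j. r j \<in> polys V"
    and y: "y = g + (\<Sum>j<e. s j * l j)" "g \<in> J" "\<And>j. s j \<in> polys V"
    by (auto simp: idl_def)
  have "x + y = (f + g) + (\<Sum>j<e. (r j + s j) * l j)"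
    by (simp add: x y sum.distrib distrib_right)
  then show "x + y \<in> idl V J e l"
    using idlI[of "f + g" J "\<lambda>j. r j + s j" V l e] x(2,3) y(2,3) pidealD(3)[OF assms(1)] by auto
next
  fix a x :: "('a, 'b) mpoly" assume a: "a \<in> polys V" and "x \<in> idl V J e l"
  then obtain f r where x: "x = f + (\<Sum>j<e. r j * l j)" "f \<in> J" "\<And>j. r j \<in> polys V"
    by (auto simp: idl_def)
  have "a * x = a * f + (\<Sum>j<e. (a * r j) * l j)"
    by (simp add: x distrib_left sum_distrib_left mult.assoc)
  then show "a * x \<in> idl V J e l"
    using idlI[of "a * f" J "\<lambda>j. a * r j" V l e] x(2,3) a pidealD(4)[OF assms(1)] by auto
qed

lemma hidealD: "hideal V J \<Longrightarrow> pideal V J" "hideal V J \<Longrightarrow> p \<in> J \<Longrightarrow> hom_part n p \<in> J"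
  by (auto simp: hideal_def)

lemma idl_hideal:
  assumes "hideal V J" "\<And>j. j < e \<Longrightarrow> l j \<in> F V (dg j)"
  shows "hideal V (idl V J e l)"
  unfolding hideal_def
proof (intro conjI ballI allI)
  show "pideal V (idl V J e l)"
    using assms by (intro idl_pideal) (auto simp: hideal_def intro: F_polys)
next
  fix p n assume "p \<in> idl V J e l"
  then obtain f r where p: "p = f + (\<Sum>j<e. r j * l j)" "f \<in> J" "\<And>j. r j \<in> polys V"
    by (auto simp: idl_def)
  have "hom_part n p = hom_part n f + (\<Sum>j<e. (if dg j \<le> n then hom_part (n - dg j) (r j) else 0) * l j)"
    unfolding p(1) hom_part_simps hom_part_sum
    by (intro arg_cong2[where f = "(+)"] refl sum.cong)
      (auto simp: mult.commute[of "r _"] hom_part_F_mult[OF assms(2) p(3)] mult.commute)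
  moreover have "hom_part (n - dg j) (r j) \<in> polys V" for j
    using hom_part_F[OF p(3)] by (rule F_polys)
  ultimately show "hom_part n p \<in> idl V J e l"
    using hidealD(2)[OF assms(1) p(2)] by (auto intro!: idlI)
qed

text \<open>Take the component of degree \<open>n\<close> of an arbitrary representation. In degree
  0 the coefficients vanish, which has to be said separately because \<open>n - 1\<close> is
  truncated there.\<close>

lemma F_idl_elem:
  assumes "hideal V J" "\<And>j. j < e \<Longrightarrow> l j \<in> F V 1" "p \<in> F V n" "p \<in> idl V J e l"
  shows "\<exists>f r. f \<in> J \<and> f \<in> F V n \<and> p = f + (\<Sum>j<e. r j * l j) \<and>
    (\<forall>j. r j \<in> F V (n - 1) \<and> (n = 0 \<longrightarrow> r j = 0))"
proof -
  obtain f r where p: "p = f + (\<Sum>j<e. r j * l j)" "f \<in> J" "\<And>j. r j \<in> polys V"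
    using assms(4) by (auto simp: idl_def)
  define s where "s j = (if n = 0 then 0 else hom_part (n - 1) (r j))" for j
  have "p = hom_part n p" using hom_part_of_F[OF assms(3)] by simp
  also have "\<dots> = hom_part n f + (\<Sum>j<e. s j * l j)"
    unfolding p(1) hom_part_simps hom_part_sum s_def
    by (intro arg_cong2[where f = "(+)"] refl sum.cong)
      (auto simp: mult.commute[of "r _"] hom_part_F_mult[OF assms(2) p(3)] mult.commute)
  finally have "p = hom_part n f + (\<Sum>j<e. s j * l j)" .
  moreover have "hom_part n f \<in> J" "hom_part n f \<in> F V n"
    using p(2) assms(1) pidealD(1)[of V J] by (auto simp: hideal_def)
  moreover have "s j \<in> F V (n - 1)" "n = 0 \<Longrightarrow> s j = 0" for j using p(3) by (auto simp: s_def)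
  ultimately show ?thesis by blast
qed

section \<open>Forms of one degree inside an ideal, and their behaviour along a pencil of
  tuples\<close>

lemma F_subset_iff:
  assumes "pideal V J" "finite V"
  shows "F V n \<subseteq> J \<longleftrightarrow> (\<forall>t\<in>xmons V n. xmon t \<in> J)"
proof
  assume "\<forall>t\<in>xmons V n. xmon t \<in> J"
  then show "F V n \<subseteq> J"
    using F_expand[OF _ assms(2)] assms(1) by (metis (no_types, lifting) pidealD(8) pideal_sum subsetI)
qed (auto intro: xmon_F)

lemma F_add_subset:
  assumes "pideal V J" "finite V" and "\<And>t u. t \<in> xmons V a \<Longrightarrow> u \<in> xmons V b \<Longrightarrow> xmon t * xmon u \<in> J"
  shows "F V (a + b) \<subseteq> J"
  unfolding F_subset_iff[OF assms(1,2)]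
proof
  fix t assume t: "t \<in> xmons V (a + b)"
  then obtain u v where "t = u + v" "mon_degree u = a" "mon_degree v = b"
    by (auto simp: xmons_def elim: mon_degree_split)
  with t show "xmon t \<in> J"
    using assms(3)[of u v] by (auto simp: xmons_def keys_plus_nat mult_single)
qed

lemma F_subset_mono:
  assumes "pideal V J" "finite V" "F V n \<subseteq> J" "n \<le> N"
  shows "F V N \<subseteq> J"
proof -
  have "F V (n + (N - n)) \<subseteq> J"
    using assms(3) by (intro F_add_subset[OF assms(1,2)] pidealD(5)[OF assms(1)]) (auto dest: xmon_F intro: F_polys)
  with assms(4) show ?thesis by simp
qed

text \<open>Moving along the pencil changes a represented monomial only by a multiple of
  \<open>s\<close>, which Nakayama's lemma over k[s] absorbs. The bad parameters are then among the
  roots of \<open>D\<close>, and \<open>D\<close> is nonzero because its value at 0 is 1.\<close>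

lemma generic_on_line:
  fixes l :: "nat \<Rightarrow> ('v, 'a::field) mpoly"
  assumes V: "finite V" and J: "hideal V J"
    and l: "\<And>j. j < e \<Longrightarrow> l j \<in> F V 1" and d: "\<And>j. j < e \<Longrightarrow> d j \<in> F V 1"
    and red: "F V n \<subseteq> idl V J e l"
  shows "\<exists>D. D \<noteq> 0 \<and> (\<forall>s. poly D s \<noteq> 0 \<longrightarrow> F V n \<subseteq> idl V J e (\<lambda>j. l j + const s * d j))"
proof -
  let ?W = "\<lambda>s. idl V J e (\<lambda>j. l j + const s * d j)"
  have pidealW: "pideal V (?W s)" for s
    by (rule idl_pideal) (use J l d in \<open>auto simp: hideal_def intro!: F_polys[of _ _ 1] F_closed\<close>)
  have "\<exists>C. C \<in> F V n \<and> (\<forall>s. xmon t + const s * C \<in> ?W s)" if t: "t \<in> xmons V n" for t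
  proof -
    have "xmon t \<in> idl V J e l" using red xmon_F[OF t] by blast
    then obtain f r where fr: "f \<in> J" "xmon t = f + (\<Sum>j<e. r j * l j)"
      "\<And>j. r j \<in> F V (n - 1)" "\<And>j. n = 0 \<Longrightarrow> r j = 0"
      using F_idl_elem[where l = l, OF J l xmon_F[OF t]] by blast
    have "r j * d j \<in> F V n" if "j < e" for j
      using F_mult[OF fr(3)[of j] d[OF that]] fr(4)[of j] by (cases n) auto
    then have dF: "(\<Sum>j<e. r j * d j) \<in> F V n" by (intro F_sum) auto
    \<comment> \<open>Keeping the coefficients \<open>r j\<close> and replacing \<open>l j\<close>
      by l j + s * d j adds exactly \<open>s\<close> times the form that is taken as
      \<open>C t\<close>.\<close>
    have eq: "xmon t + const s * (\<Sum>j<e. r j * d j) = f + (\<Sum>j<e. r j * (l j + const s * d j))" for s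
      by (simp add: fr(2) distrib_left sum.distrib sum_distrib_left ac_simps)
    have "xmon t + const s * (\<Sum>j<e. r j * d j) \<in> ?W s" for s
      unfolding eq by (rule idlI[OF fr(1)]) (rule F_polys[OF fr(3)])
    with dF show ?thesis by blast
  qed
  then have "\<exists>C. \<forall>t\<in>xmons V n. C t \<in> F V n \<and> (\<forall>s. xmon t + const s * C t \<in> ?W s)"
    by (intro bchoice) blast
  then obtain C where C: "\<And>t. t \<in> xmons V n \<Longrightarrow> C t \<in> F V n"
    "\<And>t s. t \<in> xmons V n \<Longrightarrow> xmon t + const s * C t \<in> ?W s" by blast
  define ev :: "'a \<Rightarrow> ('v, 'a poly) mpoly \<Rightarrow> ('v, 'a) mpoly" where "ev s = map_coeff (\<lambda>p. poly p s)" for s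
  have poly_hom: "coeff_hom (\<lambda>p::'a poly. poly p s)" for s by unfold_locales auto
  interpret ev: coeff_hom "ev s" for s
    unfolding ev_def by (rule coeff_hom.map_coeff_hom[OF poly_hom])
  have ev_simps [simp]: "ev s (const p) = const (poly p s)" "ev s (xmon t) = xmon t" for s p t
    by (simp_all add: ev_def coeff_hom.map_coeff_const[OF poly_hom] coeff_hom.map_coeff_single[OF poly_hom])
  \<comment> \<open>\<open>S\<close> is k[s] and \<open>M\<close> is its ideal (s), both embedded as
    constant polynomials.\<close>
  define S :: "('v, 'a poly) mpoly set" where "S = range const"
  define M :: "('v, 'a poly) mpoly set" where "M = const ` {p. poly p 0 = 0}"
  \<comment> \<open>One module over \<open>k[s]\<close> encodes all members of the pencil at once.\<close>
  define W where "W = {p. \<forall>s. ev s p \<in> ?W s}"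
  have "\<exists>D\<in>S. 1 - D \<in> M \<and> (\<forall>t\<in>xmons V n. D * xmon t \<in> W)"
  proof (rule nakayama)
    show "1 \<in> S" unfolding S_def by (metis const_simps(2) rangeI)
    show "x - y \<in> S" "x * y \<in> S" if "x \<in> S" "y \<in> S" for x y
      using that by (auto simp: S_def simp flip: const_simps(4,6))
    show "M \<subseteq> S" "0 \<in> M" by (auto simp: M_def S_def intro: image_eqI[of _ _ 0])
    show "x + y \<in> M" if xy: "x \<in> M" "y \<in> M" for x y
    proof -
      obtain p q where "x = const p" "y = const q" "poly p 0 = 0" "poly q 0 = 0"
        using xy by (auto simp: M_def)
      then show ?thesis unfolding M_def by (intro image_eqI[of _ _ "p + q"]) auto
    qed
    show "s * x \<in> M" if sx: "s \<in> S" "x \<in> M" for s x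
    proof -
      obtain p q where "s = const p" "x = const q" "poly q 0 = 0"
        using sx by (auto simp: M_def S_def)
      then show ?thesis unfolding M_def by (intro image_eqI[of _ _ "p * q"]) auto
    qed
    show "0 \<in> W"
      using pidealD[OF pidealW] by (auto simp: W_def)
    show "x + y \<in> W" if "x \<in> W" "y \<in> W" for x y
      using that pidealD[OF pidealW] by (auto simp: W_def)
    show "s * x \<in> W" if "s \<in> S" "x \<in> W" for s x
      using that pidealD[OF pidealW] by (auto simp: W_def S_def)
    fix t assume t: "t \<in> xmons V n"
    \<comment> \<open>Since xmon t + s * C t lies in the ideal for every \<open>s\<close>, the
      monomial is congruent to a combination of monomials with coefficients - s times those of
      \<open>C t\<close>, hence in (s).\<close>
    define c :: "_ \<Rightarrow> ('v, 'a poly) mpoly" where "c u = const [:0, - lookup (C t) u:]" for u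
    have "ev s (xmon t - (\<Sum>u\<in>xmons V n. c u * xmon u)) = xmon t + const s * C t" for s
    proof -
      have "ev s (\<Sum>u\<in>xmons V n. c u * xmon u) = - const s * (\<Sum>u\<in>xmons V n. const (lookup (C t) u) * xmon u)"
        by (simp add: ev.sum c_def sum_distrib_left sum_negf mult.assoc)
      also have "\<dots> = - (const s * C t)" using F_expand[OF C(1)[OF t] V] by simp
      finally show ?thesis by simp
    qed
    then have "xmon t - (\<Sum>u\<in>xmons V n. c u * xmon u) \<in> W"
      using C(2)[OF t] unfolding W_def by (auto simp del: ev.diff)
    moreover have "c u \<in> M" for u by (simp add: c_def M_def)
    ultimately show "\<exists>c. (\<forall>u\<in>xmons V n. c u \<in> M) \<and> xmon t - (\<Sum>u\<in>xmons V n. c u * xmon u) \<in> W" by blast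
  qed (use finite_xmons[OF V] in auto)
  then obtain D p where Dp: "1 - const D = (const p :: ('v, 'a poly) mpoly)" "poly p 0 = 0"
    and D: "\<And>t. t \<in> xmons V n \<Longrightarrow> const D * xmon t \<in> W"
    unfolding S_def M_def by blast
  have "const (1 - D) = (const p :: ('v, 'a poly) mpoly)" using Dp(1) by simp
  then have "1 - D = p" by (simp only: const_eq_iff)
  then have "1 - poly D 0 = 0" using Dp(2) by auto
  then have "D \<noteq> 0" by auto
  moreover have "F V n \<subseteq> ?W s" if s: "poly D s \<noteq> 0" for s
    unfolding F_subset_iff[OF pidealW V]
  proof
    fix t assume "t \<in> xmons V n"
    then have "const (poly D s) * xmon t \<in> ?W s" using D[of t] by (auto simp: W_def)
    then have "const (inverse (poly D s)) * (const (poly D s) * xmon t) \<in> ?W s"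
      by (rule pidealD(8)[OF pidealW])
    then show "xmon t \<in> ?W s" using s by (simp add: mult.assoc[symmetric] flip: const_simps(4))
  qed
  ultimately show ?thesis by blast
qed

definition linear_space :: "'v set \<Rightarrow> ('v, 'a::comm_ring_1) mpoly set \<Rightarrow> bool" where
  "linear_space V L \<longleftrightarrow> L \<subseteq> F V 1 \<and> 0 \<in> L \<and> (\<forall>x\<in>L. \<forall>y\<in>L. x + y \<in> L) \<and> (\<forall>a. \<forall>x\<in>L. const a * x \<in> L)"

lemma linear_space_F: "linear_space V (F V 1)"
  by (auto simp: linear_space_def)

text \<open>On the line through \<open>l\<close> and \<open>l'\<close> each of the two conditions
  excludes only finitely many points. The second pencil starts at \<open>l'\<close> and runs
  backwards, so its parameter is 1 - s where the first has s.\<close>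

lemma common_reduction:
  fixes l l' :: "nat \<Rightarrow> ('v, 'a::field) mpoly"
  assumes inf: "infinite (UNIV :: 'a set)" and V: "finite V" and L: "linear_space V L"
    and J: "hideal V J" "hideal V J'" and l: "\<And>j. j < e \<Longrightarrow> l j \<in> L" "\<And>j. j < e \<Longrightarrow> l' j \<in> L"
    and red: "F V n \<subseteq> idl V J e l" "F V n' \<subseteq> idl V J' e l'"
  shows "\<exists>l''. (\<forall>j<e. l'' j \<in> L) \<and> F V n \<subseteq> idl V J e l'' \<and> F V n' \<subseteq> idl V J' e l''"
proof -
  have LF: "x \<in> L \<Longrightarrow> x \<in> F V 1" for x using L by (auto simp: linear_space_def)
  have lF: "l j \<in> F V 1" "l' j \<in> F V 1" "l' j - l j \<in> F V 1" "l j - l' j \<in> F V 1" if "j < e" for j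
    using LF[OF l(1)[OF that]] LF[OF l(2)[OF that]] by auto
  obtain D where D: "D \<noteq> 0" "\<forall>s. poly D s \<noteq> 0 \<longrightarrow> F V n \<subseteq> idl V J e (\<lambda>j. l j + const s * (l' j - l j))"
    using generic_on_line[where l = l and d = "\<lambda>j. l' j - l j", OF V J(1) lF(1) lF(3) red(1)] by blast
  obtain D' where D': "D' \<noteq> 0" "\<forall>s. poly D' s \<noteq> 0 \<longrightarrow> F V n' \<subseteq> idl V J' e (\<lambda>j. l' j + const s * (l j - l' j))"
    using generic_on_line[where l = l' and d = "\<lambda>j. l j - l' j", OF V J(2) lF(2) lF(4) red(2)] by blast
  have "finite ({s. poly D s = 0} \<union> (\<lambda>s. 1 - s) ` {s. poly D' s = 0})"
    using D D' by (simp add: poly_roots_finite)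
  then obtain s where s: "s \<notin> {s. poly D s = 0} \<union> (\<lambda>s. 1 - s) ` {s. poly D' s = 0}"
    using inf by (metis UNIV_I finite_subset subsetI)
  have "poly D' (1 - s) \<noteq> 0"
  proof
    assume "poly D' (1 - s) = 0"
    then have "1 - (1 - s) \<in> (\<lambda>s. 1 - s) ` {s. poly D' s = 0}" by blast
    with s show False by simp
  qed
  moreover have "(\<lambda>j. l' j + const (1 - s) * (l j - l' j)) = (\<lambda>j. l j + const s * (l' j - l j))"
    by (simp add: algebra_simps)
  ultimately have "F V n' \<subseteq> idl V J' e (\<lambda>j. l j + const s * (l' j - l j))"
    using D'(2)[rule_format, of "1 - s"] by (simp only: not_False_eq_True)
  moreover have "l j + const s * (l' j - l j) \<in> L" if "j < e" for j
  proof -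
    have "l j + const s * (l' j - l j) = const (1 - s) * l j + const s * l' j" by (simp add: algebra_simps)
    also have "\<dots> \<in> L" using l that L unfolding linear_space_def by blast
    finally show ?thesis .
  qed
  moreover have "F V n \<subseteq> idl V J e (\<lambda>j. l j + const s * (l' j - l j))"
    using D(2)[rule_format, of s] s by simp
  ultimately show ?thesis by (intro exI[of _ "\<lambda>j. l j + const s * (l' j - l j)"]) simp
qed

section \<open>Dimension and the number of reducing forms\<close>

text \<open>\<open>L\<close> restricts the admissible forms: all linear forms when the dimension is
  bounded, the linear forms of a given reduction when a smaller one is sought inside it.\<close>

definition reducible :: "'v set \<Rightarrow> ('v, 'a::comm_ring_1) mpoly set \<Rightarrow> ('v, 'a) mpoly set \<Rightarrow> nat \<Rightarrow> bool" where
  "reducible V L J e \<longleftrightarrow> (\<exists>l n. (\<forall>j<e. l j \<in> L) \<and> F V n \<subseteq> idl V J e l)"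

lemma linear_spaceD: "linear_space V L \<Longrightarrow> x \<in> L \<Longrightarrow> x \<in> F V 1" "linear_space V L \<Longrightarrow> x \<in> L \<Longrightarrow> x \<in> polys V" "linear_space V L \<Longrightarrow> 0 \<in> L"
  by (auto simp: linear_space_def intro: F_polys)

text \<open>If \<open>p\<close> and \<open>q\<close> both have components outside \<open>P\<close>,
  let \<open>a\<close> and \<open>b\<close> be the lowest degrees of such components. In degree a +
  b of the product all other summands have a factor in \<open>P\<close>, so the product of the two
  lowest forms lies in \<open>P\<close> as well.\<close>

lemma hideal_prime:
  assumes P: "hideal V P" "1 \<notin> P"
    and prime: "\<And>a b f g. f \<in> F V a \<Longrightarrow> g \<in> F V b \<Longrightarrow> f * g \<in> P \<Longrightarrow> f \<in> P \<or> g \<in> P"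
  shows "pprime V P"
  unfolding pprime_def
proof (intro conjI ballI impI)
  show "pideal V P" "1 \<notin> P" using P by (auto simp: hideal_def)
  note pideal = \<open>pideal V P\<close>
  have all_hom_part: "p \<in> P" if "\<forall>i. hom_part i p \<in> P" for p
  proof -
    obtain N where "deg_le N p" using deg_le_exists by blast
    then have "p = (\<Sum>i\<le>N. hom_part i p)" by (simp add: sum_hom_part)
    then show ?thesis using that pideal_sum[OF pideal, of "{..N}" "\<lambda>i. hom_part i p"] by auto
  qed
  fix p q assume pq: "p \<in> polys V" "q \<in> polys V" "p * q \<in> P"
  show "p \<in> P \<or> q \<in> P"
  proof (rule ccontr)
    assume "\<not> (p \<in> P \<or> q \<in> P)"
    then have "\<exists>i. hom_part i p \<notin> P" "\<exists>i. hom_part i q \<notin> P" using all_hom_part by auto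
    then obtain a b where a: "hom_part a p \<notin> P" "\<And>i. i < a \<Longrightarrow> hom_part i p \<in> P"
      and b: "hom_part b q \<notin> P" "\<And>i. i < b \<Longrightarrow> hom_part i q \<in> P"
      using exists_least_iff[of "\<lambda>i. hom_part i p \<notin> P"] exists_least_iff[of "\<lambda>i. hom_part i q \<notin> P"] by blast
    have polys: "hom_part i p \<in> polys V" "hom_part i q \<in> polys V" for i
      using pq by (auto intro: F_polys)
    have "hom_part (a + b) (p * q) = (\<Sum>i\<le>a + b. hom_part i p * hom_part (a + b - i) q)"
      by (rule hom_part_mult[OF pq(1,2)])
    also have "\<dots> = hom_part a p * hom_part b q + (\<Sum>i\<in>{..a + b} - {a}. hom_part i p * hom_part (a + b - i) q)"
      by (subst sum.remove[of _ a]) auto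
    finally have eq: "hom_part a p * hom_part b q = hom_part (a + b) (p * q) - (\<Sum>i\<in>{..a + b} - {a}. hom_part i p * hom_part (a + b - i) q)"
      by simp
    have "hom_part i p * hom_part (a + b - i) q \<in> P" if "i \<in> {..a + b} - {a}" for i
    proof (cases "i < a")
      case True
      then show ?thesis using a polys pidealD(5)[OF pideal] by blast
    next
      case False
      with that have "a + b - i < b" by auto
      then show ?thesis using b polys pidealD(4)[OF pideal] by blast
    qed
    then have "(\<Sum>i\<in>{..a + b} - {a}. hom_part i p * hom_part (a + b - i) q) \<in> P" by (rule pideal_sum[OF pideal])
    then have "hom_part a p * hom_part b q \<in> P"
      unfolding eq by (rule pidealD(7)[OF pideal hidealD(2)[OF P(1) pq(3)]])
    then show False using prime[OF hom_part_F[OF pq(1)] hom_part_F[OF pq(2)]] a b by blast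
  qed
qed

text \<open>Zorn's lemma applies because generating the finitely many monomials of one degree uses
  only finitely many elements of the union of a chain. A maximal element \<open>P\<close> is prime:
  for forms \<open>f\<close>, \<open>g\<close> outside \<open>P\<close>, both P + (f) and P + (g)
  are reducible, by \<open>common_reduction\<close> with the same tuple \<open>l\<close>. The
  product of P + (f) + (l) and P + (g) + (l) lies in P + (f g) + (l), which would be P + (l) if f g
  were in \<open>P\<close>.\<close>

lemma prime_of_irreducible:
  fixes J :: "('v, 'a::field) mpoly set"
  assumes inf: "infinite (UNIV :: 'a set)" and V: "finite V" and L: "linear_space V L"
    and J: "hideal V J" "\<not> reducible V L J e"
  shows "\<exists>P. hideal V P \<and> pprime V P \<and> J \<subseteq> P \<and> \<not> reducible V L P e"
proof -
  define A where "A = {K. hideal V K \<and> J \<subseteq> K \<and> \<not> reducible V L K e}"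
  have "\<exists>P\<in>A. \<forall>X\<in>A. P \<subseteq> X \<longrightarrow> X = P"
  proof (rule subset_Zorn_nonempty)
    show "A \<noteq> {}" using J by (auto simp: A_def)
    fix C assume C: "C \<noteq> {}" "subset.chain A C"
    then have CA: "K \<in> A" if "K \<in> C" for K using that by (auto simp: subset.chain_def)
    then have pideal: "pideal V K" and hideal: "hideal V K" if "K \<in> C" for K using that by (auto simp: A_def hideal_def)
    have two: "\<exists>K\<in>C. x \<in> K \<and> y \<in> K" if xy: "x \<in> \<Union>C" "y \<in> \<Union>C" for x y
    proof -
      obtain X Y where "X \<in> C" "x \<in> X" "Y \<in> C" "y \<in> Y" using xy by blast
      moreover from this have "X \<subseteq> Y \<or> Y \<subseteq> X" using C(2) by (simp add: subset_chain_def)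
      ultimately show ?thesis by blast
    qed
    have "pideal V (\<Union>C)"
      unfolding pideal_def
    proof (intro conjI ballI)
      show "\<Union>C \<subseteq> polys V" using pideal pidealD(1) by blast
      show "0 \<in> \<Union>C" using C(1) pideal pidealD(2) by blast
      show "x + y \<in> \<Union>C" if "x \<in> \<Union>C" "y \<in> \<Union>C" for x y
        using two[OF that] pideal pidealD(3) by blast
      show "r * x \<in> \<Union>C" if "r \<in> polys V" "x \<in> \<Union>C" for r x
        using that pideal pidealD(4) by blast
    qed
    then have "hideal V (\<Union>C)" unfolding hideal_def using hideal hidealD(2) by blast
    moreover have "J \<subseteq> \<Union>C" using C(1) CA by (auto simp: A_def)
    moreover have "\<not> reducible V L (\<Union>C) e"
    proof
      assume "reducible V L (\<Union>C) e"
      then obtain l n where l: "\<And>j. j < e \<Longrightarrow> l j \<in> L" and sub: "F V n \<subseteq> idl V (\<Union>C) e l"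
        unfolding reducible_def by blast
      \<comment> \<open>The singleton is not an ideal; \<open>idl V {f} e l\<close> only records
        which element of the union a representation uses, so that finitely many of them can be
        collected in one member of the chain.\<close>
      have "\<exists>f\<in>\<Union>C. xmon t \<in> idl V {f} e l" if "t \<in> xmons V n" for t
        using subsetD[OF sub xmon_F[OF that]] unfolding idl_def by blast
      then have "\<exists>f. \<forall>t\<in>xmons V n. f t \<in> \<Union>C \<and> xmon t \<in> idl V {f t} e l"
        by (intro bchoice) blast
      then obtain f where fr: "\<And>t. t \<in> xmons V n \<Longrightarrow> f t \<in> \<Union>C"
        "\<And>t. t \<in> xmons V n \<Longrightarrow> xmon t \<in> idl V {f t} e l" by blast
      have "finite (f ` xmons V n)" "f ` xmons V n \<subseteq> \<Union>C" using finite_xmons[OF V] fr by auto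
      then obtain K where K: "K \<in> C" "f ` xmons V n \<subseteq> K"
        using finite_subset_Union_chain[OF _ _ C] by blast
      have "pideal V (idl V K e l)" using pideal K l linear_spaceD[OF L] by (intro idl_pideal) auto
      then have "F V n \<subseteq> idl V K e l"
        unfolding F_subset_iff[OF \<open>pideal V (idl V K e l)\<close> V] using fr(2) K(2) unfolding idl_def by blast
      then have "reducible V L K e" using l by (auto simp: reducible_def)
      then show False using CA[OF K(1)] by (auto simp: A_def)
    qed
    ultimately show "\<Union>C \<in> A" by (auto simp: A_def)
  qed
  then obtain P where P: "P \<in> A" "\<And>X. X \<in> A \<Longrightarrow> P \<subseteq> X \<Longrightarrow> X = P" by blast
  then have hidealP: "hideal V P" and JP: "J \<subseteq> P" and irr: "\<not> reducible V L P e" by (auto simp: A_def)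
  then have pideal: "pideal V P" by (auto simp: hideal_def)
  have "1 \<notin> P"
  proof
    assume "1 \<in> P"
    then have "F V 0 \<subseteq> P" using pidealD(4)[OF pideal] F_polys[of _ V 0] by (metis mult.right_neutral subsetI)
    then have "reducible V L P e" unfolding reducible_def using linear_spaceD(3)[OF L]
      by (intro exI[of _ "\<lambda>_. 0"] exI[of _ 0]) (auto intro: idl_incl)
    with irr show False ..
  qed
  moreover have "f \<in> P \<or> g \<in> P" if f: "f \<in> F V a" and g: "g \<in> F V b" and fg: "f * g \<in> P" for a b f g
  proof (rule ccontr)
    assume "\<not> (f \<in> P \<or> g \<in> P)"
    then have nin: "f \<notin> P" "g \<notin> P" by auto
    have red: "hideal V (idl V P 1 (\<lambda>_. h)) \<and> reducible V L (idl V P 1 (\<lambda>_. h)) e"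
      if h: "h \<in> F V k" "h \<notin> P" for h k
    proof -
      let ?K = "idl V P 1 (\<lambda>_. h)"
      have "hideal V ?K" by (rule idl_hideal[OF hidealP, where dg = "\<lambda>_. k"]) (use h in auto)
      moreover have "P \<subseteq> ?K" by (auto intro: idl_incl)
      moreover have "h \<in> ?K" using idl_gen[OF pideal, of 0 1 "\<lambda>_. h"] by simp
      ultimately show ?thesis using P(2)[of ?K] JP h(2) by (auto simp: A_def)
    qed
    obtain l1 n1 l2 n2 where l: "\<And>j. j < e \<Longrightarrow> l1 j \<in> L" "\<And>j. j < e \<Longrightarrow> l2 j \<in> L"
      and r: "F V n1 \<subseteq> idl V (idl V P 1 (\<lambda>_. f)) e l1" "F V n2 \<subseteq> idl V (idl V P 1 (\<lambda>_. g)) e l2"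
      using red[OF f nin(1)] red[OF g nin(2)] unfolding reducible_def by blast
    obtain l where l: "\<And>j. j < e \<Longrightarrow> l j \<in> L"
      and r: "F V n1 \<subseteq> idl V (idl V P 1 (\<lambda>_. f)) e l" "F V n2 \<subseteq> idl V (idl V P 1 (\<lambda>_. g)) e l"
      using common_reduction[where l = l1 and l' = l2, OF inf V L _ _ l r] red[OF f nin(1)] red[OF g nin(2)] by blast
    let ?K = "idl V P e l"
    have pidealK: "pideal V ?K" by (rule idl_pideal[OF pideal]) (use l linear_spaceD(2)[OF L] in auto)
    \<comment> \<open>Everything except the multiple of \<open>h\<close> is absorbed into P +
      (l).\<close>
    have dec: "\<exists>k c. k \<in> ?K \<and> c \<in> polys V \<and> x = k + c * h"
      if x: "x \<in> idl V (idl V P 1 (\<lambda>_. h)) e l" for x h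
    proof -
      obtain y r where y: "x = y + (\<Sum>j<e. r j * l j)" "y \<in> idl V P 1 (\<lambda>_. h)" "\<And>j. r j \<in> polys V"
        using x unfolding idl_def[of V "idl V P 1 (\<lambda>_. h)"] by blast
      then obtain p s where "y = p + s * h" "p \<in> P" "s \<in> polys V"
        unfolding idl_def[of V P 1] by auto
      with y show ?thesis
        by (intro exI[of _ "p + (\<Sum>j<e. r j * l j)"] exI[of _ s]) (auto intro: idlI)
    qed
    have "F V (n1 + n2) \<subseteq> ?K"
    proof (rule F_add_subset[OF pidealK V])
      fix t u assume "t \<in> xmons V n1" "u \<in> xmons V n2"
      then have "xmon t \<in> idl V (idl V P 1 (\<lambda>_. f)) e l" "xmon u \<in> idl V (idl V P 1 (\<lambda>_. g)) e l"
        using r xmon_F by blast+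
      then obtain k c k' c' where kc: "k \<in> ?K" "c \<in> polys V" "xmon t = k + c * f"
        "k' \<in> ?K" "c' \<in> polys V" "xmon u = k' + c' * g"
        using dec by meson
      have "f * g \<in> ?K" using fg by (rule idl_incl)
      then have "k * xmon u + c * f * k' + (c * c') * (f * g) \<in> ?K"
        using pidealD(5)[OF pidealK F_polys[OF xmon_F[OF \<open>u \<in> _\<close>]] kc(1)] pidealD(4)[OF pidealK _ kc(4), of "c * f"]
          pidealD(4)[OF pidealK, of "c * c'" "f * g"] kc(2,5) F_polys[OF f] by (blast intro: pidealD(3)[OF pidealK])
      moreover have "xmon t * xmon u = k * xmon u + c * f * k' + (c * c') * (f * g)"
      proof -
        have "xmon t * xmon u = k * xmon u + c * f * xmon u"
          by (subst kc(3)) (simp add: distrib_right)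
        also have "c * f * xmon u = c * f * k' + (c * c') * (f * g)"
          by (subst kc(6)) (simp add: algebra_simps)
        finally show ?thesis by (simp add: add.assoc)
      qed
      ultimately show "xmon t * xmon u \<in> ?K" by simp
    qed
    then have "reducible V L P e" using l by (auto simp: reducible_def)
    with irr show False ..
  qed
  ultimately have "pprime V P" by (intro hideal_prime[OF hidealP])
  with hidealP JP irr show ?thesis by blast
qed

text \<open>The constant coefficient is the value at the origin. The kernel of this evaluation is
  the prime that ends the chains constructed below.\<close>

lemma lookup_0_mult: "lookup (p * q) 0 = lookup p 0 * lookup q (0 :: 'v \<Rightarrow>\<^sub>0 nat)"
  for p q :: "('v, 'a::comm_ring_1) mpoly"
proof -
  have "mon_val (\<lambda>_. 0::'a) t = (if t = 0 then 1 else 0)" for t :: "'v \<Rightarrow>\<^sub>0 nat"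
  proof (cases "t = 0")
    case False
    then obtain i where "i \<in> keys t" by fastforce
    then have "\<exists>i\<in>keys t. (0::'a) ^ lookup t i = 0" by (intro bexI[of _ i] zero_power) (simp_all add: in_keys_iff)
    then show ?thesis
      using False by (simp add: mon_val_def prod_zero)
  qed simp
  then have "eval_mpoly (\<lambda>a. a) (\<lambda>_. 0) p = lookup p 0" for p :: "('v, 'a) mpoly"
    using coeff_hom.eval_superset[OF id_coeff_hom, of "keys p" p "\<lambda>_. 0"]
    by (simp add: if_distrib[of "(*) _"] in_keys_iff cong: if_cong)
  then show ?thesis using coeff_hom.eval_mult[OF id_coeff_hom, of "\<lambda>_. 0" p q] by simp
qed

lemma irrelevant_prime: "pprime V {p \<in> polys V. lookup p 0 = (0 :: 'a::field)}"
  unfolding pprime_def pideal_def by (auto simp: lookup_0_mult lookup_add)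

text \<open>The assumption on \<open>e'\<close> says that no e - 1 forms suffice, and is empty for e
  = 0. The assumption on \<open>N\<close> says that \<open>L\<close> as a whole reduces modulo
  \<open>J\<close>; it prevents \<open>L\<close> from lying in the prime \<open>P0\<close>, where
  the zero tuple would suffice, and so provides the form \<open>y\<close> for the next step.\<close>

lemma prime_chain:
  fixes J :: "('v, 'a::field) mpoly set"
  assumes inf: "infinite (UNIV :: 'a set)" and V: "finite V" and L: "linear_space V L"
    and "hideal V J" "1 \<notin> J"
    and "\<And>K. pideal V K \<Longrightarrow> J \<subseteq> K \<Longrightarrow> L \<subseteq> K \<Longrightarrow> F V N \<subseteq> K"
    and "\<And>e'. e = Suc e' \<Longrightarrow> \<not> reducible V L J e'"
  shows "\<exists>P. (\<forall>i\<le>e. pprime V (P i)) \<and> (\<forall>i<e. P i \<subset> P (Suc i)) \<and> J \<subseteq> P 0"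
  using assms(4-)
proof (induction e arbitrary: J)
  case 0
  let ?P = "{p \<in> polys V. lookup p 0 = (0 :: 'a)}"
  have pideal: "pideal V J" using 0 by (auto simp: hideal_def)
  \<comment> \<open>A homogeneous ideal containing a polynomial with nonzero constant term contains
    that constant, hence 1.\<close>
  have "J \<subseteq> ?P"
  proof
    fix p assume p: "p \<in> J"
    then have pV: "p \<in> polys V" using pidealD(1)[OF pideal] by auto
    have "hom_part 0 p \<in> J" using hidealD(2)[OF 0(1) p] .
    moreover have "hom_part 0 p = const (lookup p 0)"
      using F0_const[OF hom_part_F[OF pV]] by (simp add: lookup_hom_part)
    ultimately have "const (inverse (lookup p 0)) * const (lookup p 0) \<in> J"
      using pidealD(8)[OF pideal] by metis
    then have "lookup p 0 = 0"
      using 0(2) by (cases "lookup p 0 = 0") (auto simp flip: const_simps(4))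
    with pV show "p \<in> ?P" by simp
  qed
  then show ?case using irrelevant_prime by (intro exI[of _ "\<lambda>_. ?P"]) auto
next
  case (Suc e)
  obtain P0 where P0: "hideal V P0" "pprime V P0" "J \<subseteq> P0" and irr: "\<not> reducible V L P0 e"
    using prime_of_irreducible[OF inf V L Suc.prems(1)] Suc.prems(4) by blast
  then have pideal: "pideal V P0" by (auto simp: hideal_def)
  have "\<not> L \<subseteq> P0"
  proof
    assume "L \<subseteq> P0"
    then have "F V N \<subseteq> P0" using Suc.prems(3) pideal P0 by blast
    then have "reducible V L P0 e" unfolding reducible_def
      by (intro exI[of _ "\<lambda>_. 0"] exI[of _ N]) (auto intro: idl_incl linear_spaceD(3)[OF L])
    with irr show False ..
  qed
  then obtain y where y: "y \<in> L" "y \<notin> P0" by auto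
  let ?K = "idl V P0 1 (\<lambda>_. y)"
  have hidealK: "hideal V ?K" by (rule idl_hideal[OF P0(1), where dg = "\<lambda>_. 1"]) (use linear_spaceD(1)[OF L y(1)] in auto)
  have sub: "P0 \<subseteq> ?K" by (auto intro: idl_incl)
  have yK: "y \<in> ?K" using idl_gen[OF pideal, of 0 1 "\<lambda>_. y"] by simp
  \<comment> \<open>Multiples of the linear form \<open>y\<close> contribute nothing in degree
    0.\<close>
  have "1 \<notin> ?K"
  proof
    assume "1 \<in> ?K"
    then have "1 \<in> P0"
      using F_idl_elem[where l = "\<lambda>_. y" and e = 1, OF P0(1) linear_spaceD(1)[OF L y(1)] F_closed(7)] by auto
    then show False using P0(2) by (simp add: pprime_def)
  qed
  moreover have "\<not> reducible V L ?K e'" if e: "e = Suc e'" for e'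
  proof
    assume "reducible V L ?K e'"
    then obtain l n where l: "\<And>j. j < e' \<Longrightarrow> l j \<in> L" "F V n \<subseteq> idl V ?K e' l"
      by (auto simp: reducible_def)
    \<comment> \<open>With \<open>y\<close> put in the last place, e' forms reducing modulo P0 + (y)
      become \<open>e\<close> forms reducing modulo \<open>P0\<close>.\<close>
    define l' where "l' j = (if j < e' then l j else y)" for j
    have l'L: "l' j \<in> L" if "j < e" for j using l y by (simp add: l'_def)
    have pideal': "pideal V (idl V P0 e l')" by (rule idl_pideal[OF pideal]) (use l'L linear_spaceD(2)[OF L] in auto)
    have gen: "l' j \<in> idl V P0 e l'" if "j < e" for j by (rule idl_gen[OF pideal that])
    have "?K \<subseteq> idl V P0 e l'"
      by (rule idl_least[OF pideal']) (use gen[of e'] e in \<open>auto intro: idl_incl simp: l'_def\<close>)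
    then have "idl V ?K e' l \<subseteq> idl V P0 e l'"
    proof (rule idl_least[OF pideal'])
      fix j assume "j < e'"
      then show "l j \<in> idl V P0 e l'" using gen[of j] e by (simp add: l'_def)
    qed
    with l(2) have "F V n \<subseteq> idl V P0 e l'" by (rule subset_trans)
    with l'L have "reducible V L P0 e" unfolding reducible_def by blast
    with irr show False ..
  qed
  moreover have "F V N \<subseteq> K" if "pideal V K" "?K \<subseteq> K" "L \<subseteq> K" for K
    using Suc.prems(3)[OF that(1)] that sub P0(3) by blast
  ultimately obtain Q where Q: "\<And>i. i \<le> e \<Longrightarrow> pprime V (Q i)" "\<And>i. i < e \<Longrightarrow> Q i \<subset> Q (Suc i)" "?K \<subseteq> Q 0"
    using Suc.IH[OF hidealK] by blast
  define P where "P i = (case i of 0 \<Rightarrow> P0 | Suc i \<Rightarrow> Q i)" for i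
  have "P0 \<subset> Q 0" using Q(3) sub yK y(2) by blast
  then have "\<forall>i<Suc e. P i \<subset> P (Suc i)" using Q(2) by (auto simp: P_def split: nat.split)
  moreover have "\<forall>i\<le>Suc e. pprime V (P i)" using Q(1) P0(2) by (auto simp: P_def split: nat.split)
  moreover have "J \<subseteq> P 0" using P0(3) by (simp add: P_def)
  ultimately show ?case by blast
qed

section \<open>Growth of the quotient and the upper bound for chains of primes\<close>

definition span_mod :: "('v, 'a::comm_ring_1) mpoly set \<Rightarrow> ('v, 'a) mpoly set \<Rightarrow> ('v, 'a) mpoly set" where
  "span_mod J G = {p. \<exists>a. p - (\<Sum>g\<in>G. const (a g) * g) \<in> J}"

lemma span_mod_gen: "pideal V J \<Longrightarrow> finite G \<Longrightarrow> g \<in> G \<Longrightarrow> g \<in> span_mod J G"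
  unfolding span_mod_def
  by (intro CollectI exI[of _ "\<lambda>x. if x = g then 1 else 0"])
    (simp add: if_distrib[of const] if_distrib[of "\<lambda>x. x * _"] pidealD(2) cong: if_cong)

lemma span_mod_ideal: "x \<in> J \<Longrightarrow> x \<in> span_mod J G"
  unfolding span_mod_def by (intro CollectI exI[of _ "\<lambda>_. 0"]) simp

lemma span_mod_add:
  assumes "pideal V J" "p \<in> span_mod J G" "q \<in> span_mod J G" shows "p + q \<in> span_mod J G"
proof -
  obtain a b where "p - (\<Sum>g\<in>G. const (a g) * g) \<in> J" "q - (\<Sum>g\<in>G. const (b g) * g) \<in> J"
    using assms by (auto simp: span_mod_def)
  then have "(p - (\<Sum>g\<in>G. const (a g) * g)) + (q - (\<Sum>g\<in>G. const (b g) * g)) \<in> J"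
    by (rule pidealD(3)[OF assms(1)])
  then show ?thesis
    unfolding span_mod_def by (intro CollectI exI[of _ "\<lambda>g. a g + b g"]) (simp add: sum.distrib algebra_simps)
qed

lemma span_mod_const:
  assumes "pideal V J" "p \<in> span_mod J G" shows "const c * p \<in> span_mod J G"
proof -
  obtain a where "p - (\<Sum>g\<in>G. const (a g) * g) \<in> J"
    using assms by (auto simp: span_mod_def)
  then have "const c * (p - (\<Sum>g\<in>G. const (a g) * g)) \<in> J"
    by (rule pidealD(8)[OF assms(1)])
  then show ?thesis
    unfolding span_mod_def by (intro CollectI exI[of _ "\<lambda>g. c * a g"]) (simp add: sum_distrib_left algebra_simps)
qed

lemma span_mod_sum: "pideal V J \<Longrightarrow> (\<And>x. x \<in> A \<Longrightarrow> f x \<in> span_mod J G) \<Longrightarrow> sum f A \<in> span_mod J G"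
  by (induction A rule: infinite_finite_induct) (auto intro: span_mod_add span_mod_ideal pidealD(2))

lemma span_mod_mult:
  assumes "pideal V J" "q \<in> polys V" "\<And>g. g \<in> G \<Longrightarrow> q * g \<in> span_mod J G'" "p \<in> span_mod J G"
  shows "q * p \<in> span_mod J G'"
proof -
  obtain a where "p - (\<Sum>g\<in>G. const (a g) * g) \<in> J"
    using assms by (auto simp: span_mod_def)
  then have "q * (p - (\<Sum>g\<in>G. const (a g) * g)) \<in> J"
    by (rule pidealD(4)[OF assms(1,2)])
  moreover have "(\<Sum>g\<in>G. const (a g) * (q * g)) \<in> span_mod J G'"
    by (intro span_mod_sum[OF assms(1)] span_mod_const[OF assms(1)] assms(3))
  ultimately have "q * (p - (\<Sum>g\<in>G. const (a g) * g)) + (\<Sum>g\<in>G. const (a g) * (q * g)) \<in> span_mod J G'"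
    by (blast intro: span_mod_add[OF assms(1)] span_mod_ideal)
  then show ?thesis by (simp add: algebra_simps sum_distrib_left)
qed

lemma span_mod_subset: "pideal V J \<Longrightarrow> finite G' \<Longrightarrow> G \<subseteq> G' \<Longrightarrow> span_mod J G \<subseteq> span_mod J G'"
  using span_mod_mult[of V J 1 G G'] span_mod_gen[of V J G'] by auto

text \<open>Monomials in a tuple, with the exponents in a list: lists of fixed length over a finite
  set are counted by \<open>card_lists_length_eq\<close>, and splitting off the head isolates the
  power of the first entry.\<close>

definition list_pow :: "(nat \<Rightarrow> 'b::comm_monoid_mult) \<Rightarrow> nat list \<Rightarrow> 'b" where
  "list_pow l xs = (\<Prod>j<length xs. l j ^ (xs ! j))"

lemma list_pow_Cons: "list_pow l (x # xs) = l 0 ^ x * list_pow (\<lambda>j. l (Suc j)) xs"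
  by (simp add: list_pow_def prod.lessThan_Suc_shift del: prod.lessThan_Suc)

lemma list_pow_Nil [simp]: "list_pow l [] = 1"
  by (simp add: list_pow_def)

lemma list_pow_update:
  assumes "j < length xs" shows "list_pow l (xs[j := Suc (xs ! j)]) = l j * list_pow l xs"
proof -
  let ?A = "{..<length xs} - {j}"
  have "(\<Prod>i\<in>?A. l i ^ (xs[j := Suc (xs ! j)] ! i)) = (\<Prod>i\<in>?A. l i ^ (xs ! i))"
    by (intro prod.cong) auto
  then show ?thesis
    using assms by (simp add: list_pow_def prod.remove[of _ j] mult.assoc)
qed

text \<open>Above degree \<open>N\<close> every form is, modulo \<open>J\<close>, a combination of
  the \<open>l j\<close> with coefficients of one degree less. Unwinding this leaves power products
  of the \<open>l j\<close> times monomials of degree at most \<open>N\<close>. There are (n + 1)^e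
  exponent lists with entries up to \<open>n\<close>, and \<open>M\<close> counts the low
  monomials.\<close>

lemma spanning_bound:
  fixes J :: "('v, 'a::field) mpoly set"
  assumes V: "finite V" and J: "hideal V J" and l: "\<And>j. j < e \<Longrightarrow> l j \<in> F V 1"
    and red: "F V N \<subseteq> idl V J e l"
  shows "\<exists>M. \<forall>n. \<exists>G. finite G \<and> card G \<le> M * (n + 1) ^ e \<and> (\<forall>p\<in>polys V. deg_le n p \<longrightarrow> p \<in> span_mod J G)"
proof -
  define Low where "Low = (\<Union>k\<le>N. xmons V k)"
  have finLow: "finite Low" unfolding Low_def using finite_xmons[OF V] by auto
  define Xs where "Xs n = {xs :: nat list. set xs \<subseteq> {..n} \<and> length xs = e}" for n
  define G where "G n = (\<lambda>(xs, t). list_pow l xs * xmon t) ` (Xs n \<times> Low)" for n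
  have finXs: "finite (Xs n)" for n unfolding Xs_def by (rule finite_lists_length_eq) simp
  have finG: "finite (G n)" for n unfolding G_def using finXs finLow by auto
  have "card (Xs n) = (n + 1) ^ e" for n
    unfolding Xs_def by (subst card_lists_length_eq) auto
  then have cardG: "card (G n) \<le> card Low * (n + 1) ^ e" for n
    unfolding G_def using card_image_le[of "Xs n \<times> Low"] finXs finLow
    by (simp add: card_cartesian_product mult.commute)
  have Gmono: "G n \<subseteq> G m" if "n \<le> m" for n m
    unfolding G_def Xs_def using that by (intro image_mono) fastforce
  have pideal: "pideal V J" using J by (auto simp: hideal_def)
  have low: "F V k \<subseteq> span_mod J (G k)" if k: "k \<le> N" for k
  proof
    fix p :: "('v, 'a) mpoly" assume p: "p \<in> F V k"
    have "(xmon t :: ('v, 'a) mpoly) \<in> G k" if "t \<in> xmons V k" for t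
      unfolding G_def using that k
      by (intro image_eqI[of _ _ "(replicate e 0, t)"]) (auto simp: Xs_def Low_def list_pow_def)
    then have "(\<Sum>t\<in>xmons V k. const (lookup p t) * xmon t) \<in> span_mod J (G k)"
      by (intro span_mod_sum[OF pideal] span_mod_const[OF pideal] span_mod_gen[OF pideal finG])
    then show "p \<in> span_mod J (G k)" using F_expand[OF p V] by simp
  qed
  have *: "F V k \<subseteq> span_mod J (G k)" for k
  proof (induction k)
    case 0
    show ?case by (rule low) simp
  next
    case (Suc k)
    show ?case
    proof (cases "Suc k \<le> N")
      case False
      have pideal': "pideal V (idl V J e l)" using l by (intro idl_pideal[OF pideal]) (auto intro: F_polys)
      show ?thesis
      proof
        fix p :: "('v, 'a) mpoly" assume p: "p \<in> F V (Suc k)"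
        then have "p \<in> idl V J e l" using F_subset_mono[OF pideal' V red, of "Suc k"] False by auto
        then obtain f r where fr: "f \<in> J" "p = f + (\<Sum>j<e. r j * l j)" "\<And>j. r j \<in> F V k"
          using F_idl_elem[where l = l and e = e, OF J l p] by auto
        have "l j * r j \<in> span_mod J (G (Suc k))" if j: "j < e" for j
        proof (rule span_mod_mult[OF pideal])
          show "l j \<in> polys V" using l[OF j] by (rule F_polys)
          show "r j \<in> span_mod J (G k)" using fr(3) Suc.IH by blast
          fix g assume "g \<in> G k"
          then obtain xs t where g: "g = list_pow l xs * xmon t" "xs \<in> Xs k" "t \<in> Low"
            by (auto simp: G_def)
          have len: "length xs = e" and le: "set xs \<subseteq> {..k}" using g(2) by (auto simp: Xs_def)
          have "xs ! j \<in> set xs" using j len by simp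
          then have "xs ! j \<le> k" using le by auto
          then have "set (xs[j := Suc (xs ! j)]) \<subseteq> {..Suc k}"
            using le set_update_subset_insert[of xs j "Suc (xs ! j)"] by fastforce
          then have "xs[j := Suc (xs ! j)] \<in> Xs (Suc k)" using len by (simp add: Xs_def)
          moreover have "l j * g = list_pow l (xs[j := Suc (xs ! j)]) * xmon t"
            using list_pow_update[of j xs l] j len g(1) by (simp add: mult.assoc)
          ultimately have "l j * g \<in> G (Suc k)" using g(3) unfolding G_def
            by (intro image_eqI[of _ _ "(xs[j := Suc (xs ! j)], t)"]) auto
          then show "l j * g \<in> span_mod J (G (Suc k))" by (rule span_mod_gen[OF pideal finG])
        qed
        then have "(\<Sum>j<e. r j * l j) \<in> span_mod J (G (Suc k))"
          by (intro span_mod_sum[OF pideal]) (simp add: mult.commute)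
        then show "p \<in> span_mod J (G (Suc k))"
          unfolding fr(2) by (rule span_mod_add[OF pideal span_mod_ideal[OF fr(1)]])
      qed
    qed (rule low)
  qed
  have "p \<in> span_mod J (G n)" if p: "p \<in> polys V" "deg_le n p" for p n
  proof -
    have "p = (\<Sum>i\<le>n. hom_part i p)" using sum_hom_part[OF p(2)] by simp
    moreover have "hom_part i p \<in> span_mod J (G n)" if "i \<le> n" for i
      using hom_part_F[OF p(1), of i] * span_mod_subset[OF pideal finG Gmono[OF that]] by blast
    ultimately show ?thesis using span_mod_sum[OF pideal, of "{..n}" "\<lambda>i. hom_part i p" "G n"] by simp
  qed
  then show ?thesis using finG cardG by blast
qed


text \<open>
  A relation among the \<open>f i\<close> modulo \<open>P 0\<close> can be divided by the lowest power of \<open>f 0\<close> that occurs in it;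
  modulo \<open>P 1\<close> only the terms free of \<open>f 0\<close> then survive.
\<close>

lemma prime_chain_independent:
  fixes P :: "nat \<Rightarrow> ('v, 'a::field) mpoly set"
  assumes "\<And>i. i \<le> n \<Longrightarrow> pprime V (P i)"
    and "\<And>i. i < n \<Longrightarrow> P i \<subseteq> P (Suc i)" and "\<And>i. i < n \<Longrightarrow> f i \<in> P (Suc i) - P i"
    and "(\<Sum>xs\<in>{xs. set xs \<subseteq> {..<B} \<and> length xs = n}. const (c xs) * list_pow f xs) \<in> P 0"
    and "set xs \<subseteq> {..<B}" "length xs = n"
  shows "c xs = 0"
  using assms
proof (induction n arbitrary: P f c xs)
  case 0
  have P: "pideal V (P 0)" "1 \<notin> P 0" using 0(1)[of 0] by (auto simp: pprime_def)
  have "{xs. set xs \<subseteq> {..<B} \<and> length xs = 0} = {[]}" by auto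
  then have "const (c []) \<in> P 0" using 0(4) by simp
  then have "const (inverse (c [])) * const (c []) \<in> P 0" by (rule pidealD(8)[OF P(1)])
  then show ?case using P(2) 0(6) by (cases "c [] = 0") (auto simp flip: const_simps(4))
next
  case (Suc n)
  let ?X = "\<lambda>n. {xs. set xs \<subseteq> {..<B} \<and> length xs = n}"
  let ?f = "\<lambda>j. f (Suc j)"
  define g where "g b = (\<Sum>ys\<in>?X n. const (c (b # ys)) * list_pow ?f ys)" for b
  have prime: "pprime V (P 0)" "pprime V (P 1)" using Suc.prems(1)[of 0] Suc.prems(1)[of 1] by auto
  then have pideal: "pideal V (P 0)" "pideal V (P 1)" by (auto simp: pprime_def)
  have f0: "f 0 \<in> P 1" "f 0 \<notin> P 0" using Suc.prems(3)[of 0] by auto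
  have f0V: "f 0 \<in> polys V" using f0 pidealD(1)[OF pideal(2)] by auto
  have fV: "f i \<in> polys V" if "i < Suc n" for i
    using Suc.prems(3)[OF that] Suc.prems(1)[of "Suc i"] that pidealD(1)[of V "P (Suc i)"] by (auto simp: pprime_def)
  have gV: "g b \<in> polys V" for b
    unfolding g_def list_pow_def by (intro polys_sum polys_mult polys_prod polys_power polys_closed fV) auto
  have X: "?X (Suc n) = (\<lambda>(b, ys). b # ys) ` ({..<B} \<times> ?X n)"
  proof
    show "?X (Suc n) \<subseteq> (\<lambda>(b, ys). b # ys) ` ({..<B} \<times> ?X n)"
    proof
      fix xs assume "xs \<in> ?X (Suc n)"
      then show "xs \<in> (\<lambda>(b, ys). b # ys) ` ({..<B} \<times> ?X n)"
        by (cases xs) (auto simp: image_iff)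
    qed
  qed auto
  have "(\<Sum>xs\<in>?X (Suc n). const (c xs) * list_pow f xs) =
    (\<Sum>(b, ys)\<in>{..<B} \<times> ?X n. const (c (b # ys)) * (f 0 ^ b * list_pow ?f ys))"
    unfolding X by (subst sum.reindex) (auto simp: inj_on_def list_pow_Cons case_prod_beta)
  also have "\<dots> = (\<Sum>b<B. f 0 ^ b * g b)"
    unfolding g_def by (simp add: sum.cartesian_product[symmetric] sum_distrib_left algebra_simps)
  finally have main: "(\<Sum>b<B. f 0 ^ b * g b) \<in> P 0" using Suc.prems(4) by simp
  \<comment> \<open>The induction hypothesis for the chain starting at \<open>P 1\<close>: a
    coefficient polynomial of a power of \<open>f 0\<close> is a relation modulo \<open>P 1\<close>
    as soon as it lies there.\<close>
  have cg: "(\<forall>ys\<in>?X n. c (b # ys) = 0)" if "g b \<in> P 1" for b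
    using Suc.IH[of "\<lambda>i. P (Suc i)" ?f "\<lambda>ys. c (b # ys)"] Suc.prems(1-3) that by (auto simp: g_def)
  have all: "\<forall>ys\<in>?X n. c (b # ys) = 0" if "b < B" for b
    using that
  proof (induction b rule: less_induct)
    case (less b)
    have g0: "g i = 0" if "i < b" for i
      using less that by (simp add: g_def)
    have "(\<Sum>i<B. f 0 ^ i * g i) = (\<Sum>i\<in>{b..<B}. f 0 ^ i * g i)"
      using less.prems by (intro sum.mono_neutral_right) (auto simp: g0)
    also have "\<dots> = f 0 ^ b * (\<Sum>i\<in>{b..<B}. f 0 ^ (i - b) * g i)"
      by (simp add: sum_distrib_left mult.assoc[symmetric] flip: power_add)
    finally have "f 0 ^ b * (\<Sum>i\<in>{b..<B}. f 0 ^ (i - b) * g i) \<in> P 0" using main by simp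
    moreover have sV: "(\<Sum>i\<in>{b..<B}. f 0 ^ (i - b) * g i) \<in> polys V"
      using f0V gV by (intro polys_sum polys_mult) auto
    moreover have "f 0 ^ k \<notin> P 0" for k
    proof (induction k)
      case 0
      then show ?case using prime by (simp add: pprime_def)
    next
      case (Suc k)
      then show ?case using prime f0(2) f0V by (auto simp: pprime_def)
    qed
    ultimately have "(\<Sum>i\<in>{b..<B}. f 0 ^ (i - b) * g i) \<in> P 0"
      using prime(1) f0V unfolding pprime_def by blast
    then have bP: "(\<Sum>i\<in>{b..<B}. f 0 ^ (i - b) * g i) \<in> P 1"
      using Suc.prems(2)[of 0] by auto
    have eq: "(\<Sum>i\<in>{b..<B}. f 0 ^ (i - b) * g i) = g b + (\<Sum>i\<in>{Suc b..<B}. f 0 ^ (i - b) * g i)"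
      using less.prems by (simp add: sum.atLeast_Suc_lessThan)
    have "f 0 ^ (i - b) * g i \<in> P 1" if "i \<in> {Suc b..<B}" for i
    proof -
      have "f 0 ^ (i - b) = f 0 ^ (i - Suc b) * f 0"
        using that by (simp add: Suc_diff_Suc flip: power_Suc2)
      then have "f 0 ^ (i - b) \<in> P 1" using pidealD(4)[OF pideal(2) polys_power[OF f0V] f0(1)] by simp
      then show ?thesis using gV by (rule pidealD(5)[OF pideal(2), rotated])
    qed
    then have "(\<Sum>i\<in>{Suc b..<B}. f 0 ^ (i - b) * g i) \<in> P 1" by (rule pideal_sum[OF pideal(2)])
    from pidealD(7)[OF pideal(2) bP this] have "g b \<in> P 1" unfolding eq by simp
    then show ?case by (rule cg)
  qed
  obtain b ys where "xs = b # ys" using Suc.prems(6) by (cases xs) auto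
  then show ?case using all[of b] Suc.prems(5,6) by auto
qed

text \<open>Counting: there are B^(e + 1) exponent lists of length e + 1 with entries below
  \<open>B\<close>, while the corresponding products of the \<open>f i\<close> lie in a space of
  dimension O(B^e) modulo \<open>J\<close>. The resulting linear relation contradicts
  \<open>prime_chain_independent\<close>.\<close>

lemma no_long_prime_chain:
  fixes J :: "('v, 'a::field) mpoly set"
  assumes V: "finite V" and J: "hideal V J" and l: "\<And>j. j < e \<Longrightarrow> l j \<in> F V 1"
    and red: "F V N \<subseteq> idl V J e l"
    and P: "\<And>i. i \<le> Suc e \<Longrightarrow> pprime V (P i)" "\<And>i. i < Suc e \<Longrightarrow> P i \<subset> P (Suc i)" "J \<subseteq> P 0"
  shows False
proof -
  obtain M where M: "\<And>n. \<exists>G. finite G \<and> card G \<le> M * (n + 1) ^ e \<and> (\<forall>p\<in>polys V. deg_le n p \<longrightarrow> p \<in> span_mod J G)"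
    using spanning_bound[where l = l, OF V J l red] by blast
  have pideal: "pideal V J" using J by (auto simp: hideal_def)
  have "\<exists>f. \<forall>i. i < Suc e \<longrightarrow> f i \<in> P (Suc i) - P i"
    by (rule choice) (use P(2) in blast)
  then obtain f where f: "\<And>i. i < Suc e \<Longrightarrow> f i \<in> P (Suc i) - P i" by blast
  have fV: "f i \<in> polys V" if "i < Suc e" for i
    using f[OF that] P(1)[of "Suc i"] that pidealD(1)[of V "P (Suc i)"] by (auto simp: pprime_def)
  have "\<exists>s. \<forall>i. deg_le (s i) (f i)" by (rule choice) (use deg_le_exists in blast)
  then obtain s where s: "\<And>i. deg_le (s i) (f i)" by blast
  define t where "t = (\<Sum>i<Suc e. s i)"
  \<comment> \<open>The products have degree at most t * (B - 1), and t * (B - 1) + 1 \<le> (t + 1)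
    * B. So the spanning set has at most M (t + 1)^e B^e elements, and \<open>B\<close> is chosen
    one larger than the factor M (t + 1)^e.\<close>
  define B where "B = M * (t + 1) ^ e + 1"
  define X where "X = {xs. set xs \<subseteq> {..<B} \<and> length xs = Suc e}"
  have finX: "finite X" unfolding X_def by (rule finite_lists_length_eq) simp
  have cardX: "card X = B ^ Suc e" unfolding X_def by (subst card_lists_length_eq) auto
  obtain G where G: "finite G" "card G \<le> M * (t * (B - 1) + 1) ^ e"
    "\<And>p. p \<in> polys V \<Longrightarrow> deg_le (t * (B - 1)) p \<Longrightarrow> p \<in> span_mod J G"
    using M[of "t * (B - 1)"] by blast
  have "t * (B - 1) + 1 \<le> (t + 1) * B" by (simp add: B_def algebra_simps)
  then have "M * (t * (B - 1) + 1) ^ e \<le> M * ((t + 1) * B) ^ e"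
    by (intro mult_le_mono2 power_mono) auto
  also have "\<dots> = (M * (t + 1) ^ e) * B ^ e" by (simp only: power_mult_distrib mult.assoc)
  also have "\<dots> < B * B ^ e" by (intro mult_strict_right_mono) (auto simp: B_def)
  finally have card: "card G < card X" using G(2) cardX by simp
  have pow_deg: "deg_le (\<Sum>i\<in>A. s i * k i) (\<Prod>i\<in>A. f i ^ k i)" for A and k :: "nat \<Rightarrow> nat"
  proof (induction A rule: infinite_finite_induct)
    case (insert x A)
    then show ?case using deg_le_mult[OF deg_le_power[OF s[of x], of "k x"] insert.IH]
      by (simp add: mult.commute)
  qed auto
  have "list_pow f xs \<in> span_mod J G" if "xs \<in> X" for xs
  proof (rule G(3))
    have len: "length xs = Suc e" and sub: "set xs \<subseteq> {..<B}"
      using that by (auto simp: X_def)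
    have xs: "xs ! i \<le> B - 1" if "i < Suc e" for i
    proof -
      have "xs ! i \<in> set xs" using that len by simp
      with sub have "xs ! i \<in> {..<B}" by (rule subsetD)
      then show ?thesis by simp
    qed
    show "list_pow f xs \<in> polys V" unfolding list_pow_def len by (intro polys_prod polys_power fV) auto
    have "(\<Sum>i<Suc e. s i * xs ! i) \<le> (\<Sum>i<Suc e. s i * (B - 1))"
      by (intro sum_mono mult_le_mono2 xs) auto
    also have "\<dots> = t * (B - 1)" unfolding t_def by (rule sum_distrib_right[symmetric])
    finally show "deg_le (t * (B - 1)) (list_pow f xs)"
      unfolding list_pow_def len by (rule deg_le_mono[OF pow_deg])
  qed
  then have "\<forall>xs\<in>X. \<exists>a. list_pow f xs - (\<Sum>g\<in>G. const (a g) * g) \<in> J"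
    by (simp add: span_mod_def)
  then have "\<exists>a. \<forall>xs\<in>X. list_pow f xs - (\<Sum>g\<in>G. const (a xs g) * g) \<in> J"
    by (rule bchoice)
  then obtain a where a: "\<And>xs. xs \<in> X \<Longrightarrow> list_pow f xs - (\<Sum>g\<in>G. const (a xs g) * g) \<in> J"
    by blast
  obtain c where c: "\<exists>xs\<in>X. c xs \<noteq> 0" "\<And>g. g \<in> G \<Longrightarrow> (\<Sum>xs\<in>X. c xs * a xs g) = 0"
    using underdetermined_system[OF G(1) finX card, of a] by blast
  have "(\<Sum>xs\<in>X. const (c xs) * (list_pow f xs - (\<Sum>g\<in>G. const (a xs g) * g))) \<in> J"
    by (intro pideal_sum[OF pideal] pidealD(8)[OF pideal] a)
  also have "(\<Sum>xs\<in>X. const (c xs) * (list_pow f xs - (\<Sum>g\<in>G. const (a xs g) * g))) =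
    (\<Sum>xs\<in>X. const (c xs) * list_pow f xs) - (\<Sum>xs\<in>X. \<Sum>g\<in>G. const (c xs * a xs g) * g)"
    by (simp add: sum_subtractf right_diff_distrib sum_distrib_left mult.assoc)
  also have "(\<Sum>xs\<in>X. \<Sum>g\<in>G. const (c xs * a xs g) * g) = (\<Sum>g\<in>G. const (\<Sum>xs\<in>X. c xs * a xs g) * g)"
    unfolding const_sum sum_distrib_right by (rule sum.swap)
  also have "\<dots> = 0" using c(2) by simp
  finally have "(\<Sum>xs\<in>X. const (c xs) * list_pow f xs) \<in> P 0" using P(3) by auto
  then have "c xs = 0" if "xs \<in> X" for xs
    using prime_chain_independent[of "Suc e" V P f c B xs] P(1,2) f that unfolding X_def by blast
  with c(1) show False by blast
qed

text \<open>Steinitz exchange modulo \<open>J\<close> without inverting the matrix \<open>M\<close>: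
  the \<open>d\<close> elements \<open>l' i\<close> together with \<open>l j\<close> have
  coordinates in only \<open>d\<close> elements, so they satisfy a nontrivial relation, and
  independence of the \<open>l' i\<close> forces a nonzero coefficient at
  \<open>l j\<close>.\<close>

lemma exchange:
  fixes J :: "('v, 'a::field) mpoly set" and d :: nat
  assumes J: "pideal V J"
    and M: "\<And>i. i < d \<Longrightarrow> l' i - (\<Sum>j<d. const (M i j) * l j) \<in> J"
    and indep: "\<And>c. (\<Sum>i<d. const (c i) * l' i) \<in> J \<Longrightarrow> \<forall>i<d. c i = 0"
    and j: "j < d"
  shows "\<exists>c. l j - (\<Sum>i<d. const (c i) * l' i) \<in> J"
proof -
  \<comment> \<open>Row \<open>d\<close> holds the coordinates of \<open>l j\<close>, the earlier
    rows those of the \<open>l' b\<close>.\<close>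
  define a where "a b g = (if b < d then M b g else if g = j then 1 else 0)" for b g
  have "\<exists>c. (\<exists>b\<in>{..d}. c b \<noteq> 0) \<and> (\<forall>g\<in>{..<d}. (\<Sum>b\<le>d. c b * a b g) = 0)"
    by (rule underdetermined_system) auto
  then obtain c where c: "\<exists>b\<in>{..d}. c b \<noteq> 0" "\<And>g. g < d \<Longrightarrow> (\<Sum>b\<le>d. c b * a b g) = 0"
    by blast
  have c': "(\<Sum>i<d. c i * M i g) = - (if g = j then c d else 0)" if "g < d" for g
  proof -
    have "(\<Sum>b\<le>d. c b * a b g) = (\<Sum>b<d. c b * a b g) + c d * a d g"
      by (simp add: lessThan_Suc_atMost[symmetric])
    also have "(\<Sum>b<d. c b * a b g) = (\<Sum>i<d. c i * M i g)"
      by (intro sum.cong) (auto simp: a_def)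
    also have "c d * a d g = (if g = j then c d else 0)" by (simp add: a_def)
    finally show ?thesis using c(2)[OF that] by (simp add: eq_neg_iff_add_eq_0)
  qed
  have "(\<Sum>i<d. const (c i) * (l' i - (\<Sum>j<d. const (M i j) * l j))) \<in> J"
    by (intro pideal_sum[OF J] pidealD(8)[OF J] M) auto
  also have "(\<Sum>i<d. const (c i) * (l' i - (\<Sum>j<d. const (M i j) * l j))) =
    (\<Sum>i<d. const (c i) * l' i) - (\<Sum>i<d. \<Sum>g<d. const (c i * M i g) * l g)"
    by (simp add: right_diff_distrib sum_subtractf sum_distrib_left mult.assoc)
  also have "(\<Sum>i<d. \<Sum>g<d. const (c i * M i g) * l g) = (\<Sum>g<d. const (\<Sum>i<d. c i * M i g) * l g)"
    unfolding const_sum sum_distrib_right by (rule sum.swap)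
  also have "\<dots> = (\<Sum>g<d. if g = j then - (const (c d) * l j) else 0)"
    by (intro sum.cong) (auto simp: c')
  also have "\<dots> = - (const (c d) * l j)" using j by simp
  finally have mem: "(\<Sum>i<d. const (c i) * l' i) + const (c d) * l j \<in> J" by simp
  have "c d \<noteq> 0"
  proof
    assume "c d = 0"
    with mem have "\<forall>i<d. c i = 0" using indep[of c] by simp
    with c(1) \<open>c d = 0\<close> show False by (metis atMost_iff le_neq_implies_less)
  qed
  have "const (inverse (c d)) * ((\<Sum>i<d. const (c i) * l' i) + const (c d) * l j) \<in> J"
    using mem by (rule pidealD(8)[OF J])
  also have "const (inverse (c d)) * ((\<Sum>i<d. const (c i) * l' i) + const (c d) * l j) =
    const (inverse (c d) * c d) * l j - (\<Sum>i<d. const (- (inverse (c d) * c i)) * l' i)"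
    by (simp add: distrib_left sum_distrib_left sum_negf mult.assoc)
  finally show ?thesis
    using \<open>c d \<noteq> 0\<close> by (auto intro!: exI[of _ "\<lambda>i. - (inverse (c d) * c i)"])
qed

text \<open>The relation expresses \<open>l p\<close> by the other forms. The last form is moved
  into slot \<open>p\<close> so that the remaining ones are again indexed by 0, ..., e - 1; for p =
  e nothing moves.\<close>

lemma drop_dependent:
  fixes J :: "('v, 'a::field) mpoly set"
  assumes J: "pideal V J" and l: "\<And>j. j < Suc e \<Longrightarrow> l j \<in> polys V"
    and dep: "(\<Sum>i<Suc e. const (c i) * l i) \<in> J" and p: "p < Suc e" "c p \<noteq> 0"
  shows "idl V J (Suc e) l \<subseteq> idl V J e (\<lambda>i. if i = p then l e else l i)"
proof -
  let ?l = "\<lambda>i. if i = p then l e else l i"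
  let ?K = "idl V J e ?l"
  have pideal: "pideal V ?K" by (rule idl_pideal[OF J]) (use l in auto)
  have other: "l j \<in> ?K" if "j < Suc e" "j \<noteq> p" for j
  proof (cases "j < e")
    case True
    then show ?thesis using idl_gen[OF J True, of ?l] that by simp
  next
    case False
    then have "j = e" "p < e" using that p by auto
    then show ?thesis using idl_gen[OF J \<open>p < e\<close>, of ?l] by simp
  qed
  have "(\<Sum>i\<in>{..<Suc e} - {p}. const (c i) * l i) \<in> ?K"
    using other by (intro pideal_sum[OF pideal] pidealD(8)[OF pideal]) auto
  then have "(\<Sum>i<Suc e. const (c i) * l i) - (\<Sum>i\<in>{..<Suc e} - {p}. const (c i) * l i) \<in> ?K"
    by (intro pidealD(7)[OF pideal] idl_incl[OF dep])
  moreover have "(\<Sum>i<Suc e. const (c i) * l i) = const (c p) * l p + (\<Sum>i\<in>{..<Suc e} - {p}. const (c i) * l i)"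
    using p by (intro sum.remove) auto
  ultimately have "const (c p) * l p \<in> ?K" by (simp only: add_diff_cancel_right')
  then have "const (inverse (c p)) * (const (c p) * l p) \<in> ?K" by (rule pidealD(8)[OF pideal])
  then have "l p \<in> ?K" using p by (simp add: mult.assoc[symmetric] flip: const_simps(4))
  then have "l j \<in> ?K" if "j < Suc e" for j using other[OF that] by (cases "j = p") auto
  then show ?thesis by (intro idl_least[OF pideal]) (auto intro: idl_incl)
qed

text \<open>Chains are kept in the polynomial ring. Primes above \<open>J\<close> correspond to
  primes of the quotient by \<open>J\<close>, so this says that the quotient has dimension at least
  \<open>n\<close>.\<close>

definition has_chain :: "'v set \<Rightarrow> ('v, 'a::comm_ring_1) mpoly set \<Rightarrow> nat \<Rightarrow> bool" where
  "has_chain V J n \<longleftrightarrow> (\<exists>P. (\<forall>i\<le>n. pprime V (P i)) \<and> (\<forall>i<n. P i \<subset> P (Suc i)) \<and> J \<subseteq> P 0)"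

lemma reducible_bound:
  fixes J :: "('v, 'a::field) mpoly set"
  assumes "finite V" "hideal V J" "reducible V (F V 1) J e"
  shows "\<not> has_chain V J (Suc e)"
proof
  assume "has_chain V J (Suc e)"
  then obtain P where P: "\<And>i. i \<le> Suc e \<Longrightarrow> pprime V (P i)" "\<And>i. i < Suc e \<Longrightarrow> P i \<subset> P (Suc i)" "J \<subseteq> P 0"
    unfolding has_chain_def by blast
  obtain l n where l: "\<And>j. j < e \<Longrightarrow> l j \<in> F V 1" "F V n \<subseteq> idl V J e l"
    using assms(3) unfolding reducible_def by blast
  show False by (rule no_long_prime_chain[OF assms(1,2) l P])
qed

text \<open>The converse of \<open>reducible_bound\<close>, with the forms taken from a prescribed
  space \<open>L\<close> that reduces as a whole.\<close>

lemma reducible_dim: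
  fixes J :: "('v, 'a::field) mpoly set"
  assumes "infinite (UNIV :: 'a set)" "finite V" "linear_space V L" "hideal V J" "1 \<notin> J"
    and "\<And>K. pideal V K \<Longrightarrow> J \<subseteq> K \<Longrightarrow> L \<subseteq> K \<Longrightarrow> F V N \<subseteq> K"
    and "\<not> has_chain V J (Suc d)"
  shows "reducible V L J d"
proof (rule ccontr)
  assume irr: "\<not> reducible V L J d"
  have "\<exists>P. (\<forall>i\<le>Suc d. pprime V (P i)) \<and> (\<forall>i<Suc d. P i \<subset> P (Suc i)) \<and> J \<subseteq> P 0"
    by (rule prime_chain[OF assms(1-5), where N = N]) (use assms(6) irr in auto)
  with assms(7) show False unfolding has_chain_def by blast
qed

text \<open>The chains say that the dimension is at least \<open>d\<close>. A dependent tuple could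
  be shortened by \<open>drop_dependent\<close>, which would bound the dimension by d - 1.\<close>

lemma reducing_forms_independent:
  fixes J :: "('v, 'a::field) mpoly set"
  assumes V: "finite V" and J: "hideal V J" and chain: "\<And>e. e < d \<Longrightarrow> has_chain V J (Suc e)"
    and l: "\<And>j. j < d \<Longrightarrow> l j \<in> F V 1" and red: "F V n \<subseteq> idl V J d l"
    and dep: "(\<Sum>i<d. const (c i) * l i) \<in> J"
  shows "\<forall>i<d. c i = 0"
proof (rule ccontr)
  assume "\<not> (\<forall>i<d. c i = 0)"
  then obtain p where p: "p < d" "c p \<noteq> 0" by auto
  then obtain e where d: "d = Suc e" by (cases d) auto
  have pideal: "pideal V J" using J by (auto simp: hideal_def)
  let ?l = "\<lambda>i. if i = p then l e else l i"
  have lV: "l j \<in> polys V" if "j < Suc e" for j using F_polys[OF l] that d by simp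
  have "idl V J (Suc e) l \<subseteq> idl V J e ?l"
    using drop_dependent[where l = l, OF pideal lV, of e c p] dep p unfolding d by blast
  then have "F V n \<subseteq> idl V J e ?l" using red unfolding d by blast
  moreover have "?l j \<in> F V 1" if "j < e" for j using l that unfolding d by auto
  ultimately have "reducible V (F V 1) J e" unfolding reducible_def
    by (intro exI[of _ ?l] exI[of _ n]) blast
  then show False using reducible_bound[OF V J] chain[of e] d by auto
qed

lemma idl_F1_elem:
  assumes "hideal V J" "\<And>j. j < e \<Longrightarrow> l j \<in> F V 1" "p \<in> F V 1" "p \<in> idl V J e l"
  shows "\<exists>c. p - (\<Sum>j<e. const (c j) * l j) \<in> J"
proof -
  obtain f r where f: "f \<in> J" "p = f + (\<Sum>j<e. r j * l j)" "\<And>j. r j \<in> F V (1 - 1)"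
    using F_idl_elem[where l = l and e = e, OF assms] by blast
  have "r j = const (lookup (r j) 0)" for j using F0_const[of "r j" V] f(3)[of j] by simp
  then have "p = f + (\<Sum>j<e. const (lookup (r j) 0) * l j)" using f(2) by simp
  then show ?thesis using f(1) by (intro exI[of _ "\<lambda>j. lookup (r j) 0"]) simp
qed

text \<open>The core of minimality. In degree 1 the coefficients are constants, so \<open>l'\<close>
  lies in the linear span of \<open>l\<close> modulo \<open>J\<close>; as a reducing tuple of length
  \<open>d\<close> it is independent, and \<open>exchange\<close> reverses the inclusion.\<close>

lemma reducing_forms_subset:
  fixes J :: "('v, 'a::field) mpoly set"
  assumes V: "finite V" and J: "hideal V J" and chain: "\<And>e. e < d \<Longrightarrow> has_chain V J (Suc e)"
    and l: "\<And>j. j < d \<Longrightarrow> l j \<in> F V 1" and l': "\<And>j. j < d \<Longrightarrow> l' j \<in> F V 1"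
    and red: "F V n \<subseteq> idl V J d l'" and sub: "\<And>j. j < d \<Longrightarrow> l' j \<in> idl V J d l"
  shows "idl V J d l \<subseteq> idl V J d l'"
proof -
  have pideal: "pideal V J" using J by (auto simp: hideal_def)
  have pideal': "pideal V (idl V J d l')" by (rule idl_pideal[OF pideal]) (use F_polys[OF l'] in auto)
  have "\<exists>c. l' i - (\<Sum>j<d. const (c j) * l j) \<in> J" if "i < d" for i
    using idl_F1_elem[where l = l, OF J l l' sub] that by blast
  then have "\<exists>M. \<forall>i. i < d \<longrightarrow> l' i - (\<Sum>j<d. const (M i j) * l j) \<in> J"
    by (intro choice) blast
  then obtain M where M: "\<And>i. i < d \<Longrightarrow> l' i - (\<Sum>j<d. const (M i j) * l j) \<in> J" by blast
  have "l j \<in> idl V J d l'" if j: "j < d" for j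
  proof -
    have "\<exists>c. l j - (\<Sum>i<d. const (c i) * l' i) \<in> J"
    proof (rule exchange[OF pideal])
      show "\<forall>i<d. c i = 0" if "(\<Sum>i<d. const (c i) * l' i) \<in> J" for c
        using reducing_forms_independent[where l = l' and d = d, OF V J chain l' red that] .
    qed (use M j in auto)
    then obtain c where c: "l j - (\<Sum>i<d. const (c i) * l' i) \<in> J" ..
    have "(\<Sum>i<d. const (c i) * l' i) \<in> idl V J d l'"
      by (intro pideal_sum[OF pideal'] pidealD(8)[OF pideal'] idl_gen[OF pideal]) auto
    from pidealD(3)[OF pideal' idl_incl[OF c] this] show ?thesis by simp
  qed
  then show ?thesis by (intro idl_least[OF pideal']) (auto intro: idl_incl)
qed

section \<open>Reductions of the quotient ring\<close>

text \<open>Coefficient sets smaller than their type are needed for k(v): the type of fractions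
  contains the indeterminates for all pairs of indices, and only those from
  \<open>gen_indices\<close> may occur.\<close>

definition subring_set :: "'a::comm_ring_1 set \<Rightarrow> bool" where
  "subring_set K \<longleftrightarrow> 1 \<in> K \<and> (\<forall>x\<in>K. \<forall>y\<in>K. x - y \<in> K) \<and> (\<forall>x\<in>K. \<forall>y\<in>K. x * y \<in> K)"

lemma subring_setD:
  assumes "subring_set K"
  shows "0 \<in> K" "1 \<in> K" "x \<in> K \<Longrightarrow> y \<in> K \<Longrightarrow> x - y \<in> K" "x \<in> K \<Longrightarrow> y \<in> K \<Longrightarrow> x * y \<in> K"
    "x \<in> K \<Longrightarrow> - x \<in> K" "x \<in> K \<Longrightarrow> y \<in> K \<Longrightarrow> x + y \<in> K"
proof -
  show zero: "0 \<in> K" using assms unfolding subring_set_def by (metis diff_self)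
  show "1 \<in> K" "x \<in> K \<Longrightarrow> y \<in> K \<Longrightarrow> x * y \<in> K" using assms by (auto simp: subring_set_def)
  show diff: "x \<in> K \<Longrightarrow> y \<in> K \<Longrightarrow> x - y \<in> K" for x y using assms by (auto simp: subring_set_def)
  show neg: "x \<in> K \<Longrightarrow> - x \<in> K" for x using diff[OF zero, of x] by simp
  show "x \<in> K \<Longrightarrow> y \<in> K \<Longrightarrow> x + y \<in> K" using diff[of x "- y"] neg[of y] by simp
qed

lemma mpoly_carrierI: "(\<And>t. lookup p t \<in> K) \<Longrightarrow> p \<in> polys V \<Longrightarrow> p \<in> carrier (mpoly_ring K V)"
  by (auto simp: mpoly_ring_def)

lemma mpoly_carrierD:
  assumes "p \<in> carrier (mpoly_ring K V)" shows "lookup p t \<in> K" "p \<in> polys V"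
  using assms by (auto simp: mpoly_ring_def)

lemma subring_sum: "subring_set K \<Longrightarrow> (\<And>x. x \<in> A \<Longrightarrow> f x \<in> K) \<Longrightarrow> sum f A \<in> K"
  by (induction A rule: infinite_finite_induct) (auto intro: subring_setD)

lemma mpoly_ring_closed:
  assumes K: "subring_set K" and p: "p \<in> carrier (mpoly_ring K V)"
  shows "- p \<in> carrier (mpoly_ring K V)"
    and "q \<in> carrier (mpoly_ring K V) \<Longrightarrow> p + q \<in> carrier (mpoly_ring K V)"
    and "q \<in> carrier (mpoly_ring K V) \<Longrightarrow> p * q \<in> carrier (mpoly_ring K V)"
proof -
  note pD = mpoly_carrierD[OF p]
  show "- p \<in> carrier (mpoly_ring K V)"
    by (rule mpoly_carrierI) (simp_all only: lookup_uminus subring_setD(5)[OF K] pD polys_closed)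
  show "p + q \<in> carrier (mpoly_ring K V)" if "q \<in> carrier (mpoly_ring K V)"
    by (rule mpoly_carrierI)
      (simp_all only: lookup_add subring_setD(6)[OF K] pD mpoly_carrierD[OF that] polys_closed)
  assume q: "q \<in> carrier (mpoly_ring K V)"
  have "p * q = (\<Sum>s\<in>keys p. Poly_Mapping.single s (lookup p s)) * (\<Sum>t\<in>keys q. Poly_Mapping.single t (lookup q t))"
    by (simp flip: mpoly_sum_xmons)
  also have "\<dots> = (\<Sum>s\<in>keys p. \<Sum>t\<in>keys q. Poly_Mapping.single (s + t) (lookup p s * lookup q t))"
    by (simp add: sum_product mult_single)
  finally have "lookup (p * q) u = (\<Sum>s\<in>keys p. \<Sum>t\<in>keys q. if s + t = u then lookup p s * lookup q t else 0)" for u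
    by (simp add: lookup_sum lookup_single when_def)
  moreover have "(if s + t = u then lookup p s * lookup q t else 0) \<in> K" for s t u
    using subring_setD(4)[OF K mpoly_carrierD(1)[OF p] mpoly_carrierD(1)[OF q]] subring_setD(1)[OF K]
    by simp
  ultimately have "lookup (p * q) u \<in> K" for u
    by (simp only:) (intro subring_sum[OF K])
  then show "p * q \<in> carrier (mpoly_ring K V)" 
    by (rule mpoly_carrierI[OF _ polys_mult[OF mpoly_carrierD(2)[OF p] mpoly_carrierD(2)[OF q]]])
qed

lemma const_carrier: "0 \<in> K \<Longrightarrow> a \<in> K \<Longrightarrow> const a \<in> carrier (mpoly_ring K V)"
  by (rule mpoly_carrierI) (auto simp: const_def lookup_single when_def)

lemma cring_mpoly_ring:
  assumes K: "subring_set K" shows "cring (mpoly_ring K V)"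
proof (rule cringI)
  have zero: "0 \<in> carrier (mpoly_ring K V)" and one: "1 \<in> carrier (mpoly_ring K V)"
    using const_carrier[of K 0 V] const_carrier[of K 1 V] subring_setD(1,2)[OF K] by auto
  note closed = zero one mpoly_ring_closed[OF K]
  show "abelian_group (mpoly_ring K V)"
  proof (rule abelian_groupI)
    fix x assume x: "x \<in> carrier (mpoly_ring K V)"
    show "\<exists>y\<in>carrier (mpoly_ring K V). y \<oplus>\<^bsub>mpoly_ring K V\<^esub> x = \<zero>\<^bsub>mpoly_ring K V\<^esub>"
      by (rule bexI[of _ "- x"]) (use closed(3)[OF x] in auto)
  qed (use closed in \<open>auto simp: ac_simps\<close>)
  show "comm_monoid (mpoly_ring K V)"
    by (rule comm_monoidI) (use closed in \<open>auto simp: ac_simps\<close>)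
qed (auto simp: distrib_right)

lemma ideal_mpoly_ring_iff:
  assumes K: "subring_set K"
  shows "ideal J (mpoly_ring K V) \<longleftrightarrow> J \<subseteq> carrier (mpoly_ring K V) \<and> 0 \<in> J \<and>
    (\<forall>x\<in>J. \<forall>y\<in>J. x + y \<in> J) \<and> (\<forall>r\<in>carrier (mpoly_ring K V). \<forall>x\<in>J. r * x \<in> J)"
    (is "_ \<longleftrightarrow> ?rhs")
proof
  interpret R: cring "mpoly_ring K V" by (rule cring_mpoly_ring[OF K])
  show ?rhs if "ideal J (mpoly_ring K V)"
  proof -
    interpret ideal J "mpoly_ring K V" by (rule that)
    show ?rhs using a_subset zero_closed a_closed I_l_closed by auto
  qed
  assume J: ?rhs
  have uminus: "- x \<in> J" if "x \<in> J" for x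
  proof -
    have "const (- 1) \<in> carrier (mpoly_ring K V)"
      by (intro const_carrier) (use subring_setD[OF K] in auto)
    then have "const (- 1) * x \<in> J" using J that by blast
    then show ?thesis by simp
  qed
  have inv: "\<ominus>\<^bsub>mpoly_ring K V\<^esub> x = - x" if "x \<in> carrier (mpoly_ring K V)" for x
    by (rule R.minus_equality) (use that mpoly_ring_closed[OF K that] in auto)
  show "ideal J (mpoly_ring K V)"
  proof (rule idealI)
    show "subgroup J (add_monoid (mpoly_ring K V))"
    proof (rule subgroup.intro)
      fix x assume x: "x \<in> J"
      then have "inv\<^bsub>add_monoid (mpoly_ring K V)\<^esub> x = - x"
        using inv[of x] J by (auto simp: a_inv_def)
      then show "inv\<^bsub>add_monoid (mpoly_ring K V)\<^esub> x \<in> J" using uminus[OF x] by simp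
    qed (use J in auto)
    show "x \<otimes>\<^bsub>mpoly_ring K V\<^esub> a \<in> J" "a \<otimes>\<^bsub>mpoly_ring K V\<^esub> x \<in> J"
      if "a \<in> J" "x \<in> carrier (mpoly_ring K V)" for a x
      using J that by (auto simp: mult.commute[of a x])
  qed (rule R.ring_axioms)
qed

lemma UNIV_subring: "subring_set UNIV"
  by (simp add: subring_set_def)

lemma ideal_iff_pideal: "ideal J (mpoly_ring UNIV V) \<longleftrightarrow> pideal V J"
  unfolding ideal_mpoly_ring_iff[OF UNIV_subring] pideal_def ..

lemma primeideal_iff_pprime: "primeideal P (mpoly_ring UNIV V) \<longleftrightarrow> pprime V P"
proof
  assume "primeideal P (mpoly_ring UNIV V)"
  then interpret primeideal P "mpoly_ring UNIV V" .
  have pideal: "pideal V P" using ideal_axioms by (simp add: ideal_iff_pideal)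
  have "1 \<notin> P" using one_imp_carrier I_notcarr by auto
  with pideal I_prime show "pprime V P" by (auto simp: pprime_def)
next
  assume P: "pprime V P"
  show "primeideal P (mpoly_ring UNIV V)"
  proof (rule primeidealI)
    show "carrier (mpoly_ring UNIV V) \<noteq> P" using P polys_closed(2)[of V] by (auto simp: pprime_def simp del: polys_closed)
  qed (use P cring_mpoly_ring[OF UNIV_subring] in \<open>auto simp: pprime_def ideal_iff_pideal\<close>)
qed

text \<open>The polynomials all of whose components lie in \<open>J\<close> form an ideal, and this
  ideal contains the homogeneous generators.\<close>

lemma homogeneous_ideal_hideal:
  assumes "homogeneous_ideal UNIV V J"
  shows "hideal V J"
proof -
  let ?R = "mpoly_ring UNIV V"
  interpret R: cring ?R by (rule cring_mpoly_ring[OF UNIV_subring])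
  obtain S where S: "S \<subseteq> (\<Union>n. F V n)" and J: "J = Idl\<^bsub>?R\<^esub> S"
    using assms unfolding homogeneous_ideal_def by blast
  have SV: "S \<subseteq> carrier ?R" using S by (auto intro: F_polys)
  have pideal: "pideal V J" using R.genideal_ideal[OF SV] unfolding J ideal_iff_pideal .
  define K where "K = {p \<in> polys V. \<forall>n. hom_part n p \<in> J}"
  have "pideal V K"
    unfolding pideal_def
  proof (intro conjI ballI)
    show "0 \<in> K" "K \<subseteq> polys V" using pidealD(2)[OF pideal] by (auto simp: K_def)
    show "x + y \<in> K" if "x \<in> K" "y \<in> K" for x y
      using that pidealD(3)[OF pideal] by (auto simp: K_def)
    show "r * x \<in> K" if "r \<in> polys V" "x \<in> K" for r x
    proof -
      have x: "x \<in> polys V" "\<And>n. hom_part n x \<in> J" using that by (auto simp: K_def)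
      have "hom_part n (r * x) \<in> J" for n
        unfolding hom_part_mult[OF that(1) x(1)]
        by (intro pideal_sum[OF pideal] pidealD(4)[OF pideal] F_polys[OF hom_part_F] that x)
      then show ?thesis using that x by (auto simp: K_def)
    qed
  qed
  moreover have "S \<subseteq> K"
  proof
    fix s assume s: "s \<in> S"
    then obtain m where m: "s \<in> F V m" using S by blast
    have "s \<in> J" unfolding J using R.genideal_self[OF SV] s by blast
    then show "s \<in> K" using m pidealD(2)[OF pideal] by (auto simp: K_def hom_part_of_F[OF m] intro: F_polys)
  qed
  ultimately have "J \<subseteq> K" unfolding J by (intro R.genideal_minimal) (simp add: ideal_iff_pideal)
  with pideal show ?thesis by (auto simp: hideal_def K_def)
qed

section \<open>Ideals of the quotient ring as ideals above \<open>I\<close>\<close>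

locale mpoly_quotient =
  fixes V :: "'v set" and I :: "('v, 'a::field) mpoly set"
  assumes hideal: "hideal V I"
begin

abbreviation "R \<equiv> mpoly_ring (UNIV :: 'a set) V"
abbreviation "A \<equiv> R Quot I"
abbreviation proj where "proj \<equiv> (+>\<^bsub>R\<^esub>) I"
abbreviation "G \<equiv> quot_piece UNIV V I"

lemma pideal: "pideal V I"
  using hideal by (simp add: hideal_def)

sublocale R: cring R
  by (rule cring_mpoly_ring[OF UNIV_subring])

sublocale I: ideal I R
  using pideal by (simp add: ideal_iff_pideal)

sublocale proj: ring_hom_ring R A proj
  by (rule I.rcos_ring_hom_ring)

sublocale A: cring A
  by (rule I.quotient_is_cring[OF R.is_cring])

lemma carrier_A: "carrier A = proj ` polys V"
  by (auto simp: FactRing_def A_RCOSETS_def')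

lemma proj_eq_iff: "f \<in> polys V \<Longrightarrow> g \<in> polys V \<Longrightarrow> proj f = proj g \<longleftrightarrow> f - g \<in> I"
proof -
  assume f: "f \<in> polys V" and g: "g \<in> polys V"
  have "\<ominus>\<^bsub>R\<^esub> g = - g"
    by (rule R.minus_equality) (use g in auto)
  then have "f \<ominus>\<^bsub>R\<^esub> g = f - g" by (simp add: a_minus_def)
  then show ?thesis using R.quotient_eq_iff_same_a_r_cos[OF I.is_ideal f g] by simp
qed

text \<open>Statements about graded pieces of the quotient are moved to the polynomial ring through
  this preimage; \<open>piece_iff\<close> translates the condition that an ideal contains a whole
  piece.\<close>

definition pre :: "('v, 'a) mpoly set set \<Rightarrow> ('v, 'a) mpoly set" where
  "pre Q = {f \<in> polys V. proj f \<in> Q}"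

lemma pre_pideal:
  assumes "ideal Q A" shows "pideal V (pre Q)" "I \<subseteq> pre Q"
proof -
  show "pideal V (pre Q)"
    using proj.ideal_vimage[OF assms] by (simp add: ideal_iff_pideal pre_def)
  interpret Q: ideal Q A by fact
  have "proj f = \<zero>\<^bsub>A\<^esub>" if "f \<in> I" for f
    using I.a_rcos_const[OF that] by (simp add: FactRing_def)
  then show "I \<subseteq> pre Q" using pidealD(1)[OF pideal] Q.zero_closed by (auto simp: pre_def)
qed

lemma pre_image: "pideal V K \<Longrightarrow> I \<subseteq> K \<Longrightarrow> f \<in> polys V \<Longrightarrow> proj f \<in> proj ` K \<Longrightarrow> f \<in> K"
proof -
  assume K: "pideal V K" "I \<subseteq> K" and f: "f \<in> polys V" and "proj f \<in> proj ` K"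
  then obtain k where k: "k \<in> K" "proj f = proj k" by blast
  then have "f - k \<in> I" using proj_eq_iff[OF f] pidealD(1)[OF K(1)] by blast
  then have "(f - k) + k \<in> K" using K k by (intro pidealD(3)[OF K(1)]) auto
  then show "f \<in> K" by simp
qed

lemma image_ideal: "pideal V K \<Longrightarrow> ideal (proj ` K) A"
  using R.ring_ideal_imp_quot_ideal[OF I.is_ideal] by (simp add: ideal_iff_pideal)

lemma pre_genideal:
  assumes "L \<subseteq> polys V" "pideal V K" "I \<subseteq> K" "L \<subseteq> K"
  shows "pre (Idl\<^bsub>A\<^esub> (proj ` L)) \<subseteq> K"
proof
  fix f assume f: "f \<in> pre (Idl\<^bsub>A\<^esub> (proj ` L))"
  have "Idl\<^bsub>A\<^esub> (proj ` L) \<subseteq> proj ` K"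
    by (rule proj.S.genideal_minimal[OF image_ideal[OF assms(2)]]) (use assms(4) in auto)
  with f show "f \<in> K" using pre_image[OF assms(2,3)] by (auto simp: pre_def)
qed

lemma genideal_A: "L \<subseteq> polys V \<Longrightarrow> ideal (Idl\<^bsub>A\<^esub> (proj ` L)) A" "L \<subseteq> polys V \<Longrightarrow> proj ` L \<subseteq> Idl\<^bsub>A\<^esub> (proj ` L)"
  by (rule proj.S.genideal_ideal proj.S.genideal_self; auto simp: carrier_A)+

lemma piece_iff: "Q \<inter> G n = G n \<longleftrightarrow> F V n \<subseteq> pre Q"
  by (auto simp: quot_piece_def pre_def intro: F_polys)

lemma is_reduction_ideal: "is_reduction A G Q \<Longrightarrow> ideal Q A"
proof -
  assume "is_reduction A G Q"
  then obtain L where L: "L \<subseteq> G 1" "Q = Idl\<^bsub>A\<^esub> L" unfolding is_reduction_def by blast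
  have "G 1 \<subseteq> carrier A" by (auto simp: quot_piece_def carrier_A intro: F_polys)
  with L show "ideal Q A" by (auto intro: proj.S.genideal_ideal)
qed

text \<open>The space \<open>L\<close> to which \<open>reducible_dim\<close> is applied. It contains
  all linear forms with class in \<open>Q\<close>, not just chosen generators, because the
  perturbation of tuples needs closure under linear combinations.\<close>

definition lin :: "('v, 'a) mpoly set set \<Rightarrow> ('v, 'a) mpoly set" where
  "lin Q = {f \<in> F V 1. proj f \<in> Q}"

lemma lin_linear_space: "ideal Q A \<Longrightarrow> linear_space V (lin Q)"
proof -
  assume "ideal Q A"
  note pideal = pre_pideal(1)[OF this]
  have "lin Q = F V 1 \<inter> pre Q" by (auto simp: lin_def pre_def intro: F_polys)
  then show ?thesis using pidealD[OF pideal] by (auto simp: linear_space_def)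
qed

text \<open>Supplies the assumption on \<open>N\<close> in \<open>reducible_dim\<close>: a reduction
  is generated by classes of linear forms, so an ideal above \<open>I\<close> that contains
  \<open>lin Q\<close> contains the whole preimage of \<open>Q\<close>.\<close>

lemma reduction_lin:
  assumes "is_reduction A G Q"
  shows "\<exists>N. \<forall>K. pideal V K \<longrightarrow> I \<subseteq> K \<longrightarrow> lin Q \<subseteq> K \<longrightarrow> F V N \<subseteq> K"
proof -
  obtain L N where L: "L \<subseteq> G 1" "Q = Idl\<^bsub>A\<^esub> L" and N: "Q \<inter> G N = G N"
    using assms unfolding is_reduction_def by blast
  have LQ: "L \<subseteq> Q" unfolding L(2) by (auto simp: genideal_def)
  have "L = proj ` {f \<in> F V 1. proj f \<in> L}" using L(1) by (auto simp: quot_piece_def)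
  then have Q: "Q = Idl\<^bsub>A\<^esub> (proj ` {f \<in> F V 1. proj f \<in> L})" using L(2) by simp
  have "F V N \<subseteq> K" if K: "pideal V K" "I \<subseteq> K" "lin Q \<subseteq> K" for K
  proof -
    have "pre Q \<subseteq> K" unfolding Q
      by (rule pre_genideal[OF _ K(1,2)]) (use K(3) LQ in \<open>auto simp: lin_def intro: F_polys\<close>)
    then show ?thesis using N unfolding piece_iff by blast
  qed
  then show ?thesis by blast
qed

definition gen :: "nat \<Rightarrow> (nat \<Rightarrow> ('v, 'a) mpoly) \<Rightarrow> ('v, 'a) mpoly set set" where
  "gen d l = Idl\<^bsub>A\<^esub> (proj ` l ` {..<d})"

context
  fixes d :: nat and l :: "nat \<Rightarrow> ('v, 'a) mpoly"
  assumes l: "\<And>j. j < d \<Longrightarrow> l j \<in> F V 1"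
begin

lemma gen_ideal: "ideal (gen d l) A"
  unfolding gen_def by (rule genideal_A) (use l in \<open>auto intro: F_polys\<close>)

lemma gen_least: "ideal Q A \<Longrightarrow> (\<And>j. j < d \<Longrightarrow> proj (l j) \<in> Q) \<Longrightarrow> gen d l \<subseteq> Q"
  unfolding gen_def by (rule proj.S.genideal_minimal) auto

lemma pre_gen: "pre (gen d l) = idl V I d l"
proof
  have lV: "l j \<in> polys V" if "j < d" for j using l[OF that] by (rule F_polys)
  show "pre (gen d l) \<subseteq> idl V I d l"
    unfolding gen_def
  proof (rule pre_genideal)
    show "pideal V (idl V I d l)" using lV by (rule idl_pideal[OF pideal])
    show "l ` {..<d} \<subseteq> idl V I d l" using idl_gen[OF pideal] by blast
  qed (use lV in \<open>auto intro: idl_incl\<close>)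
  show "idl V I d l \<subseteq> pre (gen d l)"
  proof (rule idl_least)
    show "l j \<in> pre (gen d l)" if "j < d" for j
      using genideal_A(2)[of "l ` {..<d}"] lV that unfolding pre_def gen_def by blast
  qed (use pre_pideal[OF gen_ideal] in auto)
qed

lemma gen_reduction:
  assumes V: "finite V" and "F V N \<subseteq> idl V I d l"
  shows "is_reduction A G (gen d l)"
  unfolding is_reduction_def
proof (intro conjI exI allI impI)
  show "proj ` l ` {..<d} \<subseteq> G 1" using l by (auto simp: quot_piece_def)
  show "gen d l = Idl\<^bsub>A\<^esub> (proj ` l ` {..<d})" by (simp add: gen_def)
  show "gen d l \<inter> G n = G n" if "N \<le> n" for n
    unfolding piece_iff
    by (rule F_subset_mono[OF pre_pideal(1)[OF gen_ideal] V _ that]) (use assms in \<open>simp add: pre_gen\<close>)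
qed

end

text \<open>By \<open>reducible_dim\<close> a reduction \<open>Q\<close> inside
  \<open>gen d l\<close> contains the classes of a reducing tuple of the same length
  \<open>d\<close>; by \<open>reducing_forms_subset\<close> that tuple already generates every
  \<open>l j\<close> modulo \<open>I\<close>.\<close>

lemma minimal_reduction_gen:
  assumes inf: "infinite (UNIV :: 'a set)" and V: "finite V" and "1 \<notin> I"
    and chains: "\<And>e. e < d \<Longrightarrow> has_chain V I (Suc e)" "\<not> has_chain V I (Suc d)"
    and l: "\<And>j. j < d \<Longrightarrow> l j \<in> F V 1" and red: "F V N \<subseteq> idl V I d l"
  shows "is_minimal_reduction A G (gen d l)"
  unfolding is_minimal_reduction_def
proof (intro conjI allI impI)
  show "is_reduction A G (gen d l)" using l V red by (rule gen_reduction)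
  fix Q assume Q: "is_reduction A G Q \<and> Q \<subseteq> gen d l"
  then have idQ: "ideal Q A" by (blast intro: is_reduction_ideal)
  have linear_space: "linear_space V (lin Q)" using idQ by (rule lin_linear_space)
  obtain M where M: "\<And>K. pideal V K \<Longrightarrow> I \<subseteq> K \<Longrightarrow> lin Q \<subseteq> K \<Longrightarrow> F V M \<subseteq> K"
    using reduction_lin Q by blast
  have "reducible V (lin Q) I d"
    using reducible_dim[OF inf V linear_space hideal \<open>1 \<notin> I\<close> M chains(2)] .
  then obtain l' n where l': "\<And>j. j < d \<Longrightarrow> l' j \<in> lin Q" "F V n \<subseteq> idl V I d l'"
    unfolding reducible_def by blast
  have l'F: "l' j \<in> F V 1" if "j < d" for j using l'(1)[OF that] by (simp add: lin_def)
  have "l' j \<in> idl V I d l" if "j < d" for j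
  proof -
    have "pre (gen d l) = idl V I d l" using l by (rule pre_gen)
    moreover have "l' j \<in> pre (gen d l)"
      using l'(1)[OF that] Q by (auto simp: lin_def pre_def intro: F_polys)
    ultimately show ?thesis by simp
  qed
  then have "idl V I d l \<subseteq> idl V I d l'"
    using reducing_forms_subset[where l = l and l' = l', OF V hideal chains(1) l l'F l'(2)] by blast
  also have "idl V I d l' \<subseteq> pre Q"
    using l'(1) pre_pideal[OF idQ] by (intro idl_least) (auto simp: lin_def pre_def intro: F_polys)
  finally have "gen d l \<subseteq> Q"
    using idl_gen[OF pideal] by (intro gen_least[OF l idQ]) (auto simp: pre_def)
  with Q show "Q = gen d l" by blast
qed

text \<open>By \<open>reducible_dim\<close> the reduction contains one generated by \<open>d\<close>
  linear forms, and minimality makes the two equal.\<close>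

lemma minimal_reduction_is_gen:
  assumes inf: "infinite (UNIV :: 'a set)" and V: "finite V" and "1 \<notin> I"
    and chain: "\<not> has_chain V I (Suc d)" and Q: "is_minimal_reduction A G Q"
  shows "\<exists>l. (\<forall>j<d. l j \<in> F V 1) \<and> Q = gen d l"
proof -
  have red: "is_reduction A G Q" using Q by (simp add: is_minimal_reduction_def)
  then have idQ: "ideal Q A" by (rule is_reduction_ideal)
  obtain M where M: "\<And>K. pideal V K \<Longrightarrow> I \<subseteq> K \<Longrightarrow> lin Q \<subseteq> K \<Longrightarrow> F V M \<subseteq> K"
    using reduction_lin[OF red] by blast
  have "reducible V (lin Q) I d"
    using reducible_dim[OF inf V lin_linear_space[OF idQ] hideal \<open>1 \<notin> I\<close> M chain] .
  then obtain l n where l: "\<And>j. j < d \<Longrightarrow> l j \<in> lin Q" "F V n \<subseteq> idl V I d l"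
    unfolding reducible_def by blast
  have lF: "l j \<in> F V 1" if "j < d" for j using l(1)[OF that] by (simp add: lin_def)
  have "gen d l \<subseteq> Q" by (rule gen_least[OF lF idQ]) (use l(1) in \<open>auto simp: lin_def\<close>)
  moreover have "is_reduction A G (gen d l)" using lF V l(2) by (rule gen_reduction)
  ultimately have "gen d l = Q" using Q by (auto simp: is_minimal_reduction_def)
  with lF show ?thesis by blast
qed

lemma has_chain_iff:
  "has_chain V I n \<longleftrightarrow> (\<exists>P. (\<forall>i\<le>n. primeideal (P i) A) \<and> (\<forall>i<n. P i \<subset> P (Suc i)))"
proof
  assume "has_chain V I n"
  then obtain P where P: "\<And>i. i \<le> n \<Longrightarrow> pprime V (P i)" "\<And>i. i < n \<Longrightarrow> P i \<subset> P (Suc i)" "I \<subseteq> P 0"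
    unfolding has_chain_def by blast
  have sub: "I \<subseteq> P i" if "i \<le> n" for i
    using that P(2,3) by (induction i) (auto, metis Suc_le_lessD less_imp_le psubsetE subsetD)
  have pidealP: "pideal V (P i)" if "i \<le> n" for i using P(1)[OF that] by (simp add: pprime_def)
  have "primeideal (proj ` P i) A" if i: "i \<le> n" for i
  proof (rule primeidealI)
    show "ideal (proj ` P i) A" by (rule image_ideal[OF pidealP[OF i]])
    show "cring A" by (rule A.is_cring)
    have "proj 1 \<notin> proj ` P i" using pre_image[OF pidealP[OF i] sub[OF i], of 1] P(1)[OF i] by (auto simp: pprime_def)
    then show "carrier A \<noteq> proj ` P i" unfolding carrier_A using polys_closed(2)[of V] by blast
    fix a b assume "a \<in> carrier A" "b \<in> carrier A" and ab: "a \<otimes>\<^bsub>A\<^esub> b \<in> proj ` P i"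
    then obtain f g where fg: "f \<in> polys V" "g \<in> polys V" "a = proj f" "b = proj g"
      unfolding carrier_A by blast
    then have "a \<otimes>\<^bsub>A\<^esub> b = proj (f * g)" using proj.hom_mult[of f g] by simp
    with ab have "f * g \<in> P i" using pre_image[OF pidealP[OF i] sub[OF i]] fg by auto
    then show "a \<in> proj ` P i \<or> b \<in> proj ` P i" using P(1)[OF i] fg by (auto simp: pprime_def)
  qed
  moreover have "proj ` P i \<subset> proj ` P (Suc i)" if i: "i < n" for i
  proof -
    obtain f where f: "f \<in> P (Suc i)" "f \<notin> P i" using P(2)[OF i] by blast
    moreover have "f \<in> polys V" using f pidealD(1)[OF pidealP[of "Suc i"]] i by auto
    ultimately have "proj f \<notin> proj ` P i" using pre_image[OF pidealP[of i] sub[of i]] i by auto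
    with f P(2)[OF i] show ?thesis by blast
  qed
  ultimately show "\<exists>P. (\<forall>i\<le>n. primeideal (P i) A) \<and> (\<forall>i<n. P i \<subset> P (Suc i))"
    by (intro exI[of _ "\<lambda>i. proj ` P i"]) auto
next
  assume "\<exists>P. (\<forall>i\<le>n. primeideal (P i) A) \<and> (\<forall>i<n. P i \<subset> P (Suc i))"
  then obtain P where P: "\<And>i. i \<le> n \<Longrightarrow> primeideal (P i) A" "\<And>i. i < n \<Longrightarrow> P i \<subset> P (Suc i)" by blast
  have idP: "ideal (P i) A" if "i \<le> n" for i using P(1)[OF that] by (simp add: primeideal_def)
  have "pprime V (pre (P i))" if "i \<le> n" for i
    using proj.primeideal_vimage[OF R.is_cring P(1)[OF that]] by (simp add: primeideal_iff_pprime pre_def)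
  moreover have "pre (P i) \<subset> pre (P (Suc i))" if i: "i < n" for i
  proof -
    obtain a where a: "a \<in> P (Suc i)" "a \<notin> P i" using P(2)[OF i] by blast
    interpret Q: ideal "P (Suc i)" A using idP[of "Suc i"] i by simp
    have "a \<in> carrier A" using a(1) by (rule Q.Icarr)
    then obtain f where "f \<in> polys V" "a = proj f" unfolding carrier_A by blast
    then show ?thesis using a P(2)[OF i] by (auto simp: pre_def)
  qed
  moreover have "I \<subseteq> pre (P 0)" using pre_pideal(2)[OF idP[of 0]] by simp
  ultimately show "has_chain V I n" unfolding has_chain_def by (intro exI[of _ "\<lambda>i. pre (P i)"]) auto
qed

lemma has_chain_less: "has_chain V I n \<Longrightarrow> m \<le> n \<Longrightarrow> has_chain V I m"
  unfolding has_chain_def by (metis le_trans less_le_trans)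

lemma krull_dim_chains:
  assumes "krull_dim A = enat d"
  shows "e < d \<Longrightarrow> has_chain V I (Suc e)" "\<not> has_chain V I (Suc d)"
proof -
  have dim: "Sup {enat n | n. has_chain V I n} = enat d"
    using assms unfolding krull_dim_def has_chain_iff .
  show "\<not> has_chain V I (Suc d)"
  proof
    assume "has_chain V I (Suc d)"
    then have "enat (Suc d) \<le> Sup {enat n | n. has_chain V I n}" by (intro Sup_upper) blast
    then show False unfolding dim by simp
  qed
  assume "e < d"
  then have "enat e < Sup {enat n | n. has_chain V I n}" unfolding dim by simp
  then obtain n where "e < n" "has_chain V I n" by (auto simp: less_Sup_iff)
  then show "has_chain V I (Suc e)" by (auto intro: has_chain_less)
qed

text \<open>The form in which the reduction number is used from here on, free of the quotient ring
  and of minimality. Every tuple of \<open>d\<close> linear forms that reduces in some degree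
  generates a minimal reduction, and every minimal reduction arises in this way; since such a tuple
  exists, both nested minima are attained.\<close>

lemma reduction_number_char:
  assumes inf: "infinite (UNIV :: 'a set)" and V: "finite V" and "1 \<notin> I" and dim: "krull_dim A = enat d"
  defines "r \<equiv> reduction_number A G"
  shows "\<exists>l. (\<forall>j<d. l j \<in> F V 1) \<and> F V (r + 1) \<subseteq> idl V I d l"
    and "\<And>l n. (\<And>j. j < d \<Longrightarrow> l j \<in> F V 1) \<Longrightarrow> F V (n + 1) \<subseteq> idl V I d l \<Longrightarrow> r \<le> n"
proof -
  note chains = krull_dim_chains[OF dim]
  have num: "reduction_number_wrt G (gen d l) = (LEAST n. F V (n + 1) \<subseteq> idl V I d l)"
    if l: "\<And>j. j < d \<Longrightarrow> l j \<in> F V 1" for l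
  proof -
    have "pre (gen d l) = idl V I d l" using l by (rule pre_gen)
    then show ?thesis by (simp add: reduction_number_wrt_def piece_iff)
  qed
  \<comment> \<open>With \<open>L\<close> the space of all linear forms the assumption on
    \<open>N\<close> is trivial for N = 1; closing the proof by assumption finds this
    instance.\<close>
  have "reducible V (F V 1) I d"
  proof (rule reducible_dim[OF inf V linear_space_F hideal \<open>1 \<notin> I\<close> _ chains(2)])
  qed
  then obtain l n where l: "\<And>j. j < d \<Longrightarrow> l j \<in> F V 1" "F V n \<subseteq> idl V I d l"
    unfolding reducible_def by blast
  have "is_minimal_reduction A G (gen d l)"
    by (rule minimal_reduction_gen[OF inf V \<open>1 \<notin> I\<close> chains l])
  then have "\<exists>r Q. is_minimal_reduction A G Q \<and> r = reduction_number_wrt G Q" by blast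
  then have "\<exists>Q. is_minimal_reduction A G Q \<and> r = reduction_number_wrt G Q"
    unfolding r_def reduction_number_def by (rule LeastI_ex)
  then obtain Q where Q: "is_minimal_reduction A G Q" "r = reduction_number_wrt G Q" by blast
  obtain l where l: "\<And>j. j < d \<Longrightarrow> l j \<in> F V 1" "Q = gen d l"
    using minimal_reduction_is_gen[OF inf V \<open>1 \<notin> I\<close> chains(2) Q(1)] by blast
  have "is_reduction A G Q" using Q(1) by (simp add: is_minimal_reduction_def)
  then obtain N where "\<And>n. N \<le> n \<Longrightarrow> Q \<inter> G n = G n" unfolding is_reduction_def by blast
  moreover have "pre (gen d l) = idl V I d l" using l(1) by (rule pre_gen)
  ultimately have "F V (N + 1) \<subseteq> idl V I d l" unfolding piece_iff l(2) by simp
  moreover have "r = (LEAST n. F V (n + 1) \<subseteq> idl V I d l)" unfolding Q(2) l(2) using l(1) by (rule num)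
  ultimately have "F V (r + 1) \<subseteq> idl V I d l"
    by (simp only:) (rule LeastI[where P = "\<lambda>n. F V (n + 1) \<subseteq> idl V I d l"])
  with l(1) show "\<exists>l. (\<forall>j<d. l j \<in> F V 1) \<and> F V (r + 1) \<subseteq> idl V I d l" by blast
  fix l n assume l: "\<And>j. j < d \<Longrightarrow> l j \<in> F V 1" and n: "F V (n + 1) \<subseteq> idl V I d l"
  have "is_minimal_reduction A G (gen d l)"
    by (rule minimal_reduction_gen[OF inf V \<open>1 \<notin> I\<close> chains l n])
  then have "r \<le> reduction_number_wrt G (gen d l)"
    unfolding r_def reduction_number_def by (intro Least_le) blast
  also have "reduction_number_wrt G (gen d l) = (LEAST n. F V (n + 1) \<subseteq> idl V I d l)" using l by (rule num)
  also have "\<dots> \<le> n" using n by (rule Least_le)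
  finally show "r \<le> n" .
qed

end

section \<open>Generic substitution\<close>

lemma eval_F:
  fixes x :: "'v \<Rightarrow> ('w, 'b::comm_ring_1) mpoly"
  assumes c: "coeff_hom h" and x: "\<And>i. i \<in> V \<Longrightarrow> x i \<in> F U 1" and p: "p \<in> F V n"
  shows "eval_mpoly (\<lambda>a. const (h a)) x p \<in> F U n"
proof -
  interpret h: coeff_hom "\<lambda>a. const (h a) :: ('w, 'b) mpoly" using c by (rule coeff_hom.const_comp)
  have mon: "keys t \<subseteq> V \<Longrightarrow> mon_degree t = k \<Longrightarrow> mon_val x t \<in> F U k" for t k
  proof (induction k arbitrary: t)
    case 0
    then show ?case by simp
  next
    case (Suc k)
    then obtain i u where u: "t = Poly_Mapping.single i 1 + u" "mon_degree u = k"
      by (auto elim: mon_degree_SucE)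
    then have "i \<in> V" "keys u \<subseteq> V" using Suc.prems(1) by (auto simp: keys_plus_nat)
    then have "x i * mon_val x u \<in> F U (1 + k)" using x Suc.IH[of u] u by (intro F_mult) auto
    then show ?case unfolding u(1) by (simp add: mon_val_plus)
  qed
  have "const (h (lookup p t)) * mon_val x t \<in> F U n" if "t \<in> keys p" for t
  proof -
    have "t \<in> xmons V n" using p that by (auto simp: F_iff)
    then show ?thesis by (intro F_closed(5) mon) (auto simp: xmons_def)
  qed
  then show ?thesis
    unfolding h.eval_superset[OF finite_keys subset_refl] by (rule F_sum)
qed

lemma eval_nonzero:
  fixes p :: "('w, 'a::field) mpoly"
  assumes "infinite (UNIV :: 'a set)" "p \<noteq> 0"
  shows "\<exists>a. eval_mpoly (\<lambda>x. x) a p \<noteq> 0"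
proof (rule ccontr)
  assume "\<not> ?thesis"
  then have zero: "eval_mpoly (\<lambda>x. x) a p = 0" for a by blast
  let ?W = "\<Union>(keys ` keys p)"
  have "\<forall>t\<in>keys p. lookup p t = 0"
  proof (rule vanishing_sum_of_monomials[where W = ?W and f = lookup])
    fix s t assume st: "s \<in> keys p" "t \<in> keys p" "\<And>w. w \<in> ?W \<Longrightarrow> lookup s w = lookup t w"
    show "s = t"
    proof (rule poly_mapping_eqI)
      fix w
      show "lookup s w = lookup t w"
        using st by (cases "w \<in> ?W") (auto simp: in_keys_iff)
    qed
  next
    fix a
    have "eval_mpoly (\<lambda>x. x) a p = (\<Sum>t\<in>keys p. lookup p t * (\<Prod>w\<in>?W. a w ^ lookup t w))"
      unfolding coeff_hom.eval_superset[OF id_coeff_hom finite_keys subset_refl]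
      by (intro sum.cong refl arg_cong2[where f = "(*)"] mon_val_superset) auto
    then show "(\<Sum>t\<in>keys p. lookup p t * (\<Prod>w\<in>?W. a w ^ lookup t w)) = 0" using zero[of a] by simp
  qed (use assms in auto)
  then have "lookup p t = 0" for t by (cases "t \<in> keys p") (auto simp: in_keys_iff)
  then have "p = 0" by (intro poly_mapping_eqI) simp
  with assms(2) show False by simp
qed

section \<open>Fractions and common denominators\<close>

definition fr :: "'b::idom \<Rightarrow> 'b fract" where "fr q = Fraction_Field.Fract q 1"

lemma fr_hom: "coeff_hom fr"
  by unfold_locales (simp_all add: fr_def One_fract_def)

lemma fr_eq_iff: "fr p = fr q \<longleftrightarrow> p = q"
  by (simp add: fr_def eq_fract)

lemma map_coeff_fr_inj: "map_coeff fr p = map_coeff fr q \<Longrightarrow> p = q"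
  by (rule poly_mapping_eqI) (metis coeff_hom.lookup_map_coeff fr_eq_iff fr_hom)

lemma common_denominator:
  fixes r :: "('v, 'b::idom fract) mpoly"
  assumes "r \<in> polys U"
  shows "\<exists>E s. E \<noteq> 0 \<and> s \<in> polys U \<and> const (fr E) * r = map_coeff fr s"
proof -
  interpret fr: coeff_hom "fr :: 'b \<Rightarrow> _" by (rule fr_hom)
  interpret m: coeff_hom "map_coeff fr :: ('v, 'b) mpoly \<Rightarrow> _" by (rule fr.map_coeff_hom)
  have "\<exists>E s. E \<noteq> 0 \<and> s \<in> polys U \<and> const (fr E) * (\<Sum>t\<in>T. Poly_Mapping.single t (lookup r t)) = map_coeff fr s"
    if "finite T" "T \<subseteq> keys r" for T
    using that
  proof (induction T rule: finite_induct)
    case empty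
    show ?case by (intro exI[of _ 1] exI[of _ 0]) simp
  next
    case (insert t T)
    then obtain E s where Es: "E \<noteq> 0" "s \<in> polys U"
      "const (fr E) * (\<Sum>t\<in>T. Poly_Mapping.single t (lookup r t)) = map_coeff fr s" by auto
    obtain a b where ab: "lookup r t = Fraction_Field.Fract a b" "b \<noteq> 0" by (rule Fract_cases)
    have b: "fr b * lookup r t = fr a" using ab by (simp add: fr_def eq_fract)
    have "const (fr (b * E)) * (\<Sum>t\<in>insert t T. Poly_Mapping.single t (lookup r t)) =
      const (fr E) * (const (fr b) * Poly_Mapping.single t (lookup r t)) + const (fr b) * map_coeff fr s"
      using insert.hyps unfolding Es(3)[symmetric] by (simp add: algebra_simps)
    also have "const (fr b) * Poly_Mapping.single t (lookup r t) = map_coeff fr (Poly_Mapping.single t a)"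
      using b by (simp add: const_times_single fr.map_coeff_single)
    finally have "const (fr (b * E)) * (\<Sum>t\<in>insert t T. Poly_Mapping.single t (lookup r t)) =
      map_coeff fr (const E * Poly_Mapping.single t a + const b * s)"
      by (simp add: fr.map_coeff_const)
    moreover have "const E * Poly_Mapping.single t a + const b * s \<in> polys U"
      using assms insert.prems Es(2)
      by (intro polys_closed polys_mult single_polys) (auto simp: polys_iff)
    ultimately show ?case using ab(2) Es(1) by (intro exI[of _ "b * E"]) auto
  qed
  from this[of "keys r"] show ?thesis by (simp flip: mpoly_sum_xmons)
qed

lemma ratfuns_subring: "subring_set (ratfuns W :: ('b::linorder, 'c::field) mpoly fract set)"
  (is "subring_set ?K")
proof -
  have mem: "Fraction_Field.Fract p q \<in> ratfuns W" if "p \<in> polys W" "q \<in> polys W" "q \<noteq> 0" for p q :: "('b, 'c) mpoly"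
    unfolding ratfuns_def using that by blast
  show ?thesis
    unfolding subring_set_def
  proof (intro conjI ballI)
    show "1 \<in> ?K" unfolding One_fract_def by (rule mem) auto
    fix x y :: "('b, 'c) mpoly fract" assume "x \<in> ratfuns W" "y \<in> ratfuns W"
    then obtain p q p' q' where "x = Fraction_Field.Fract p q" "y = Fraction_Field.Fract p' q'"
      "p \<in> polys W" "q \<in> polys W" "p' \<in> polys W" "q' \<in> polys W" "q \<noteq> 0" "q' \<noteq> 0"
      unfolding ratfuns_def by blast
    then show "x - y \<in> ratfuns W" "x * y \<in> ratfuns W" by (auto intro!: mem)
  qed
qed

text \<open>The generic substitution specialised at v = a. It is a retraction onto the polynomials
  in the first \<open>k\<close> variables: it fixes them and kills the forms \<open>lform\<close>,
  and by \<open>minus_subst_mem\<close> these forms generate its kernel on the polynomials in k + d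
  variables.\<close>

definition subst :: "nat \<Rightarrow> (nat \<times> nat \<Rightarrow> 'a::comm_ring_1) \<Rightarrow> (nat, 'a) mpoly \<Rightarrow> (nat, 'a) mpoly" where
  "subst k a = eval_mpoly const (\<lambda>i. if i \<le> k then indet i else (\<Sum>j = 1..k. const (a (i, j)) * indet j))"

text \<open>Counted from 0, so that j < d runs through the variables with index k + 1, ..., k +
  d.\<close>

definition lform :: "nat \<Rightarrow> (nat \<times> nat \<Rightarrow> 'a::comm_ring_1) \<Rightarrow> nat \<Rightarrow> (nat, 'a) mpoly" where
  "lform k a j = indet (k + 1 + j) - (\<Sum>i = 1..k. const (a (k + 1 + j, i)) * indet i)"

lemma subst_hom: "coeff_hom (subst k a)"
  unfolding subst_def by (rule coeff_hom.eval_coeff_hom[OF const_coeff_hom])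

lemma subst_const: "subst k a (const b) = const b"
  unfolding subst_def by (rule coeff_hom.eval_const[OF const_coeff_hom])

lemma subst_indet: "subst k a (indet i) = (if i \<le> k then indet i else (\<Sum>j = 1..k. const (a (i, j)) * indet j))"
  unfolding subst_def by (rule coeff_hom.eval_indet[OF const_coeff_hom])

lemma lform_F:
  assumes "k + d = m" "j < d" shows "lform k a j \<in> F {1..m} 1"
  unfolding lform_def using assms by (intro F_closed F_sum indet_F) auto

text \<open>The set of variables allows for an index 0 in \<open>V\<close>: every index i \<le> k is
  left alone, 0 included, and all others are replaced by forms in the variables 1, ..., k. For
  \<open>V = {1..m}\<close> it is just \<open>{1..k}\<close>.\<close>

lemma subst_F:
  assumes "p \<in> F V n" shows "subst k a p \<in> F ({1..k} \<union> (V \<inter> {..k})) n"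
  unfolding subst_def
  by (rule eval_F[OF id_coeff_hom _ assms]) (auto simp del: One_nat_def intro!: F_sum F_closed(5) indet_F)

lemma subst_id:
  assumes "p \<in> polys {1..k}" shows "subst k a p = p"
proof -
  have "subst k a p = map_coeff (\<lambda>x. x) p"
    unfolding subst_def map_coeff_def
    by (rule coeff_hom.eval_cong[OF const_coeff_hom _ assms]) auto
  also have "\<dots> = p"
    by (rule poly_mapping_eqI) (rule coeff_hom.lookup_map_coeff[OF id_coeff_hom])
  finally show ?thesis .
qed

lemma subst_lform: "subst k a (lform k a j) = 0"
proof -
  interpret s: coeff_hom "subst k a" by (rule subst_hom)
  show ?thesis unfolding lform_def by (simp add: s.sum subst_const subst_indet)
qed

text \<open>Modulo the forms \<open>lform\<close> no variable is changed by the substitution. This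
  passes to monomials through x u - x' u' = x (u - u') + (x - x') u'.\<close>

lemma minus_subst_mem:
  fixes a :: "nat \<times> nat \<Rightarrow> 'a::field"
  assumes km: "k + d = m" and K: "pideal {1..m} K" and l: "\<And>j. j < d \<Longrightarrow> lform k a j \<in> K"
    and p: "p \<in> polys {1..m}"
  shows "p - subst k a p \<in> K"
proof -
  interpret s: coeff_hom "subst k a" by (rule subst_hom)
  have var: "indet i - subst k a (indet i) \<in> K" if i: "i \<in> {1..m}" for i
  proof (cases "i \<le> k")
    case True
    then show ?thesis using pidealD(2)[OF K] by (simp add: subst_indet)
  next
    case False
    then have "i = k + 1 + (i - (k + 1))" "i - (k + 1) < d" using i km by auto
    then show ?thesis using l[of "i - (k + 1)"] False by (simp add: subst_indet lform_def)
  qed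
  have mon: "keys t \<subseteq> {1..m} \<Longrightarrow> mon_degree t = n \<Longrightarrow> xmon t - subst k a (xmon t) \<in> K" for t n
  proof (induction n arbitrary: t)
    case 0
    then show ?case using pidealD(2)[OF K] by simp
  next
    case (Suc n)
    then obtain i u where u: "t = Poly_Mapping.single i 1 + u" "mon_degree u = n"
      by (auto elim: mon_degree_SucE)
    then have i: "i \<in> {1..m}" "keys u \<subseteq> {1..m}" using Suc.prems(1) by (auto simp: keys_plus_nat)
    have t: "xmon t = (indet i * xmon u :: (nat, 'a) mpoly)" by (simp add: u(1) indet_def mult_single)
    have "subst k a (xmon u) \<in> F ({1..k} \<union> ({1..m} \<inter> {..k})) n"
      by (rule subst_F) (use i u in \<open>auto simp: F_iff xmons_def\<close>)
    moreover have "{1..k} \<union> ({1..m} \<inter> {..k}) \<subseteq> {1..m}" using km by auto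
    ultimately have su: "subst k a (xmon u) \<in> polys {1..m}"
      unfolding F_iff xmons_def polys_iff by blast
    have "indet i * (xmon u - subst k a (xmon u)) + (indet i - subst k a (indet i)) * subst k a (xmon u) \<in> K"
      using Suc.IH[of u] u i var su by (intro pidealD(3)[OF K] pidealD(4)[OF K] pidealD(5)[OF K]) auto
    then show ?case unfolding t by (simp add: algebra_simps)
  qed
  have p_eq: "p = (\<Sum>t\<in>keys p. const (lookup p t) * xmon t)"
    by (subst mpoly_sum_xmons) (simp add: const_times_single)
  have "(\<Sum>t\<in>keys p. const (lookup p t) * (xmon t - subst k a (xmon t))) \<in> K"
    using p mon by (intro pideal_sum[OF K] pidealD(8)[OF K]) (auto simp: polys_iff)
  also have "(\<Sum>t\<in>keys p. const (lookup p t) * (xmon t - subst k a (xmon t))) = p - subst k a p"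
    by (subst (2 3) p_eq) (simp add: s.sum subst_const right_diff_distrib sum_subtractf)
  finally show ?thesis .
qed

context
  fixes k d m n :: nat and a :: "nat \<times> nat \<Rightarrow> 'a::field" and I :: "(nat, 'a) mpoly set"
  assumes km: "k + d = m" and I: "hideal {1..m} I"
begin

text \<open>Substituting in a representation of the monomial kills the multiples of the forms
  \<open>lform\<close>. The element \<open>f\<close> is kept homogeneous of degree \<open>n\<close>
  because \<open>forms_subset_if_specialization\<close> expands its generic substitution in the
  monomials of that degree.\<close>

lemma subst_of_F_subset:
  assumes sub: "F {1..m} n \<subseteq> idl {1..m} I d (lform k a)" and t: "t \<in> xmons {1..k} n"
  shows "\<exists>f\<in>I \<inter> F {1..m} n. xmon t = subst k a f"
proof -
  interpret s: coeff_hom "subst k a" by (rule subst_hom)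
  have tm: "xmon t \<in> F {1..m} n" using t km by (auto simp: F_iff xmons_def)
  obtain f r where f: "f \<in> I" "f \<in> F {1..m} n" "xmon t = f + (\<Sum>j<d. r j * lform k a j)"
    using F_idl_elem[OF I _ tm subsetD[OF sub tm]] lform_F[OF km] by blast
  have "xmon t = subst k a (xmon t)"
    by (rule subst_id[symmetric]) (use t in \<open>auto simp: xmons_def\<close>)
  also have "\<dots> = subst k a f" unfolding f(3) by (simp add: s.sum subst_lform)
  finally show ?thesis using f by blast
qed

text \<open>Modulo the ideal on the right a form agrees with its substitution, which is a
  combination of monomials in the first \<open>k\<close> variables; each of these monomials agrees
  with an element of \<open>I\<close> for the same reason.\<close>

lemma F_subset_of_subst:
  assumes ex: "\<And>t. t \<in> xmons {1..k} n \<Longrightarrow> xmon t \<in> subst k a ` I"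
  shows "F {1..m} n \<subseteq> idl {1..m} I d (lform k a)"
proof
  let ?K = "idl {1..m} I d (lform k a)"
  have pidealI: "pideal {1..m} I" using I by (rule hidealD)
  have K: "pideal {1..m} ?K" by (rule idl_pideal[OF pidealI]) (rule F_polys[OF lform_F[OF km]])
  have diff: "p - subst k a p \<in> ?K" if "p \<in> polys {1..m}" for p
    using km K idl_gen[OF pidealI] that by (rule minus_subst_mem)
  have low: "xmon u \<in> ?K" if u: "u \<in> xmons {1..k} n" for u
  proof -
    obtain f where f: "f \<in> I" "xmon u = subst k a f" using ex u by blast
    then have "f - (f - subst k a f) \<in> ?K"
      using pidealD(1)[OF pidealI] by (intro pidealD(7)[OF K] diff idl_incl) auto
    then show ?thesis using f(2) by simp
  qed
  fix p :: "(nat, 'a) mpoly" assume p: "p \<in> F {1..m} n"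
  have "{1..k} \<union> ({1..m} \<inter> {..k}) = {1..k}" using km by auto
  then have "subst k a p \<in> F {1..k} n" using subst_F[OF p, of k a] by simp
  then have "subst k a p = (\<Sum>u\<in>xmons {1..k} n. const (lookup (subst k a p) u) * xmon u)"
    by (rule F_expand) simp
  also have "\<dots> \<in> ?K" by (intro pideal_sum[OF K] pidealD(8)[OF K] low)
  finally have "(p - subst k a p) + subst k a p \<in> ?K"
    by (intro pidealD(3)[OF K] diff F_polys[OF p])
  then show "p \<in> ?K" by simp
qed

end

lemma ratfuns_memI: "p \<in> polys W \<Longrightarrow> q \<in> polys W \<Longrightarrow> q \<noteq> 0 \<Longrightarrow> Fraction_Field.Fract p q \<in> ratfuns W"
  unfolding ratfuns_def by blast

text \<open>\<open>gen_subst\<close> before passing from \<open>k[v]\<close> to its fraction field, so that the \<open>v\<^sub>i\<^sub>j\<close> can be specialised.\<close>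

definition gen_subst_poly :: "nat \<Rightarrow> (nat, 'a::field) mpoly \<Rightarrow> (nat, (nat \<times> nat, 'a) mpoly) mpoly" where
  "gen_subst_poly k = eval_mpoly (\<lambda>a. const (const a))
     (\<lambda>i. if i \<le> k then indet i else (\<Sum>j = 1..k. const (indet (i, j)) * indet j))"

lemma const_const_hom: "coeff_hom (\<lambda>a. const (const a))"
  by unfold_locales auto

lemma gen_subst_eq: "gen_subst m d f = map_coeff fr (gen_subst_poly (m - d) f)"
proof -
  interpret h: coeff_hom "map_coeff fr :: (nat, (nat \<times> nat, 'a) mpoly) mpoly \<Rightarrow> _"
    by (rule coeff_hom.map_coeff_hom[OF fr_hom])
  have [simp]: "map_coeff fr (const q) = const (fr q)" "map_coeff fr (indet i) = indet i"
    for q :: "(nat \<times> nat, 'a) mpoly" and i :: nat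
    by (rule coeff_hom.map_coeff_const[OF fr_hom] coeff_hom.map_coeff_indet[OF fr_hom])+
  show ?thesis
    unfolding gen_subst_poly_def coeff_hom.eval_comp[OF const_const_hom h.coeff_hom_axioms]
    by (simp add: gen_subst_def fr_def[symmetric] comp_def h.sum if_distrib[of "map_coeff fr"] cong: if_cong)
qed

text \<open>Together with \<open>gen_subst_eq\<close> this makes \<open>gen_subst_poly\<close> the
  common source of the generic substitution and of all its specialisations.\<close>

lemma map_coeff_eval_gen_subst_poly:
  "map_coeff (eval_mpoly (\<lambda>x. x) a) (gen_subst_poly k f) = subst k a f"
proof -
  note ev = coeff_hom.eval_coeff_hom[OF id_coeff_hom, of a]
  interpret h: coeff_hom "map_coeff (eval_mpoly (\<lambda>x. x) a) :: (nat, (nat \<times> nat, 'a) mpoly) mpoly \<Rightarrow> _"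
    by (rule coeff_hom.map_coeff_hom[OF ev])
  have [simp]: "map_coeff (eval_mpoly (\<lambda>x. x) a) (const q) = const (eval_mpoly (\<lambda>x. x) a q)"
    "map_coeff (eval_mpoly (\<lambda>x. x) a) (indet i) = indet i"
    for q :: "(nat \<times> nat, 'a) mpoly" and i :: nat
    by (rule coeff_hom.map_coeff_const[OF ev] coeff_hom.map_coeff_indet[OF ev])+
  show ?thesis
    unfolding gen_subst_poly_def coeff_hom.eval_comp[OF const_const_hom h.coeff_hom_axioms] subst_def
    by (simp add: comp_def h.sum coeff_hom.eval_const[OF id_coeff_hom] coeff_hom.eval_indet[OF id_coeff_hom]
        if_distrib[of "map_coeff _"] cong: if_cong)
qed

text \<open>Only v_ij with \<open>(i, j)\<close> in \<open>gen_indices m d\<close> enter, since the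
  replaced variables have indices from m - d + 1 to m. This keeps the generators of
  \<open>I'\<close> inside \<open>R'\<close>.\<close>

lemma gen_subst_poly_carrier:
  assumes "f \<in> polys {1..m}"
  shows "gen_subst_poly (m - d) f \<in> carrier (mpoly_ring (polys (gen_indices m d)) {1..m - d})"
    (is "_ \<in> carrier (mpoly_ring ?S ?U)")
proof -
  have S: "subring_set ?S" by (auto simp: subring_set_def)
  note closed = mpoly_ring_closed[OF S]
  have const: "const q \<in> carrier (mpoly_ring ?S ?U)" if "q \<in> ?S" for q
    using that by (intro const_carrier) auto
  have indet: "indet i \<in> carrier (mpoly_ring ?S ?U)" if "i \<in> ?U" for i
    by (rule mpoly_carrierI) (use that in \<open>auto simp: indet_def lookup_single when_def\<close>)
  have zero: "0 \<in> carrier (mpoly_ring ?S ?U)" using const[of 0] by simp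
  have sum: "sum g T \<in> carrier (mpoly_ring ?S ?U)" if "\<And>x. x \<in> T \<Longrightarrow> g x \<in> carrier (mpoly_ring ?S ?U)"
    for T :: "nat set" and g
    using that by (induction T rule: infinite_finite_induct) (auto simp: zero intro: closed(2) simp del: One_nat_def)
  show ?thesis
    unfolding gen_subst_poly_def
  proof (rule coeff_hom.eval_polys[OF const_const_hom _ _ assms])
    fix i assume i: "i \<in> {1..m}"
    have "const (indet (i, j)) * indet j \<in> carrier (mpoly_ring ?S ?U)" if "j \<in> ?U" "\<not> i \<le> m - d" for j
      using that i by (intro closed(3) const indet indet_polys) (auto simp: gen_indices_def)
    then show "(if i \<le> m - d then indet i else \<Sum>j = 1..m - d. const (indet (i, j)) * indet j)
        \<in> carrier (mpoly_ring ?S ?U)"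
      using i indet[of i] by (auto intro!: sum simp del: One_nat_def)
  next
    show "1 \<in> carrier (mpoly_ring ?S ?U)" using const[of 1] by simp
  qed (use zero const closed in auto)
qed

lemma gen_subst_poly_F:
  assumes "f \<in> F {1..m} n"
  shows "gen_subst_poly (m - d) f \<in> F {1..m - d} n"
  unfolding gen_subst_poly_def
  by (rule eval_F[OF const_coeff_hom _ assms]) (auto simp del: One_nat_def intro!: F_sum F_closed(5) indet_F)

section \<open>Comparison of the generic substitution with its specialisations\<close>

locale generic_substitution =
  fixes m d :: nat and I :: "(nat, 'a::field) mpoly set"
  assumes hideal: "hideal {1..m} I" and dm: "d \<le> m" and inf: "infinite (UNIV :: 'a set)"
begin

abbreviation "W \<equiv> gen_indices m d"
abbreviation "U \<equiv> {1..m - d}"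
abbreviation "K' \<equiv> (ratfuns W :: (nat \<times> nat, 'a) mpoly fract set)"
abbreviation "R' \<equiv> mpoly_ring K' U"
abbreviation "I' \<equiv> Idl\<^bsub>R'\<^esub> (gen_subst m d ` I)"
abbreviation "ev \<equiv> eval_mpoly (\<lambda>x::'a. x)"

lemma pideal: "pideal {1..m} I"
  using hideal by (rule hidealD)

lemma K': "subring_set K'"
  by (rule ratfuns_subring)

sublocale R': cring R'
  by (rule cring_mpoly_ring[OF K'])

lemma fr_K': "q \<in> polys W \<Longrightarrow> fr q \<in> K'"
  unfolding fr_def by (rule ratfuns_memI) auto

lemma gen_subst_carrier: "gen_subst m d ` I \<subseteq> carrier R'"
proof
  fix g assume "g \<in> gen_subst m d ` I"
  then obtain f where f: "f \<in> polys {1..m}" "g = map_coeff fr (gen_subst_poly (m - d) f)"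
    using pidealD(1)[OF pideal] by (auto simp: gen_subst_eq)
  note carr = gen_subst_poly_carrier[OF f(1), of d]
  have lk: "lookup g t = fr (lookup (gen_subst_poly (m - d) f) t)" for t
    unfolding f(2) by (rule coeff_hom.lookup_map_coeff[OF fr_hom])
  show "g \<in> carrier R'"
  proof (rule mpoly_carrierI)
    show "lookup g t \<in> K'" for t
      unfolding lk by (rule fr_K'[OF mpoly_carrierD(1)[OF carr]])
    have "keys g \<subseteq> keys (gen_subst_poly (m - d) f)"
      by (auto simp: in_keys_iff lk coeff_hom.zero[OF fr_hom])
    then show "g \<in> polys U" using mpoly_carrierD(2)[OF carr] unfolding polys_iff by blast
  qed
qed

lemma I'_ideal: "ideal I' R'"
  by (rule R'.genideal_ideal[OF gen_subst_carrier])

lemma I'_props: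
  shows "I' \<subseteq> carrier R'" "0 \<in> I'" "x \<in> I' \<Longrightarrow> y \<in> I' \<Longrightarrow> x + y \<in> I'"
    "r \<in> carrier R' \<Longrightarrow> x \<in> I' \<Longrightarrow> r * x \<in> I'" "f \<in> I \<Longrightarrow> gen_subst m d f \<in> I'"
  using I'_ideal R'.genideal_self[OF gen_subst_carrier] unfolding ideal_mpoly_ring_iff[OF K'] by auto

lemma const_R': "c \<in> K' \<Longrightarrow> const c \<in> carrier R'"
  by (rule const_carrier) (use subring_setD(1)[OF K'] in auto)

lemma forms_subset_iff: "forms K' U n \<subseteq> I' \<longleftrightarrow> (\<forall>t\<in>xmons U n. xmon t \<in> I')"
proof
  assume sub: "forms K' U n \<subseteq> I'"
  have "xmon t \<in> forms K' U n" if "t \<in> xmons U n" for t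
  proof -
    have "xmon t \<in> carrier R'"
      by (rule mpoly_carrierI)
        (use that subring_setD(1,2)[OF K'] in \<open>auto simp: xmons_def lookup_single when_def\<close>)
    then show ?thesis using that by (simp add: forms_def xmons_def)
  qed
  with sub show "\<forall>t\<in>xmons U n. xmon t \<in> I'" by blast
next
  assume mon: "\<forall>t\<in>xmons U n. xmon t \<in> I'"
  have sum: "sum g T \<in> I'" if "\<And>x. x \<in> T \<Longrightarrow> g x \<in> I'" for T :: "(nat \<Rightarrow>\<^sub>0 nat) set" and g
    using that by (induction T rule: infinite_finite_induct) (auto intro: I'_props(2,3) simp del: One_nat_def)
  show "forms K' U n \<subseteq> I'"
  proof
    fix p assume p: "p \<in> forms K' U n"
    then have carr: "p \<in> carrier R'" by (simp add: forms_def)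
    have "p \<in> F U n"
      using p mpoly_carrierD(2)[OF carr] unfolding forms_def[of UNIV] by (simp add: forms_def)
    then have "p = (\<Sum>t\<in>xmons U n. const (lookup p t) * xmon t)" by (rule F_expand) simp
    also have "\<dots> \<in> I'"
      using mon mpoly_carrierD(1)[OF carr] by (intro sum I'_props(4) const_R') auto
    finally show "p \<in> I'" .
  qed
qed

text \<open>Nakayama's lemma over k[v] with \<open>M\<close> the polynomials vanishing at
  \<open>a\<close>: modulo \<open>M\<close> the generic substitution of \<open>f\<close> equals its
  specialisation, which is a monomial. The resulting factor has value 1 at \<open>a\<close>, so it
  is nonzero and can be inverted in k(v).\<close>

lemma forms_subset_if_specialization:
  assumes sp: "\<forall>t\<in>xmons U n. \<exists>f\<in>I \<inter> F {1..m} n. xmon t = subst (m - d) a f"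
  shows "forms K' U n \<subseteq> I'"
proof -
  note ev = coeff_hom.eval_coeff_hom[OF id_coeff_hom, of a]
  let ?c = "\<lambda>q. const (fr q) :: (nat, (nat \<times> nat, 'a) mpoly fract) mpoly"
  have c_hom: "coeff_hom ?c" by (rule coeff_hom.const_comp[OF fr_hom])
  interpret c: coeff_hom ?c by (rule c_hom)
  interpret ev: coeff_hom "ev a" by (rule ev)
  define S where "S = ?c ` polys W"
  define M where "M = ?c ` {q \<in> polys W. ev a q = 0}"
  have "\<exists>D\<in>S. 1 - D \<in> M \<and> (\<forall>t\<in>xmons U n. D * xmon t \<in> I')"
  proof (rule nakayama)
    show "1 \<in> S" unfolding S_def by (rule image_eqI[of _ _ 1]) auto
    show "x - y \<in> S" "x * y \<in> S" if xy: "x \<in> S" "y \<in> S" for x y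
    proof -
      obtain p q where "x = ?c p" "y = ?c q" "p \<in> polys W" "q \<in> polys W" using xy by (auto simp: S_def)
      then show "x - y \<in> S" "x * y \<in> S" unfolding S_def
        by (auto simp del: c.diff c.mult simp flip: c.diff c.mult)
    qed
    show "M \<subseteq> S" by (auto simp: M_def S_def)
    show "0 \<in> M" unfolding M_def by (rule image_eqI[of _ _ 0]) auto
    show "x + y \<in> M" if xy: "x \<in> M" "y \<in> M" for x y
    proof -
      obtain p q where "x = ?c p" "y = ?c q" "p \<in> polys W" "q \<in> polys W" "ev a p = 0" "ev a q = 0"
        using xy by (auto simp: M_def)
      then show ?thesis unfolding M_def by (intro image_eqI[of _ _ "p + q"]) auto
    qed
    show "s * x \<in> M" if sx: "s \<in> S" "x \<in> M" for s x
    proof -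
      obtain p q where "s = ?c p" "x = ?c q" "p \<in> polys W" "q \<in> polys W" "ev a q = 0"
        using sx by (auto simp: M_def S_def)
      then show ?thesis unfolding M_def by (intro image_eqI[of _ _ "p * q"]) auto
    qed
    show "0 \<in> I'" by (rule I'_props)
    show "x + y \<in> I'" if "x \<in> I'" "y \<in> I'" for x y
      using that by (rule I'_props)
    show "s * x \<in> I'" if "s \<in> S" "x \<in> I'" for s x
      using that I'_props(4)[OF const_R'[OF fr_K']] unfolding S_def by blast
    fix t assume t: "t \<in> xmons U n"
    then obtain f where f: "f \<in> I" "f \<in> F {1..m} n" "xmon t = subst (m - d) a f" using sp by blast
    let ?g = "gen_subst_poly (m - d) f"
    have gF: "?g \<in> F U n" by (rule gen_subst_poly_F[OF f(2)])
    have gW: "lookup ?g u \<in> polys W" for u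
      by (rule mpoly_carrierD(1)[OF gen_subst_poly_carrier[OF F_polys[OF f(2)]]])
    \<comment> \<open>The coefficients of the monomial \<open>t\<close> minus those of
      \<open>?g\<close>. They vanish at \<open>a\<close>, and subtracting the corresponding
      combination from the monomial leaves \<open>gen_subst m d f\<close>, an element of
      \<open>I'\<close>.\<close>
    define c where "c u = (if u = t then 1 else 0) - lookup ?g u" for u
    have "ev a (lookup ?g u) = (if u = t then 1 else 0)" for u
    proof -
      have "ev a (lookup ?g u) = lookup (map_coeff (ev a) ?g) u"
        by (rule coeff_hom.lookup_map_coeff[OF ev, symmetric])
      also have "\<dots> = lookup (xmon t) u" unfolding map_coeff_eval_gen_subst_poly f(3) ..
      finally show ?thesis by (simp add: lookup_single when_def)
    qed
    then have "?c (c u) \<in> M" for u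
      unfolding M_def c_def using gW by (intro imageI) auto
    moreover have "xmon t - (\<Sum>u\<in>xmons U n. ?c (c u) * xmon u) = gen_subst m d f"
    proof -
      interpret mc: coeff_hom "map_coeff fr :: (nat, (nat \<times> nat, 'a) mpoly) mpoly \<Rightarrow> _"
        by (rule coeff_hom.map_coeff_hom[OF fr_hom])
      have "(\<Sum>u\<in>xmons U n. ?c (c u) * xmon u) =
        (\<Sum>u\<in>xmons U n. (if u = t then xmon u else 0) - ?c (lookup ?g u) * xmon u)"
        by (intro sum.cong) (auto simp: c_def left_diff_distrib)
      also have "\<dots> = xmon t - (\<Sum>u\<in>xmons U n. ?c (lookup ?g u) * xmon u)"
        using t by (simp add: sum_subtractf finite_xmons)
      also have "(\<Sum>u\<in>xmons U n. ?c (lookup ?g u) * xmon u) =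
        map_coeff fr (\<Sum>u\<in>xmons U n. const (lookup ?g u) * xmon u)"
        by (simp add: mc.sum coeff_hom.map_coeff_const[OF fr_hom] coeff_hom.map_coeff_single[OF fr_hom]
            coeff_hom.one[OF fr_hom])
      also have "(\<Sum>u\<in>xmons U n. const (lookup ?g u) * xmon u) = ?g"
        using F_expand[OF gF] by simp
      finally show ?thesis by (simp add: gen_subst_eq)
    qed
    then have "xmon t - (\<Sum>u\<in>xmons U n. ?c (c u) * xmon u) \<in> I'"
      using I'_props(5)[OF f(1)] by (simp only:)
    ultimately show "\<exists>c. (\<forall>u\<in>xmons U n. c u \<in> M) \<and> xmon t - (\<Sum>u\<in>xmons U n. c u * xmon u) \<in> I'"
      by (intro exI[of _ "\<lambda>u. ?c (c u)"]) blast
  qed (simp add: finite_xmons)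
  then obtain q p where qp: "1 - ?c q = ?c p" "q \<in> polys W" "ev a p = 0"
    and D: "\<And>t. t \<in> xmons U n \<Longrightarrow> ?c q * xmon t \<in> I'"
    unfolding S_def M_def by blast
  have "?c (1 - q) = ?c p" using qp(1) by simp
  then have "1 - q = p" by (simp only: const_eq_iff fr_eq_iff)
  then have "1 - ev a q = 0" using qp(3) by auto
  then have "q \<noteq> 0" by auto
  have "xmon t \<in> I'" if t: "t \<in> xmons U n" for t
  proof -
    have "Fraction_Field.Fract 1 q \<in> K'" using \<open>q \<noteq> 0\<close> qp(2) by (intro ratfuns_memI) auto
    then have "const (Fraction_Field.Fract 1 q) * (?c q * xmon t) \<in> I'"
      by (intro I'_props(4) const_R' D t)
    moreover have "Fraction_Field.Fract 1 q * fr q = 1"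
      using \<open>q \<noteq> 0\<close> by (simp add: fr_def One_fract_def eq_fract)
    ultimately show ?thesis by (simp add: mult.assoc[symmetric] flip: const_simps(4))
  qed
  then show ?thesis unfolding forms_subset_iff by blast
qed

text \<open>Membership in \<open>I'\<close> can be specialised once denominators are cleared. Only
  the denominators belonging to the finitely many monomials of degree \<open>n\<close> have to stay
  nonzero, and over an infinite field their product has a point where it does not vanish.\<close>

lemma specialization_if_forms_subset:
  assumes sub: "forms K' U n \<subseteq> I'"
  shows "\<exists>a. \<forall>t\<in>xmons U n. xmon t \<in> subst (m - d) a ` I"
proof -
  let ?k = "m - d"
  let ?mc = "map_coeff fr :: (nat, (nat \<times> nat, 'a) mpoly) mpoly \<Rightarrow> _"
  interpret mc: coeff_hom ?mc by (rule coeff_hom.map_coeff_hom[OF fr_hom])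
  have mc_const: "?mc (const q) = const (fr q)" for q by (rule coeff_hom.map_coeff_const[OF fr_hom])
  have evm: "coeff_hom (map_coeff (ev a) :: (nat, (nat \<times> nat, 'a) mpoly) mpoly \<Rightarrow> (nat, 'a) mpoly)" for a
    by (rule coeff_hom.map_coeff_hom[OF coeff_hom.eval_coeff_hom[OF id_coeff_hom]])
  interpret evm: coeff_hom "map_coeff (ev a) :: (nat, (nat \<times> nat, 'a) mpoly) mpoly \<Rightarrow> (nat, 'a) mpoly" for a
    by (rule evm)
  interpret s: coeff_hom "subst ?k a" for a by (rule subst_hom)
  define T where "T a = subst ?k a ` I" for a
  have T_zero: "0 \<in> T a" for a unfolding T_def using pidealD(2)[OF pideal] by (intro image_eqI[of _ _ 0]) auto
  have T_add: "x + y \<in> T a" if "x \<in> T a" "y \<in> T a" for x y a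
    using that pidealD(3)[OF pideal] unfolding T_def by (auto simp flip: s.add)
  have T_mult: "r * x \<in> T a" if r: "r \<in> polys U" and "x \<in> T a" for r x a
  proof -
    obtain f where "f \<in> I" "x = subst ?k a f" using \<open>x \<in> T a\<close> unfolding T_def by blast
    moreover have "r \<in> polys {1..m}" using r by (fastforce simp: polys_iff)
    ultimately show ?thesis
      using pidealD(4)[OF pideal, of r f] subst_id[OF r, of a] unfolding T_def by (intro image_eqI[of _ _ "r * f"]) auto
  qed
  \<comment> \<open>Specialising at all points replaces an explicit \<open>k[v]\<close>-span of the substituted polynomials.\<close>
  define Z :: "(nat, (nat \<times> nat, 'a) mpoly) mpoly set" where "Z = {w. \<forall>a. map_coeff (ev a) w \<in> T a}"
  have Z_mult: "s * w \<in> Z" if s: "s \<in> polys U" and "w \<in> Z" for s w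
  proof -
    have "map_coeff (ev a) s \<in> polys U" for a
    proof -
      have "keys (map_coeff (ev a) s) \<subseteq> keys s"
        unfolding subset_iff in_keys_iff
        using coeff_hom.lookup_map_coeff[OF coeff_hom.eval_coeff_hom[OF id_coeff_hom], of a s]
          coeff_hom.eval_zero[OF id_coeff_hom, of a] by metis
      then show ?thesis using s unfolding polys_iff by blast
    qed
    then show ?thesis using \<open>w \<in> Z\<close> by (auto simp: Z_def intro: T_mult)
  qed
  \<comment> \<open>Polynomials that have, after clearing a denominator \<open>D\<close>, all
    specialisations in the substituted ideals. As an ideal containing the generators it contains
    \<open>I'\<close>, so no explicit representation of elements of \<open>I'\<close> is
    needed.\<close>
  define N where "N = {p \<in> carrier R'. \<exists>D w. D \<noteq> 0 \<and> w \<in> Z \<and> const (fr D) * p = ?mc w}"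
  have "ideal N R'"
    unfolding ideal_mpoly_ring_iff[OF K']
  proof (intro conjI ballI)
    show "N \<subseteq> carrier R'" by (auto simp: N_def)
    have "0 \<in> Z" by (simp add: Z_def T_zero)
    moreover have "0 \<in> carrier R'" using const_R'[OF subring_setD(1)[OF K']] by simp
    ultimately show "0 \<in> N" unfolding N_def
      by (intro CollectI conjI exI[of _ 1] exI[of _ 0]) auto
  next
    fix x y assume "x \<in> N" "y \<in> N"
    then obtain D w E v where x: "x \<in> carrier R'" "D \<noteq> 0" "w \<in> Z" "const (fr D) * x = ?mc w"
      and y: "y \<in> carrier R'" "E \<noteq> 0" "v \<in> Z" "const (fr E) * y = ?mc v" unfolding N_def by blast
    have "const (fr (D * E)) * (x + y) = const (fr E) * (const (fr D) * x) + const (fr D) * (const (fr E) * y)"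
      by (simp add: coeff_hom.mult[OF fr_hom] algebra_simps)
    also have "\<dots> = ?mc (const E * w + const D * v)"
      unfolding x(4) y(4) by (simp add: mc_const)
    finally have "const (fr (D * E)) * (x + y) = ?mc (const E * w + const D * v)" .
    moreover have "const E * w \<in> Z" "const D * v \<in> Z" using x y by (auto intro: Z_mult)
    then have "const E * w + const D * v \<in> Z" unfolding Z_def using T_add by simp
    moreover have "D * E \<noteq> 0" using x y by simp
    ultimately show "x + y \<in> N"
      unfolding N_def using mpoly_ring_closed(2)[OF K' x(1) y(1)] by blast
  next
    fix r x assume r: "r \<in> carrier R'" and "x \<in> N"
    then obtain D w where x: "x \<in> carrier R'" "D \<noteq> 0" "w \<in> Z" "const (fr D) * x = ?mc w" unfolding N_def by blast
    obtain E s where s: "E \<noteq> 0" "s \<in> polys U" "const (fr E) * r = ?mc s"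
      using common_denominator[OF mpoly_carrierD(2)[OF r]] by blast
    have "const (fr (E * D)) * (r * x) = (const (fr E) * r) * (const (fr D) * x)"
      by (simp add: coeff_hom.mult[OF fr_hom] algebra_simps)
    also have "\<dots> = ?mc (s * w)" unfolding x(4) s(3) by simp
    finally have "const (fr (E * D)) * (r * x) = ?mc (s * w)" .
    moreover have "s * w \<in> Z" "E * D \<noteq> 0" using s x Z_mult by auto
    ultimately show "r * x \<in> N"
      unfolding N_def using mpoly_ring_closed(3)[OF K' r x(1)] by blast
  qed
  moreover have "gen_subst m d ` I \<subseteq> N"
  proof
    fix g assume g: "g \<in> gen_subst m d ` I"
    then obtain f where f: "f \<in> I" "g = ?mc (gen_subst_poly ?k f)" by (auto simp: gen_subst_eq)
    then have "gen_subst_poly ?k f \<in> Z"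
      by (auto simp: Z_def T_def map_coeff_eval_gen_subst_poly)
    moreover have "const (fr 1) * g = ?mc (gen_subst_poly ?k f)" using f by (simp add: coeff_hom.one[OF fr_hom])
    ultimately show "g \<in> N" unfolding N_def using g gen_subst_carrier one_neq_zero by blast
  qed
  ultimately have "I' \<subseteq> N" by (rule R'.genideal_minimal)
  then have "\<forall>t\<in>xmons U n. \<exists>D. D \<noteq> 0 \<and> Poly_Mapping.single t D \<in> Z"
  proof (intro ballI)
    fix t assume "t \<in> xmons U n"
    then have "xmon t \<in> N" using sub \<open>I' \<subseteq> N\<close> unfolding forms_subset_iff by blast
    then obtain D w where D: "D \<noteq> 0" "w \<in> Z" "const (fr D) * xmon t = ?mc w" unfolding N_def by blast
    have "?mc w = ?mc (Poly_Mapping.single t D)"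
      using D(3) by (simp add: coeff_hom.map_coeff_single[OF fr_hom] const_times_single)
    then have "w = Poly_Mapping.single t D" by (rule map_coeff_fr_inj)
    with D show "\<exists>D. D \<noteq> 0 \<and> Poly_Mapping.single t D \<in> Z" by blast
  qed
  then have "\<exists>D. \<forall>t\<in>xmons U n. D t \<noteq> 0 \<and> Poly_Mapping.single t (D t) \<in> Z" by (rule bchoice)
  then obtain D where D: "\<And>t. t \<in> xmons U n \<Longrightarrow> D t \<noteq> 0" "\<And>t. t \<in> xmons U n \<Longrightarrow> Poly_Mapping.single t (D t) \<in> Z"
    by blast
  have "(\<Prod>t\<in>xmons U n. D t) \<noteq> 0" using D(1) finite_xmons[of U n] by simp
  then obtain a where a: "ev a (\<Prod>t\<in>xmons U n. D t) \<noteq> 0" using eval_nonzero[OF inf] by blast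
  have "xmon t \<in> T a" if t: "t \<in> xmons U n" for t
  proof -
    note eva = coeff_hom.eval_coeff_hom[OF id_coeff_hom, of a]
    have "(\<Prod>t\<in>xmons U n. D t) = D t * (\<Prod>t\<in>xmons U n - {t}. D t)"
      using t by (intro prod.remove finite_xmons) auto
    then have nz: "ev a (D t) \<noteq> 0" using a by (auto simp: coeff_hom.mult[OF eva])
    have "map_coeff (ev a) (Poly_Mapping.single t (D t)) \<in> T a"
      using D(2)[OF t] unfolding Z_def by blast
    then have "Poly_Mapping.single t (ev a (D t)) \<in> T a"
      unfolding coeff_hom.map_coeff_single[OF eva] .
    then have "const (inverse (ev a (D t))) * Poly_Mapping.single t (ev a (D t)) \<in> T a"
      by (rule T_mult[rotated]) simp
    then show ?thesis using nz by (simp add: const_times_single)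
  qed
  then show ?thesis unfolding T_def by blast
qed

lemma forms_subset_iff_reducing:
  "forms K' U n \<subseteq> I' \<longleftrightarrow> (\<exists>a. F {1..m} n \<subseteq> idl {1..m} I d (lform (m - d) a))"
proof
  have km: "m - d + d = m" using dm by simp
  show "forms K' U n \<subseteq> I'" if ex: "\<exists>a. F {1..m} n \<subseteq> idl {1..m} I d (lform (m - d) a)"
  proof -
    obtain a where "F {1..m} n \<subseteq> idl {1..m} I d (lform (m - d) a)" using ex ..
    then show ?thesis using subst_of_F_subset[OF km hideal]
      by (intro forms_subset_if_specialization ballI)
  qed
  assume "forms K' U n \<subseteq> I'"
  then obtain a where "\<And>t. t \<in> xmons U n \<Longrightarrow> xmon t \<in> subst (m - d) a ` I"
    using specialization_if_forms_subset by blast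
  then have "F {1..m} n \<subseteq> idl {1..m} I d (lform (m - d) a)" by (rule F_subset_of_subst[OF km hideal])
  then show "\<exists>a. F {1..m} n \<subseteq> idl {1..m} I d (lform (m - d) a)" by (intro exI[of _ a])
qed

end

section \<open>Tuples solved for the last variables, and the conclusion\<close>

lemma zero_hideal: "hideal V {0}"
  by (auto simp: hideal_def pideal_def)

text \<open>Among these forms only \<open>lform k a p\<close> contains the variable with index k + 1
  + p.\<close>

lemma lform_independent:
  fixes c :: "nat \<Rightarrow> 'a::field"
  assumes "(\<Sum>i<d. const (c i) * lform k a i) = 0"
  shows "\<forall>i<d. c i = 0"
proof (intro allI impI)
  fix p assume p: "p < d"
  let ?t = "Poly_Mapping.single (k + 1 + p) 1 :: nat \<Rightarrow>\<^sub>0 nat"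
  have "lookup (lform k a i) ?t = (if i = p then 1 else 0)" for i
  proof -
    have inj: "Poly_Mapping.single x (1::nat) = Poly_Mapping.single y 1 \<longleftrightarrow> x = y" for x y :: nat
      by (metis lookup_single_eq lookup_single_not_eq zero_neq_one)
    have "lookup (\<Sum>j = 1..k. const (a (k + 1 + i, j)) * indet j) ?t = 0"
      by (simp add: lookup_sum indet_def lookup_single when_def inj[unfolded One_nat_def])
    then show ?thesis
      by (simp add: lform_def lookup_minus indet_def lookup_single when_def inj[unfolded One_nat_def])
  qed
  then have "lookup (\<Sum>i<d. const (c i) * lform k a i) ?t = c p"
    using p by (simp add: lookup_sum if_distrib[of "(*) _"] cong: if_cong)
  then show "c p = 0" by (simp add: assms)
qed

text \<open>A tuple spans the same space as some \<open>lform k a\<close> once it completes x_1,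
  ..., x_k to a spanning set of the linear forms. This is the reducing condition for the ideal
  \<open>X\<close> = (x_1, ..., x_k) in degree 1, and x_(k+1), ..., x_m satisfy it; so
  \<open>common_reduction\<close> yields a tuple that fulfils it and still reduces modulo
  \<open>I\<close> in degree \<open>n\<close>.\<close>

lemma reducing_lform:
  fixes I :: "(nat, 'a::field) mpoly set"
  assumes inf: "infinite (UNIV :: 'a set)" and I: "hideal {1..m} I" and km: "k + d = m"
    and l: "\<And>j. j < d \<Longrightarrow> l j \<in> F {1..m} 1" and red: "F {1..m} n \<subseteq> idl {1..m} I d l"
  shows "\<exists>a. F {1..m} n \<subseteq> idl {1..m} I d (lform k a)"
proof -
  let ?V = "{1..m}"
  let ?v = "\<lambda>j. indet (j + 1) :: (nat, 'a) mpoly"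
  have pidealI: "pideal ?V I" using I by (rule hidealD)
  have pideal0: "pideal ?V {0}" using zero_hideal by (rule hidealD)
  have vF: "?v j \<in> F ?V 1" if "j < m" for j using that by (intro indet_F) auto
  define X where "X = idl ?V {0} k ?v"
  have hidealX: "hideal ?V X" unfolding X_def
    by (rule idl_hideal[OF zero_hideal, where dg = "\<lambda>_. 1"]) (use vF km in auto)
  have pidealX: "pideal ?V X" using hidealX by (rule hidealD)
  have sF: "?v (k + j) \<in> F ?V 1" if "j < d" for j using that km by (intro vF) auto
  have "F ?V 1 \<subseteq> idl ?V X d (\<lambda>j. ?v (k + j))"
  proof -
    have K: "pideal ?V (idl ?V X d (\<lambda>j. ?v (k + j)))" by (rule idl_pideal[OF pidealX]) (rule F_polys[OF sF])
    have "?v j \<in> idl ?V X d (\<lambda>j. ?v (k + j))" if "j < m" for j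
    proof (cases "j < k")
      case True
      then have "?v j \<in> X" unfolding X_def by (rule idl_gen[OF pideal0])
      then show ?thesis by (rule idl_incl)
    next
      case False
      then show ?thesis using idl_gen[OF pidealX, of "j - k" d "\<lambda>j. ?v (k + j)"] that km by simp
    qed
    then have gen: "indet i \<in> idl ?V X d (\<lambda>j. ?v (k + j))" if "i \<in> ?V" for i
      using that by (cases i) auto
    have "xmon t \<in> idl ?V X d (\<lambda>j. ?v (k + j))" if t: "t \<in> xmons ?V 1" for t
    proof -
      obtain i u where u: "t = Poly_Mapping.single i 1 + u" "mon_degree u = 0"
        using t by (auto simp: xmons_def elim: mon_degree_SucE)
      then show ?thesis using gen[of i] t by (simp add: xmons_def indet_def)
    qed
    then show ?thesis unfolding F_subset_iff[OF K finite_atLeastAtMost] by blast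
  qed
  then obtain l' where l': "\<And>j. j < d \<Longrightarrow> l' j \<in> F ?V 1"
    and redI: "F ?V n \<subseteq> idl ?V I d l'" and redX: "F ?V 1 \<subseteq> idl ?V X d l'"
    using common_reduction[where l = l and l' = "\<lambda>j. ?v (k + j)" and e = d,
        OF inf finite_atLeastAtMost linear_space_F I hidealX l sF red] by blast
  \<comment> \<open>Modulo \<open>X\<close> the variable with index k + j + 1 is a combination of
    \<open>l'\<close>. The difference is a linear form in \<open>X\<close>, hence a combination of
    x_1, ..., x_k, and its coefficients become the row of \<open>a\<close> for this
    variable.\<close>
  have "\<exists>b c. lform k b j = (\<Sum>i<d. const (c i) * l' i)" if j: "j < d" for j
  proof -
    have x: "?v (k + j) \<in> F ?V 1" using sF j .
    obtain c where c: "?v (k + j) - (\<Sum>i<d. const (c i) * l' i) \<in> X"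
      using idl_F1_elem[where l = l' and e = d, OF hidealX l' x subsetD[OF redX x]] by blast
    have "?v (k + j) - (\<Sum>i<d. const (c i) * l' i) \<in> F ?V 1"
      using l' by (intro F_closed(4) x F_sum F_closed(5)) auto
    then obtain b where b: "?v (k + j) - (\<Sum>i<d. const (c i) * l' i) - (\<Sum>i<k. const (b i) * ?v i) = 0"
      using idl_F1_elem[where l = ?v and e = k, OF zero_hideal vF _ c[unfolded X_def]] km by auto
    have "(\<Sum>i = 1..k. const (b (i - 1)) * indet i) = (\<Sum>i<k. const (b i) * ?v i)"
      by (rule sum.reindex_bij_witness[of _ "\<lambda>i. i + 1" "\<lambda>i. i - 1"]) auto
    then have "lform k (\<lambda>(_, i). b (i - 1)) j = (\<Sum>i<d. const (c i) * l' i)"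
      using b by (simp add: lform_def algebra_simps)
    then show ?thesis by blast
  qed
  then have "\<exists>b. \<forall>j. j < d \<longrightarrow> (\<exists>c. lform k (b j) j = (\<Sum>i<d. const (c i) * l' i))"
    by (intro choice) blast
  then obtain b where b: "\<And>j. j < d \<Longrightarrow> \<exists>c. lform k (b j) j = (\<Sum>i<d. const (c i) * l' i)" by blast
  \<comment> \<open>The rows are glued: the variable with index \<open>i\<close> belongs to the form
    number i - (k + 1).\<close>
  define a where "a = (\<lambda>(i, j). b (i - (k + 1)) (i, j))"
  have ab: "lform k a j = lform k (b j) j" for j
    by (simp add: lform_def a_def)
  have "\<exists>M. \<forall>j. j < d \<longrightarrow> lform k a j - (\<Sum>i<d. const (M j i) * l' i) \<in> {0}"
    by (intro choice) (use b in \<open>auto simp: ab\<close>)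
  then obtain M where M: "\<And>j. j < d \<Longrightarrow> lform k a j - (\<Sum>i<d. const (M j i) * l' i) \<in> {0}" by blast
  have K: "pideal ?V (idl ?V I d (lform k a))"
    by (rule idl_pideal[OF pidealI]) (rule F_polys[OF lform_F[OF km]])
  have "l' j \<in> idl ?V I d (lform k a)" if j: "j < d" for j
  proof -
    \<comment> \<open>The solved forms are combinations of \<open>l'\<close>; being independent and
      equally many, they generate \<open>l'\<close> in turn.\<close>
    have "\<exists>c. l' j - (\<Sum>i<d. const (c i) * lform k a i) \<in> {0}"
    proof (rule exchange[OF pideal0])
      show "\<forall>i<d. c i = 0" if "(\<Sum>i<d. const (c i) * lform k a i) \<in> {0}" for c
        by (rule lform_independent) (use that in simp)
    qed (use M j in auto)
    then obtain c where "l' j = (\<Sum>i<d. const (c i) * lform k a i)" by auto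
    also have "\<dots> \<in> idl ?V I d (lform k a)"
      by (intro pideal_sum[OF K] pidealD(8)[OF K] idl_gen[OF pidealI]) auto
    finally show ?thesis .
  qed
  then have "idl ?V I d l' \<subseteq> idl ?V I d (lform k a)"
    by (intro idl_least[OF K]) (auto intro: idl_incl)
  with redI show ?thesis by blast
qed

text \<open>The variables generate all linear forms, so as many forms as there are variables suffice
  and \<open>reducible_bound\<close> applies. This makes m - d a genuine difference in the final
  theorem.\<close>

lemma (in mpoly_quotient) krull_dim_le_card:
  assumes "finite V" "krull_dim A = enat d"
  shows "d \<le> card V"
proof (rule ccontr)
  assume "\<not> d \<le> card V"
  then have chain: "has_chain V I (Suc (card V))" using krull_dim_chains(1)[OF assms(2)] by simp
  obtain h where h: "bij_betw h {..<card V} V"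
    using ex_bij_betw_nat_finite[OF assms(1)] by (auto simp: atLeast0LessThan)
  let ?l = "\<lambda>j. indet (h j) :: ('v, 'a) mpoly"
  have lF: "?l j \<in> F V 1" if "j < card V" for j
    using h that by (intro indet_F) (auto simp: bij_betw_def)
  have K: "pideal V (idl V I (card V) ?l)" by (rule idl_pideal[OF pideal]) (rule F_polys[OF lF])
  have "xmon t \<in> idl V I (card V) ?l" if t: "t \<in> xmons V 1" for t
  proof -
    obtain i u where u: "t = Poly_Mapping.single i 1 + u" "mon_degree u = 0"
      using t by (auto simp: xmons_def elim: mon_degree_SucE)
    then have "i \<in> V" using t by (auto simp: xmons_def keys_plus_nat)
    then obtain j where "j < card V" "i = h j" using h by (auto simp: bij_betw_def)
    then show ?thesis using idl_gen[OF pideal, of j "card V" ?l] u by (simp add: indet_def)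
  qed
  then have "F V 1 \<subseteq> idl V I (card V) ?l" unfolding F_subset_iff[OF K assms(1)] by blast
  then have "reducible V (F V 1) I (card V)"
    unfolding reducible_def using lF by (intro exI[of _ ?l] exI[of _ 1] conjI allI impI)
  from reducible_bound[OF assms(1) hideal this] chain show False by blast
qed

lemma (in generic_substitution) quot_piece_zero_iff:
  "quot_piece K' U I' n = {\<zero>\<^bsub>R' Quot I'\<^esub>} \<longleftrightarrow> forms K' U n \<subseteq> I'"
proof -
  interpret I': ideal I' R' by (rule I'_ideal)
  have carr: "f \<in> carrier R'" if "f \<in> forms K' U n" for f using that by (simp add: forms_def)
  have zero: "0 \<in> forms K' U n"
    using I'_props(1,2) by (auto simp: forms_def)
  have "I' +>\<^bsub>R'\<^esub> f = I' \<longleftrightarrow> f \<in> I'" if "f \<in> forms K' U n" for f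
    using I'.a_rcos_const I'.rcos_const_imp_mem carr[OF that] by blast
  then show ?thesis
    using zero unfolding quot_piece_def FactRing_def by (auto simp: set_eq_iff image_iff subset_iff)
qed

theorem corollary1p3:
  fixes m d :: nat
    and I :: "(nat, 'a::field) mpoly set"
    and R :: "(nat, 'a) mpoly ring"
    and A :: "(nat, 'a) mpoly set ring"
    and K' :: "(nat \<times> nat, 'a) mpoly fract set"
    and R' :: "(nat, (nat \<times> nat, 'a) mpoly fract) mpoly ring"
    and I' :: "(nat, (nat \<times> nat, 'a) mpoly fract) mpoly set"
    and r :: nat
  defines "R \<equiv> mpoly_ring UNIV {1..m}"
    and "A \<equiv> R Quot I"
    and "K' \<equiv> ratfuns (gen_indices m d)"
    and "R' \<equiv> mpoly_ring K' {1..m - d}"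
    and "I' \<equiv> Idl\<^bsub>R'\<^esub> (gen_subst m d ` I)"
    and "r \<equiv> reduction_number A (quot_piece UNIV {1..m} I)"
  assumes "infinite (UNIV :: 'a set)"
    and "homogeneous_ideal UNIV {1..m} I"
    and "I \<noteq> carrier R"
    and "krull_dim A = enat d"
  shows "quot_piece K' {1..m - d} I' r \<noteq> {\<zero>\<^bsub>R' Quot I'\<^esub>} \<and>
    (\<forall>n. quot_piece K' {1..m - d} I' n \<noteq> {\<zero>\<^bsub>R' Quot I'\<^esub>} \<longrightarrow> n \<le> r)"
proof -
  note inf = assms(7)
  have hideal: "hideal {1..m} I" using assms(8) by (rule homogeneous_ideal_hideal)
  interpret Q: mpoly_quotient "{1..m}" I by unfold_locales (rule hideal)
  have dim: "krull_dim Q.A = enat d" using assms(10) unfolding A_def R_def .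
  have r: "r = reduction_number Q.A Q.G" unfolding r_def A_def R_def ..
  have "d \<le> m" using Q.krull_dim_le_card[OF _ dim] by simp
  then interpret S: generic_substitution m d I by unfold_locales (use hideal inf in auto)
  have km: "m - d + d = m" using \<open>d \<le> m\<close> by simp
  have one: "1 \<notin> I" using Q.I.one_imp_carrier assms(9) unfolding R_def by auto
  have zero_iff: "quot_piece K' {1..m - d} I' n = {\<zero>\<^bsub>R' Quot I'\<^esub>} \<longleftrightarrow>
      (\<exists>a. F {1..m} n \<subseteq> idl {1..m} I d (lform (m - d) a))" for n
    unfolding K'_def R'_def I'_def S.quot_piece_zero_iff S.forms_subset_iff_reducing ..
  note char = Q.reduction_number_char[OF inf finite_atLeastAtMost one dim, folded r]
  have "\<not> F {1..m} r \<subseteq> idl {1..m} I d (lform (m - d) a)" for a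
  proof
    assume sub: "F {1..m} r \<subseteq> idl {1..m} I d (lform (m - d) a)"
    show False
    proof (cases r)
      \<comment> \<open>In degree 0 the linear forms contribute nothing, so \<open>I\<close> itself
        would contain 1.\<close>
      case 0
      have "1 \<in> idl {1..m} I d (lform (m - d) a)" using sub F_closed(7) unfolding 0 by blast
      then have "1 \<in> I"
        using F_idl_elem[where l = "lform (m - d) a" and e = d, OF hideal lform_F[OF km] F_closed(7)] by auto
      with one show False ..
    next
      \<comment> \<open>Generating all forms of degree r = n + 1 would bound the reduction number by
        \<open>n\<close>.\<close>
      case (Suc n)
      have "r \<le> n"
        by (rule char(2)[of "lform (m - d) a"])
          (use lform_F[OF km] sub in \<open>simp_all only: Suc Suc_eq_plus1 if_True\<close>)
      with Suc show False by simp
    qed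
  qed
  moreover have "n \<le> r" if n: "\<And>a. \<not> F {1..m} n \<subseteq> idl {1..m} I d (lform (m - d) a)" for n
  proof (rule ccontr)
    assume "\<not> n \<le> r"
    obtain l where l: "\<And>j. j < d \<Longrightarrow> l j \<in> F {1..m} 1" "F {1..m} (r + 1) \<subseteq> idl {1..m} I d l"
      using char(1) by blast
    obtain a where a: "F {1..m} (r + 1) \<subseteq> idl {1..m} I d (lform (m - d) a)"
      using reducing_lform[where l = l, OF inf hideal km l] by blast
    have "pideal {1..m} (idl {1..m} I d (lform (m - d) a))"
      by (rule idl_pideal[OF Q.pideal]) (rule F_polys[OF lform_F[OF km]])
    from F_subset_mono[OF this finite_atLeastAtMost a, of n] \<open>\<not> n \<le> r\<close> n show False by simp
  qed
  ultimately show ?thesis unfolding zero_iff by blast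
qed

end
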